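(* There are uncountably many irrational numbers $\alpha$ for which there exists a smooth function $r:\mathbb{T}^2\to\mathbb{R}^+$ such that the flow $(T^{\alpha,r}_t)$ on $(\mathbb{T}^2,\mu_r)$ is weakly mixing and there is an increasing sequence of numbers $(N_k)$ with $N_k\to+\infty$ such that for all $x\in\mathbb{T}^2$ the orbit of $x$ sampled at the primes $p<N_k$ is equidistributed in $\mathbb{T}^2$ with respect to $\mu_r$ as $k\to\infty$; that is, for every $x\in\mathbb{T}^2$ and every continuous $g:\mathbb{T}^2\to\mathbb{C}$, $$\frac{1}{\#\{p \text{ prime}: p<N_k\}}\sum_{\substack{p<N_k\\ p\text{ prime}}} g\big(T^{\alpha,r}_p(x)\big)\longrightarrow \int_{\mathbb{T}^2} g\,d\mu_r \qquad (k\to\infty).$$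
   Context: $\mathbb{T}=\mathbb{R}/\mathbb{Z}$, $\mathbb{T}^2=\mathbb{T}\times\mathbb{T}$, and $\mathbb{R}^+$ denotes the positive reals. For an irrational $\alpha$ and a smooth $r:\mathbb{T}^2\to\mathbb{R}^+$, $(T^{\alpha,r}_t)_{t\in\mathbb{R}}$ denotes the flow on $\mathbb{T}^2$ generated by $\frac{dx}{dt}=r(x,y)$, $\frac{dy}{dt}=\alpha\, r(x,y)$ (a reparametrization of the linear flow in direction $\alpha$), and $\mu_r$ denotes its unique invariant Borel probability measure. *)

theory Defs
  imports "HOL-Probability.Probability" "HOL-Computational_Algebra.Primes"
begin

quotient_type circle = real / "\<lambda>x y :: real. x - y \<in> \<int>"
  morphisms rep_circle to_circle
proof (rule equivpI)
  show "reflp (\<lambda>x y :: real. x - y \<in> \<int>)"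
    by (simp add: reflp_def)
  show "symp (\<lambda>x y :: real. x - y \<in> \<int>)"
    by (metis (no_types, lifting) Ints_minus minus_diff_eq sympI)
  show "transp (\<lambda>x y :: real. x - y \<in> \<int>)"
    by (rule transpI) (metis Ints_add add_diff_cancel_right' diff_add_cancel add_diff_eq)
qed

text \<open>The topology on \<open>circle\<close> is the quotient topology.\<close>

instantiation circle :: topological_space
begin

definition open_circle :: "circle set \<Rightarrow> bool" where
  "open_circle U \<longleftrightarrow> open (to_circle -` U)"

instance
  by standard (auto simp: open_circle_def vimage_Union)

end

type_synonym torus = "circle \<times> circle"

definition to_torus :: "real \<times> real \<Rightarrow> torus" where
  "to_torus = map_prod to_circle to_circle"

primrec C_k :: "nat \<Rightarrow> ('a::real_normed_vector \<Rightarrow> 'b::real_normed_vector) \<Rightarrow> bool" where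
  "C_k 0 f \<longleftrightarrow> continuous_on UNIV f"
| "C_k (Suc k) f \<longleftrightarrow> (\<forall>x. f differentiable at x) \<and>
     (\<forall>v. C_k k (\<lambda>x. frechet_derivative f (at x) v))"

definition smooth_on_torus :: "(torus \<Rightarrow> real) \<Rightarrow> bool" where
  "smooth_on_torus r \<longleftrightarrow> (\<forall>k. C_k k (r \<circ> to_torus))"

text \<open>
  \<open>\<Phi>\<close> is the flow of \<open>dx/dt = r(x,y)\<close>, \<open>dy/dt = \<alpha> r(x,y)\<close>. Each orbit is required to be the
  projection of a differentiable curve \<open>\<gamma>\<close> in the plane, which turns the equation on the torus
  into an ordinary one. For smooth \<open>r\<close> there is exactly one such \<open>\<Phi>\<close>.
\<close>

definition reparametrized_flow ::
    "real \<Rightarrow> (torus \<Rightarrow> real) \<Rightarrow> (real \<Rightarrow> torus \<Rightarrow> torus) \<Rightarrow> bool" where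
  "reparametrized_flow \<alpha> r \<Phi> \<longleftrightarrow>
     (\<forall>z. \<Phi> 0 z = z \<and>
       (\<exists>\<gamma> :: real \<Rightarrow> real \<times> real. \<forall>t. to_torus (\<gamma> t) = \<Phi> t z \<and>
          (\<gamma> has_vector_derivative (r (\<Phi> t z), \<alpha> * r (\<Phi> t z))) (at t)))"

definition invariant_prob :: "(real \<Rightarrow> 'a \<Rightarrow> 'a) \<Rightarrow> 'a::topological_space measure \<Rightarrow> bool" where
  "invariant_prob \<Phi> M \<longleftrightarrow> prob_space M \<and> sets M = sets borel \<and>
     (\<forall>t. \<Phi> t \<in> measurable M M \<and> distr M M (\<Phi> t) = M)"

definition unique_invariant_prob ::
    "(real \<Rightarrow> 'a \<Rightarrow> 'a) \<Rightarrow> 'a::topological_space measure \<Rightarrow> bool" where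
  "unique_invariant_prob \<Phi> M \<longleftrightarrow>
     invariant_prob \<Phi> M \<and> (\<forall>M'. invariant_prob \<Phi> M' \<longrightarrow> M' = M)"

definition weakly_mixing :: "(real \<Rightarrow> 'a \<Rightarrow> 'a) \<Rightarrow> 'a measure \<Rightarrow> bool" where
  "weakly_mixing \<Phi> M \<longleftrightarrow>
     (\<forall>A\<in>sets M. \<forall>B\<in>sets M.
       ((\<lambda>T. (1 / T) * (LINT t:{0..T}|lborel.
            \<bar>measure M ((\<Phi> t -` A \<inter> space M) \<inter> B) - measure M A * measure M B\<bar>)) \<longlongrightarrow> 0) at_top)"

end

theory Submission
  imports Defs "HOL-Library.Real_Mod"
begin

text \<open>
  Consider the flows \<open>Phi v a\<close> along the direction \<open>v\<close> of the plane, slowed down by the positive smooth function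
  \<open>phi a = 1 + (\<Sum>i. cf a i * cos (2 * pi * (kap i \<bullet> z)))\<close>; their invariant measure \<open>mu a\<close> has density
  \<open>phi a\<close> and does not depend on \<open>v\<close>. By the Baire category theorem in the space of
  parameters \<open>(v, a)\<close> it suffices to find, for both required properties, open dense conditions that imply them;
  given countably many slopes, the parameters avoiding them are generic as well, whence uncountability.

  Equidistribution at the primes up to a suitable \<open>N\<close>, tested against finitely many characters with some accuracy
  and uniformly in the starting point, is an open condition. It is dense: for finitely supported
  \<open>a\<close> and nonresonant \<open>v\<close> the flow is smoothly conjugate to a linear flow, and by orthogonality
  the mean square over \<open>v\<close> of an average of \<open>n\<close> distinct characters is \<open>1 / n\<close>, which is summable
  along a sparse sequence of \<open>N\<close>. So almost every linear flow equidistributes at primes along such a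
  sequence, and no information on exponential sums over primes is needed. Equidistribution of every orbit
  along the primes also yields unique ergodicity.

  Approximate mixing at a single time, again tested against finitely many characters, is an open condition too.
  It is dense because a perturbation makes \<open>v\<close> a rational direction of large height with
  exactly one resonant mode of small amplitude. Then all orbits are closed and their period varies with the
  orbit. Wiener's lemma shows that correlations decay on average over integer times, up to the small error coming from
  functions constant on orbits. A limit of such parameters is mixing along a sequence of times, which implies weak mixing.
\<close>

section \<open>The torus as a compact metric space\<close>

text \<open>The two properties pull in opposite directions. A flow with finitely many nonresonant
  modes is conjugate to a linear one, keeps nonconstant eigenfunctions and is never weakly mixing; a
  flow that nearly mixes at one time because its orbits are closed with varying periods is far from
  uniquely ergodic. Category lets each condition be checked on the approximants suited to it, since
  each involves the flow at finitely many times only. Two choices keep the perturbation theory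
  elementary. The free datum is the reciprocal of the speed: the elapsed time along a line is then a
  plain integral, continuous in the parameters even at resonances, and the invariant measure is
  explicit also for rational directions. The decay of the coefficients is prescribed once and for
  all, so smoothness never competes with the perturbations. The resonant mode has to be small
  because functions of the orbit are never mixed: the orbit means of a character differ from its
  space mean by a quantity of the size of that mode. It has to be nonzero because otherwise all
  orbits would have the same period.\<close>

definition dist_int :: "real \<Rightarrow> real" where
  "dist_int x = \<bar>x - of_int (round x)\<bar>"

lemma dist_int_le: "dist_int x \<le> \<bar>x - of_int m\<bar>"
  unfolding dist_int_def by (rule round_diff_minimal)

lemma dist_int_le_abs: "dist_int x \<le> \<bar>x\<bar>"
  using dist_int_le[of x 0] by simp

lemma dist_int_eq_0_iff: "dist_int x = 0 \<longleftrightarrow> x \<in> \<int>"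
  unfolding dist_int_def
  by (metis Ints_cases Ints_of_int abs_eq_0_iff diff_0_right eq_iff_diff_eq_0 round_of_int)

lemma dist_int_triangle: "dist_int (x + y) \<le> dist_int x + dist_int y"
proof -
  have "dist_int (x + y) \<le> \<bar>(x + y) - of_int (round x + round y)\<bar>"
    by (rule dist_int_le)
  also have "\<dots> \<le> dist_int x + dist_int y"
    by (simp add: dist_int_def)
  finally show ?thesis .
qed

lemma dist_int_uminus: "dist_int (- x) = dist_int x"
proof -
  have "dist_int (- y) \<le> dist_int y" for y
    using dist_int_le[of "- y" "- round y"] by (simp add: dist_int_def)
  from this[of x] this[of "- x"] show ?thesis by simp
qed

lemma dist_int_cong: "x - y \<in> \<int> \<Longrightarrow> dist_int x = dist_int y"
proof -
  assume *: "x - y \<in> \<int>"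
  then have "dist_int (x - y) = 0" "dist_int (y - x) = 0"
    using dist_int_eq_0_iff[of "x - y"] dist_int_uminus[of "x - y"] by simp_all
  with dist_int_triangle[of "x - y" y] dist_int_triangle[of "y - x" x] show ?thesis
    by simp
qed

lemma to_circle_eq_iff: "to_circle x = to_circle y \<longleftrightarrow> x - y \<in> \<int>"
  by (simp add: circle.abs_eq_iff)

lemma to_circle_rep [simp]: "to_circle (rep_circle w) = w"
  using Quotient_circle by (rule Quotient_abs_rep)

lemma rep_to_circle: "rep_circle (to_circle x) - x \<in> \<int>"
  using to_circle_eq_iff[of "rep_circle (to_circle x)" x] by simp

text \<open>The open sets are already fixed as those of the quotient, so beyond the metric axioms
  the instance has to show that balls of the distance to the nearest integer generate exactly the
  quotient topology.\<close>

instantiation circle :: metric_space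
begin

definition dist_circle :: "circle \<Rightarrow> circle \<Rightarrow> real" where
  "dist_circle a b = dist_int (rep_circle a - rep_circle b)"

definition uniformity_circle :: "(circle \<times> circle) filter" where
  "uniformity_circle = (INF e\<in>{0 <..}. principal {(x, y). dist x y < e})"

lemma dist_to_circle: "dist (to_circle x) (to_circle y) = dist_int (x - y)"
  unfolding dist_circle_def
proof (rule dist_int_cong)
  have "rep_circle (to_circle x) - rep_circle (to_circle y) - (x - y) =
      (rep_circle (to_circle x) - x) - (rep_circle (to_circle y) - y)" by simp
  also have "\<dots> \<in> \<int>" by (intro Ints_diff rep_to_circle)
  finally show "rep_circle (to_circle x) - rep_circle (to_circle y) - (x - y) \<in> \<int>" .
qed

instance
proof
  fix x y z :: circle
  show "dist x y = 0 \<longleftrightarrow> x = y"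
    by (metis dist_to_circle dist_int_eq_0_iff to_circle_eq_iff to_circle_rep)
  show "dist x y \<le> dist x z + dist y z"
    using dist_int_triangle[of "rep_circle x - rep_circle z" "rep_circle z - rep_circle y"]
      dist_int_uminus[of "rep_circle z - rep_circle y"]
    by (simp add: dist_circle_def)
  show "uniformity = (INF e\<in>{0 <..}. principal {(x, y :: circle). dist x y < e})"
    by (rule uniformity_circle_def)
  fix U :: "circle set"
  have op: "open U \<longleftrightarrow> (\<forall>x\<in>U. \<exists>e>0. \<forall>y. dist x y < e \<longrightarrow> y \<in> U)"
  proof safe
    fix x assume U: "open U" "x \<in> U"
    then have "open (to_circle -` U)" "rep_circle x \<in> to_circle -` U"
      by (simp_all add: open_circle_def)
    then obtain e where e: "e > 0" "\<And>t. dist t (rep_circle x) < e \<Longrightarrow> t \<in> to_circle -` U"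
      unfolding open_dist by blast
    have "y \<in> U" if y: "dist x y < e" for y
    proof -
      \<comment> \<open>A point close to \<open>x\<close> on the circle has a representative close
        to \<open>rep_circle x\<close>: subtract the integer nearest to the difference of the two
        chosen representatives.\<close>
      define u where "u = rep_circle y - rep_circle x"
      have "\<bar>u - of_int (round u)\<bar> < e"
        using y dist_int_uminus[of u] by (simp add: dist_circle_def dist_int_def u_def)
      then have "rep_circle y - of_int (round u) \<in> to_circle -` U"
        by (intro e(2)) (simp add: u_def dist_real_def)
      moreover have "to_circle (rep_circle y - of_int (round u)) = to_circle (rep_circle y)"
        by (simp only: to_circle_eq_iff) simp
      ultimately show ?thesis by simp
    qed
    then show "\<exists>e>0. \<forall>y. dist x y < e \<longrightarrow> y \<in> U" using e(1) by blast
  next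
    assume *: "\<forall>x\<in>U. \<exists>e>0. \<forall>y. dist x y < e \<longrightarrow> y \<in> U"
    show "open U" unfolding open_circle_def open_dist
    proof safe
      fix s assume "to_circle s \<in> U"
      with * obtain e where e: "e > 0" "\<And>y. dist (to_circle s) y < e \<Longrightarrow> y \<in> U" by blast
      have "to_circle t \<in> U" if "dist t s < e" for t
        using that dist_int_le_abs[of "s - t"]
        by (intro e(2)) (simp add: dist_to_circle dist_real_def abs_minus_commute)
      then show "\<exists>e>0. \<forall>y. dist y s < e \<longrightarrow> y \<in> to_circle -` U" using e(1) by auto
    qed
  qed
  have ev: "eventually P uniformity \<longleftrightarrow> (\<exists>e>0. \<forall>x y. dist x y < e \<longrightarrow> P (x, y))"
    for P :: "circle \<times> circle \<Rightarrow> bool"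
    unfolding uniformity_circle_def
    by (subst eventually_INF_base)
      (auto simp: eventually_principal subset_eq intro: bexI[of _ "min _ _"])
  show "open U \<longleftrightarrow> (\<forall>x\<in>U. \<forall>\<^sub>F (x', y) in uniformity. x' = x \<longrightarrow> y \<in> U)"
    unfolding op ev prod.case by (intro ball_cong refl) (metis (mono_tags))
qed

end

lemma continuous_on_to_circle [continuous_intros]:
  "continuous_on A f \<Longrightarrow> continuous_on A (\<lambda>x. to_circle (f x))"
proof -
  have "continuous_on UNIV to_circle"
    unfolding continuous_on_iff dist_to_circle
    by (metis dist_int_le_abs dist_real_def order_le_less_trans)
  then show "continuous_on A f \<Longrightarrow> continuous_on A (\<lambda>x. to_circle (f x))"
    using continuous_on_compose2 by blast
qed

lemma circle_UNIV: "(UNIV :: circle set) = to_circle ` {0..1}"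
proof -
  have "w \<in> to_circle ` {0..1}" for w
  proof -
    have "w = to_circle (frac (rep_circle w))"
      using to_circle_eq_iff[of "rep_circle w" "frac (rep_circle w)"] by (simp add: frac_def)
    moreover have "frac (rep_circle w) \<in> {0..1}"
      using frac_ge_0[of "rep_circle w"] frac_lt_1[of "rep_circle w"] by auto
    ultimately show ?thesis by blast
  qed
  then show ?thesis by auto
qed

lemma compact_torus: "compact (UNIV :: torus set)"
proof -
  have "compact (UNIV :: circle set)"
    unfolding circle_UNIV by (intro compact_continuous_image continuous_intros) auto
  then have "compact ((UNIV :: circle set) \<times> (UNIV :: circle set))" by (intro compact_Times)
  then show ?thesis by simp
qed

definition lat :: "(real \<times> real) set" where "lat = \<int> \<times> \<int>"

lemma lat_iff: "k \<in> lat \<longleftrightarrow> fst k \<in> \<int> \<and> snd k \<in> \<int>"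
  by (cases k) (simp add: lat_def)

definition rep_torus :: "torus \<Rightarrow> real \<times> real" where
  "rep_torus = map_prod rep_circle rep_circle"

lemma to_torus_rep [simp]: "to_torus (rep_torus w) = w"
  by (cases w) (simp add: to_torus_def rep_torus_def)

lemma to_torus_eq_iff: "to_torus z = to_torus z' \<longleftrightarrow> z - z' \<in> lat"
  by (cases z; cases z') (simp add: to_torus_def to_circle_eq_iff lat_iff)

lemma rep_to_torus: "rep_torus (to_torus z) - z \<in> lat"
  using to_torus_eq_iff[of "rep_torus (to_torus z)" z] by simp

lemma torus_cases: obtains z where "w = to_torus z"
  by (metis to_torus_rep)

lemma continuous_on_to_torus [continuous_intros]:
  "continuous_on A f \<Longrightarrow> continuous_on A (\<lambda>x. to_torus (f x))"
  by (auto simp: to_torus_def map_prod_def split_beta intro!: continuous_intros)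

text \<open>Nearby points of the torus lift to nearby points of the plane. The factor 2 pays for
  passing from a bound in each coordinate to the Euclidean distance.\<close>

lemma to_torus_near:
  assumes "dist (to_torus z) w < e"
  obtains z' where "w = to_torus z'" "dist z z' < 2 * e"
proof -
  obtain x y where z: "z = (x, y)" by (cases z)
  obtain a b where w: "w = (to_circle a, to_circle b)"
    by (metis prod.exhaust to_circle_rep)
  have d: "dist (to_circle x) (to_circle a) < e" "dist (to_circle y) (to_circle b) < e"
    using assms dist_fst_le[of "to_torus z" w] dist_snd_le[of "to_torus z" w]
    by (simp_all add: z w to_torus_def)
  define a' where "a' = a + of_int (round (x - a))"
  define b' where "b' = b + of_int (round (y - b))"
  have "w = to_torus (a', b')"
    by (simp add: w to_torus_def a'_def b'_def to_circle_eq_iff)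
  moreover have "dist x a' < e" "dist y b' < e"
    using d by (simp_all add: dist_to_circle dist_int_def a'_def b'_def dist_real_def)
  then have "dist z (a', b') < 2 * e"
    using real_sqrt_sum_squares_triangle_ineq[of "dist x a'" 0 0 "dist y b'"]
    by (simp add: z dist_Pair_Pair)
  ultimately show thesis using that by blast
qed

text \<open>Reduces continuity on the torus to that of periodic functions on the plane. The
  direction from the plane to the torus lifts neighbouring points by
  \<open>to_torus_near\<close>.\<close>

lemma continuous_on_torus_iff:
  fixes g :: "torus \<Rightarrow> 'b::metric_space"
  shows "continuous_on UNIV g \<longleftrightarrow> continuous_on UNIV (g \<circ> to_torus)"
proof
  assume "continuous_on UNIV g"
  then show "continuous_on UNIV (g \<circ> to_torus)"
    by (intro continuous_on_compose continuous_intros) (auto intro: continuous_on_subset continuous_on_to_torus[OF continuous_on_id])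
next
  assume c: "continuous_on UNIV (g \<circ> to_torus)"
  show "continuous_on UNIV g"
    unfolding continuous_on_iff
  proof (intro ballI allI impI)
    fix w and e :: real assume "e > 0"
    obtain z where z: "w = to_torus z" by (rule torus_cases)
    from c \<open>e > 0\<close> obtain d where d: "d > 0" "\<And>z'. dist z' z < d \<Longrightarrow> dist (g (to_torus z')) (g w) < e"
      unfolding continuous_on_iff z comp_def by (meson UNIV_I)
    have "dist (g w') (g w) < e" if "dist w' w < d / 2" for w'
    proof -
      from that obtain z' where "w' = to_torus z'" "dist z z' < 2 * (d / 2)"
        unfolding z dist_commute[of w'] by (rule to_torus_near)
      then show ?thesis using d(2)[of z'] by (simp add: dist_commute)
    qed
    then show "\<exists>d>0. \<forall>x'\<in>UNIV. dist x' w < d \<longrightarrow> dist (g x') (g w) < e"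
      using d(1) by (intro exI[of _ "d / 2"]) auto
  qed
qed

subsection \<open>Translations and characters\<close>

text \<open>The action of the plane by translations. It goes through a chosen representative;
  \<open>tshift_to_torus\<close> shows that the choice does not matter.\<close>

definition tshift :: "real \<times> real \<Rightarrow> torus \<Rightarrow> torus" where
  "tshift u w = to_torus (rep_torus w + u)"

lemma lat_add: "k \<in> lat \<Longrightarrow> l \<in> lat \<Longrightarrow> k + l \<in> lat"
  and lat_diff: "k \<in> lat \<Longrightarrow> l \<in> lat \<Longrightarrow> k - l \<in> lat"
  and lat_uminus: "k \<in> lat \<Longrightarrow> - k \<in> lat"
  and lat_0: "0 \<in> lat"
  by (auto simp: lat_iff)

lemma countable_lat: "countable lat"
proof -
  have "countable (\<int> :: real set)" unfolding Ints_def by simp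
  then show ?thesis by (simp add: lat_def)
qed

lemma tshift_to_torus: "tshift u (to_torus z) = to_torus (z + u)"
  unfolding tshift_def to_torus_eq_iff using rep_to_torus[of z] by (simp add: algebra_simps)

lemma tshift_tshift: "tshift u (tshift u' w) = tshift (u + u') w"
  by (cases w rule: torus_cases) (simp add: tshift_to_torus add_ac)

lemma tshift_0 [simp]: "tshift 0 w = w"
  by (simp add: tshift_def)

lemma tshift_lat: "k \<in> lat \<Longrightarrow> tshift k w = w"
  by (cases w rule: torus_cases) (simp add: tshift_to_torus to_torus_eq_iff)

text \<open>\<open>rep_circle\<close> is discontinuous, so continuity cannot be composed from the
  definition. Instead the distance of two translates is at most the distance of the points plus that
  of the shifts, which gives joint continuity.\<close>

lemma continuous_on_tshift [continuous_intros]: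
  assumes "continuous_on A f" "continuous_on A g"
  shows "continuous_on A (\<lambda>x. tshift (f x) (g x))"
proof -
  have shift: "dist (to_circle (rep_circle a + s)) (to_circle (rep_circle b + t)) \<le> dist a b + dist s t" for a b s t
  proof -
    have "dist (to_circle (rep_circle a + s)) (to_circle (rep_circle b + t)) =
        dist_int ((rep_circle a - rep_circle b) + (s - t))"
      by (simp add: dist_to_circle algebra_simps)
    also have "\<dots> \<le> dist a b + dist s t"
      using dist_int_triangle[of "rep_circle a - rep_circle b" "s - t"] dist_int_le_abs[of "s - t"]
      by (simp add: dist_circle_def dist_real_def)
    finally show ?thesis .
  qed
  have c: "continuous_on UNIV (\<lambda>(s, a). to_circle (rep_circle a + s))"
    unfolding continuous_on_iff
  proof (clarify)
    fix s a and e :: real assume e: "e > 0"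
    have "dist (to_circle (rep_circle b + t)) (to_circle (rep_circle a + s)) < e"
      if "dist (t, b) (s, a) < e / 2" for t b
      using that shift[of b t a s] dist_fst_le[of "(t, b)" "(s, a)"] dist_snd_le[of "(t, b)" "(s, a)"] by simp
    with e show "\<exists>d>0. \<forall>x'\<in>UNIV. dist x' (s, a) < d \<longrightarrow>
        dist (case x' of (s, a) \<Rightarrow> to_circle (rep_circle a + s)) (to_circle (rep_circle a + s)) < e"
      by (intro exI[of _ "e / 2"]) auto
  qed
  have c': "continuous_on A (\<lambda>x. to_circle (rep_circle (q x) + p x))"
    if "continuous_on A p" "continuous_on A q" for p q
    using continuous_on_compose2[OF c continuous_on_Pair[OF that]] by simp
  have "tshift (f x) (g x) = (to_circle (rep_circle (fst (g x)) + fst (f x)),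
      to_circle (rep_circle (snd (g x)) + snd (f x)))" for x
    by (cases "g x"; cases "f x") (simp add: tshift_def to_torus_def rep_torus_def)
  then show ?thesis
    by (simp, intro continuous_on_Pair c' continuous_on_fst continuous_on_snd assms)
qed

section \<open>Characters of the line and of the torus\<close>

definition ee :: "real \<Rightarrow> complex" where
  "ee x = cis (2 * pi * x)"

lemma ee_add: "ee (x + y) = ee x * ee y"
  by (simp add: ee_def cis_mult algebra_simps)

lemma ee_minus: "ee (- x) = cnj (ee x)"
  by (simp add: ee_def cis_cnj)

lemma ee_diff: "ee (x - y) = ee x * cnj (ee y)"
  using ee_add[of x "- y"] by (simp add: ee_minus)

lemma norm_ee [simp]: "cmod (ee x) = 1"
  by (simp add: ee_def)

lemma ee_0 [simp]: "ee 0 = 1"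
  by (simp add: ee_def)

lemma ee_mult_nat: "ee (real n * x) = ee x ^ n"
  by (simp add: ee_def Complex.DeMoivre mult.left_commute)

lemma ee_eq_1_iff: "ee x = 1 \<longleftrightarrow> x \<in> \<int>"
proof -
  have "ee x = 1 \<longleftrightarrow> (\<exists>n::int. 2 * pi * x = of_int n * (2 * pi))"
    by (simp add: ee_def cis_eq_1_iff)
  also have "\<dots> \<longleftrightarrow> (\<exists>n::int. x = of_int n)" by auto
  also have "\<dots> \<longleftrightarrow> x \<in> \<int>" by (auto elim: Ints_cases)
  finally show ?thesis .
qed

lemma ee_eq_iff: "ee x = ee y \<longleftrightarrow> x - y \<in> \<int>"
proof -
  have "ee x * cnj (ee y) = 1 \<longleftrightarrow> ee x = ee y"
  proof
    assume "ee x * cnj (ee y) = 1"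
    then have "ee x * (ee y * cnj (ee y)) = ee y" by (simp add: algebra_simps)
    then show "ee x = ee y" by (simp add: complex_norm_square[symmetric])
  next
    assume "ee x = ee y"
    then show "ee x * cnj (ee y) = 1" by (simp add: complex_norm_square[symmetric])
  qed
  then show ?thesis by (simp add: ee_eq_1_iff[symmetric] ee_diff)
qed

lemma continuous_on_ee [continuous_intros]:
  "continuous_on A f \<Longrightarrow> continuous_on A (\<lambda>x. ee (f x))"
  unfolding ee_def by (intro continuous_intros)

lemma ee_has_vector_derivative:
  "((\<lambda>u. ee (c * u)) has_vector_derivative (2 * pi * c) *\<^sub>R (\<i> * ee (c * u))) (at u)"
proof -
  have "((\<lambda>u. exp (\<i> * of_real (2 * pi * c) * of_real u)) has_vector_derivative
      \<i> * of_real (2 * pi * c) * exp (\<i> * of_real (2 * pi * c) * of_real u)) (at u)"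
    by (rule has_vector_derivative_real_field) (auto intro!: derivative_eq_intros)
  then show ?thesis by (simp add: ee_def cis_conv_exp scaleR_conv_of_real mult_ac)
qed

text \<open>Defined for every real frequency, so that \<open>tchi_add\<close> and
  \<open>tchi_uminus\<close> hold unconditionally; only for \<open>k \<in> lat\<close> is it
  independent of the representative and hence a character.\<close>

definition tchi :: "real \<times> real \<Rightarrow> torus \<Rightarrow> complex" where
  "tchi k w = ee (k \<bullet> rep_torus w)"

lemma lat_inner: "k \<in> lat \<Longrightarrow> l \<in> lat \<Longrightarrow> k \<bullet> l \<in> \<int>"
  by (auto simp: inner_prod_def lat_iff)

lemma tchi_to_torus: "k \<in> lat \<Longrightarrow> tchi k (to_torus z) = ee (k \<bullet> z)"
  unfolding tchi_def ee_eq_iff inner_diff_right[symmetric]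
  by (intro lat_inner rep_to_torus)

lemma tchi_tshift: "k \<in> lat \<Longrightarrow> tchi k (tshift u w) = ee (k \<bullet> u) * tchi k w"
  by (cases w rule: torus_cases)
    (simp add: tchi_to_torus tshift_to_torus inner_add_right ee_add)

lemma norm_tchi [simp]: "cmod (tchi k w) = 1"
  by (simp add: tchi_def)

lemma tchi_0 [simp]: "tchi 0 w = 1"
  by (simp add: tchi_def)

lemma tchi_add: "tchi (k + l) w = tchi k w * tchi l w"
  by (simp add: tchi_def inner_add_left ee_add)

lemma tchi_uminus: "tchi (- k) w = cnj (tchi k w)"
  by (simp add: tchi_def ee_minus)

lemma continuous_on_tchi:
  assumes "k \<in> lat" shows "continuous_on UNIV (tchi k)"
proof -
  have "tchi k \<circ> to_torus = (\<lambda>z. ee (k \<bullet> z))"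
    using assms by (auto simp: tchi_to_torus)
  then show ?thesis
    unfolding continuous_on_torus_iff by (simp, intro continuous_intros)
qed

lemma continuous_on_tchi' [continuous_intros]:
  "k \<in> lat \<Longrightarrow> continuous_on A f \<Longrightarrow> continuous_on A (\<lambda>x. tchi k (f x))"
  using continuous_on_compose2[OF continuous_on_tchi] by blast

lemma tchi_separates:
  assumes "\<And>k. k \<in> lat \<Longrightarrow> tchi k w = tchi k w'"
  shows "w = w'"
proof -
  have "(1, 0) \<bullet> (rep_torus w - rep_torus w') \<in> \<int>" "(0, 1) \<bullet> (rep_torus w - rep_torus w') \<in> \<int>"
    using assms[of "(1, 0)"] assms[of "(0, 1)"] by (simp_all add: tchi_def ee_eq_iff inner_diff_right lat_iff)
  then have "rep_torus w - rep_torus w' \<in> lat"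
    by (cases "rep_torus w - rep_torus w'") (simp add: lat_iff)
  then show ?thesis by (metis to_torus_eq_iff to_torus_rep)
qed

subsection \<open>Density of trigonometric polynomials\<close>

inductive_set trig :: "(real \<times> real \<Rightarrow> torus \<Rightarrow> complex) \<Rightarrow> (torus \<Rightarrow> complex) set"
  for E where
    trig_mono: "k \<in> lat \<Longrightarrow> (\<lambda>w. c * E k w) \<in> trig E"
  | trig_add: "P \<in> trig E \<Longrightarrow> Q \<in> trig E \<Longrightarrow> (\<lambda>w. P w + Q w) \<in> trig E"

text \<open>Besides the ordinary characters two further families are instances: \<open>Elin\<close>
  and \<open>Er\<close>, the characters in coordinates in which special flows become linear.
  Abstracting from the family yields density of their span without constructing the conjugating
  homeomorphism; all that remains of its injectivity is \<open>sep\<close>.\<close>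

locale char_family =
  fixes E :: "real \<times> real \<Rightarrow> torus \<Rightarrow> complex"
  assumes cont: "k \<in> lat \<Longrightarrow> continuous_on UNIV (E k)"
    and E_0: "E 0 w = 1"
    and E_add: "k \<in> lat \<Longrightarrow> l \<in> lat \<Longrightarrow> E (k + l) w = E k w * E l w"
    and E_cnj: "k \<in> lat \<Longrightarrow> E (- k) w = cnj (E k w)"
    and sep: "(\<And>k. k \<in> lat \<Longrightarrow> E k w = E k w') \<Longrightarrow> w = w'"
begin

lemma trig_cont: "P \<in> trig E \<Longrightarrow> continuous_on UNIV P"
  by (induction rule: trig.induct) (intro continuous_intros cont | assumption)+

lemma trig_scale: "P \<in> trig E \<Longrightarrow> (\<lambda>w. c * P w) \<in> trig E"
proof (induction rule: trig.induct)
  case (trig_mono k d)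
  then show ?case using trig.trig_mono[of k "c * d" E] by (simp add: mult_ac)
next
  case (trig_add P Q)
  then show ?case using trig.trig_add[of _ E] by (simp add: distrib_left)
qed

lemma trig_mult:
  assumes "P \<in> trig E" "Q \<in> trig E" shows "(\<lambda>w. P w * Q w) \<in> trig E"
  using assms(1)
proof (induction rule: trig.induct)
  case (trig_mono k c)
  from assms(2) show ?case
  proof (induction rule: trig.induct)
    case (trig_mono l d)
    have "(\<lambda>w. (c * d) * E (k + l) w) \<in> trig E"
      using \<open>k \<in> lat\<close> trig_mono by (intro trig.trig_mono lat_add)
    then show ?case using \<open>k \<in> lat\<close> trig_mono by (simp add: E_add mult_ac)
  next
    case (trig_add P Q)
    then show ?case using trig.trig_add[of _ E] by (simp add: distrib_left)
  qed
next
  case (trig_add P1 P2)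
  then show ?case using trig.trig_add[of _ E] by (simp add: distrib_right)
qed

lemma trig_ReIm:
  assumes "k \<in> lat"
  shows "(\<lambda>w. complex_of_real (Re (E k w))) \<in> trig E" "(\<lambda>w. complex_of_real (Im (E k w))) \<in> trig E"
proof -
  have r: "complex_of_real (Re z) = (1/2) * z + (1/2) * cnj z"
    and i: "complex_of_real (Im z) = (- \<i> / 2) * z + (\<i> / 2) * cnj z" for z
    by (simp_all add: complex_eq_iff)
  have m: "(\<lambda>w. c * E k w + d * cnj (E k w)) \<in> trig E" for c d
    using trig_add[OF trig_mono[OF assms, of c E] trig_mono[OF lat_uminus[OF assms], of d E]] assms
    by (simp add: E_cnj)
  show "(\<lambda>w. complex_of_real (Re (E k w))) \<in> trig E" "(\<lambda>w. complex_of_real (Im (E k w))) \<in> trig E"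
    unfolding r i by (rule m)+
qed

text \<open>Stone-Weierstrass for the ring of real functions whose complexification lies in
  \<open>trig E\<close>. Closure under conjugation puts the real and imaginary parts of each
  \<open>E k\<close> into this ring, and these separate points.\<close>

lemma trig_dense:
  fixes f :: "torus \<Rightarrow> complex"
  assumes f: "continuous_on UNIV f" and e: "0 < e"
  shows "\<exists>Q\<in>trig E. \<forall>w. cmod (f w - Q w) < e"
proof -
  define R where "R = {g. (\<lambda>w. complex_of_real (g w)) \<in> trig E}"
  interpret R: function_ring_on R UNIV
  proof
    show "compact (UNIV :: torus set)" by (rule compact_torus)
    show "continuous_on UNIV g" if "g \<in> R" for g
      using continuous_on_Re[OF trig_cont[of "\<lambda>w. complex_of_real (g w)"]] that by (simp add: R_def)
    show "(\<lambda>x. g x + h x) \<in> R" if "g \<in> R" "h \<in> R" for g h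
      using that trig_add[of "\<lambda>w. complex_of_real (g w)" E] by (simp add: R_def)
    show "(\<lambda>x. g x * h x) \<in> R" if "g \<in> R" "h \<in> R" for g h
      using that trig_mult[of "\<lambda>w. complex_of_real (g w)"] by (simp add: R_def)
    show "(\<lambda>_. c) \<in> R" for c
      using trig_mono[OF lat_0, of "complex_of_real c" E] by (simp add: R_def E_0)
    show "\<exists>g\<in>R. g x \<noteq> g y" if "x \<noteq> y" for x y
    proof -
      have "\<exists>k. k \<in> lat \<and> E k x \<noteq> E k y"
      proof (rule ccontr)
        assume "\<not> ?thesis"
        then have "x = y" by (intro sep) blast
        with that show False ..
      qed
      then obtain k where k: "k \<in> lat" "E k x \<noteq> E k y" by blast
      then have "Re (E k x) \<noteq> Re (E k y) \<or> Im (E k x) \<noteq> Im (E k y)" by (simp add: complex_eq_iff)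
      moreover have "(\<lambda>w. Re (E k w)) \<in> R" "(\<lambda>w. Im (E k w)) \<in> R"
        using trig_ReIm[OF k(1)] by (simp_all add: R_def)
      ultimately show ?thesis
        using bexI[of "\<lambda>g. g x \<noteq> g y" "\<lambda>w. Re (E k w)" R] bexI[of "\<lambda>g. g x \<noteq> g y" "\<lambda>w. Im (E k w)" R]
        by argo
    qed
  qed
  from f have "continuous_on UNIV (\<lambda>w. Re (f w))" "continuous_on UNIV (\<lambda>w. Im (f w))"
    using continuous_on_Re[OF f] continuous_on_Im[OF f] by simp_all
  then obtain g h where g: "g \<in> R" "\<And>w. \<bar>Re (f w) - g w\<bar> < e / 2"
    and h: "h \<in> R" "\<And>w. \<bar>Im (f w) - h w\<bar> < e / 2"
  proof -
    have "\<exists>g\<in>R. \<forall>x. \<bar>Re (f x) - g x\<bar> < e / 2" "\<exists>g\<in>R. \<forall>x. \<bar>Im (f x) - g x\<bar> < e / 2"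
      using R.Stone_Weierstrass_basic[OF \<open>continuous_on UNIV (\<lambda>w. Re (f w))\<close>, of "e / 2"]
        R.Stone_Weierstrass_basic[OF \<open>continuous_on UNIV (\<lambda>w. Im (f w))\<close>, of "e / 2"] e by simp_all
    then show thesis using that by blast
  qed
  define Q where "Q = (\<lambda>w. complex_of_real (g w) + \<i> * complex_of_real (h w))"
  have "Q \<in> trig E"
    unfolding Q_def using g(1) h(1) by (intro trig_add trig_scale) (simp_all add: R_def)
  moreover have "cmod (f w - Q w) < e" for w
    using cmod_le[of "f w - Q w"] g(2)[of w] h(2)[of w] by (simp add: Q_def)
  ultimately show ?thesis by blast
qed

text \<open>Density as an induction rule. It is the common skeleton of translation invariance of
  Haar measure, equidistribution, and convergence of functionals.\<close>

lemma continuous_induct [consumes 1, case_names mono add limit]: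
  fixes f :: "torus \<Rightarrow> complex"
  assumes f: "continuous_on UNIV f"
    and mono: "\<And>k c. k \<in> lat \<Longrightarrow> P (\<lambda>w. c * E k w)"
    and add: "\<And>g h. continuous_on UNIV g \<Longrightarrow> continuous_on UNIV h \<Longrightarrow> P g \<Longrightarrow> P h \<Longrightarrow> P (\<lambda>w. g w + h w)"
    and limit: "\<And>g. continuous_on UNIV g \<Longrightarrow>
      (\<And>e. e > 0 \<Longrightarrow> \<exists>h. continuous_on UNIV h \<and> P h \<and> (\<forall>w. cmod (g w - h w) < e)) \<Longrightarrow> P g"
  shows "P f"
proof (rule limit[OF f])
  fix e :: real assume "e > 0"
  then obtain Q where Q: "Q \<in> trig E" "\<forall>w. cmod (f w - Q w) < e" using trig_dense[OF f] by blast
  from Q(1) have "P Q" by (induction rule: trig.induct) (auto intro: mono add trig_cont)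
  then show "\<exists>h. continuous_on UNIV h \<and> P h \<and> (\<forall>w. cmod (f w - h w) < e)"
    using Q trig_cont by blast
qed

end

interpretation tchi: char_family tchi
proof
  show "w = w'" if "\<And>k. k \<in> lat \<Longrightarrow> tchi k w = tchi k w'" for w w'
    using that by (rule tchi_separates)
qed (simp_all add: tchi_add tchi_uminus continuous_on_tchi)

section \<open>Integration\<close>

lemma has_bochner_integral_ee:
  assumes "m \<in> \<int>"
  shows "has_bochner_integral lborel (\<lambda>x. indicator {a..a+1} x *\<^sub>R ee (m * x)) (of_bool (m = 0))"
proof (cases "m = 0")
  case True
  have "has_bochner_integral lborel (\<lambda>x. indicator {a..a+1} x *\<^sub>R (1::complex)) (measure lborel {a..a+1} *\<^sub>R 1)"
    by (intro has_bochner_integral_indicator) auto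
  with True show ?thesis by simp
next
  case False
  define F where "F = (\<lambda>x. ee (m * x) / (2 * pi * \<i> * m))"
  have "(F has_vector_derivative ee (m * x)) (at x)" for x
  proof -
    have "((\<lambda>u. ee (m * u) * (1 / (2 * pi * \<i> * m))) has_vector_derivative
        ((2 * pi * m) *\<^sub>R (\<i> * ee (m * x))) * (1 / (2 * pi * \<i> * m))) (at x)"
      by (intro has_vector_derivative_mult_left ee_has_vector_derivative)
    then show ?thesis using False by (simp add: F_def scaleR_conv_of_real field_simps)
  qed
  then have "has_bochner_integral lborel (\<lambda>x. indicator {a..a+1} x *\<^sub>R ee (m * x)) (F (a + 1) - F a)"
    by (intro has_bochner_integral_FTC_Icc)
      (auto intro: has_vector_derivative_at_within continuous_intros)
  moreover have "ee (m * (a + 1)) = ee (m * a)"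
    using assms by (simp add: ee_eq_iff algebra_simps)
  ultimately show ?thesis using False by (simp add: F_def)
qed

abbreviation unit_cell :: "real \<times> real \<Rightarrow> (real \<times> real) set" where
  "unit_cell c \<equiv> cbox c (c + (1, 1))"

lemma unit_cell_eq: "unit_cell c = {fst c..fst c + 1} \<times> {snd c..snd c + 1}"
  by (cases c) (auto simp: cbox_Pair_eq)

lemma emeasure_unit_cell: "emeasure lborel (unit_cell c) = 1"
proof -
  have "emeasure (lborel \<Otimes>\<^sub>M lborel) ({fst c..fst c + 1} \<times> {snd c..snd c + 1}) = (1 :: ennreal)"
    by (subst lborel.emeasure_pair_measure_Times) auto
  then show ?thesis by (simp add: unit_cell_eq lborel_prod)
qed

text \<open>The corner \<open>c\<close> is kept arbitrary: Haar measure uses the cell at 0, while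
  averages over directions use a cell around any given direction.\<close>

lemma integral_unit_cell_ee:
  assumes "k \<in> lat"
  shows "(LINT z|lborel. indicator (unit_cell c) z *\<^sub>R ee (k \<bullet> z)) = of_bool (k = 0)"
proof -
  obtain m n where k: "k = (m, n)" "m \<in> \<int>" "n \<in> \<int>" using assms by (auto simp: lat_def)
  define f where "f = (\<lambda>x. indicator {fst c..fst c + 1} x *\<^sub>R ee (m * x))"
  define g where "g = (\<lambda>x. indicator {snd c..snd c + 1} x *\<^sub>R ee (n * x))"
  have f: "has_bochner_integral lborel f (of_bool (m = 0))"
    and g: "has_bochner_integral lborel g (of_bool (n = 0))"
    unfolding f_def g_def using k has_bochner_integral_ee by auto
  have eq: "indicator (unit_cell c) z *\<^sub>R ee (k \<bullet> z) = f (fst z) * g (snd z)" for z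
    by (cases z) (auto simp: unit_cell_eq f_def g_def k indicator_def ee_add)
  have cell: "integrable lborel (\<lambda>z. indicator (unit_cell c) z *\<^sub>R ee (k \<bullet> z))"
    by (intro borel_integrable_compact continuous_intros) auto
  have int: "integrable (lborel \<Otimes>\<^sub>M lborel) (\<lambda>(x, y). f x * g y)"
    using cell unfolding eq lborel_prod by (simp add: case_prod_unfold)
  have "(LINT z|lborel. indicator (unit_cell c) z *\<^sub>R ee (k \<bullet> z)) =
      (LINT z|(lborel \<Otimes>\<^sub>M lborel). (case z of (x, y) \<Rightarrow> f x * g y))"
    unfolding eq lborel_prod by (simp add: case_prod_unfold)
  also have "\<dots> = (LINT x|lborel. LINT y|lborel. f x * g y)"
    using lborel_pair.integral_fst'[OF int] by simp
  also have "\<dots> = (LINT x|lborel. f x) * (LINT y|lborel. g y)" by simp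
  also have "\<dots> = of_bool (k = 0)"
    using f g by (auto simp: has_bochner_integral_iff k zero_prod_def)
  finally show ?thesis .
qed

definition haar :: "torus measure" where
  "haar = distr (density lborel (\<lambda>z. ennreal (indicator (unit_cell 0) z))) borel to_torus"

lemma measurable_to_torus [measurable]: "to_torus \<in> borel_measurable borel"
  by (intro borel_measurable_continuous_onI continuous_intros)

lemma sets_haar [simp, measurable_cong]: "sets haar = sets borel"
  by (simp add: haar_def)

lemma space_haar [simp]: "space haar = UNIV"
  by (simp add: haar_def)

lemma prob_space_haar: "prob_space haar"
proof -
  have "emeasure (density lborel (\<lambda>z. ennreal (indicator (unit_cell 0) z))) UNIV = 1"
    by (subst emeasure_density) (use emeasure_unit_cell[of 0] in \<open>auto simp: ennreal_indicator\<close>)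
  then have "prob_space (density lborel (\<lambda>z. ennreal (indicator (unit_cell 0) z)))"
    by (intro prob_spaceI) simp
  then show ?thesis unfolding haar_def by (rule prob_space.prob_space_distr) measurable
qed

interpretation haar: prob_space haar by (rule prob_space_haar)

lemma integral_haar:
  fixes f :: "torus \<Rightarrow> 'b::{banach, second_countable_topology}"
  assumes "f \<in> borel_measurable borel"
  shows "integral\<^sup>L haar f = (LINT z|lborel. indicator (unit_cell 0) z *\<^sub>R f (to_torus z))"
proof -
  have [measurable]: "f \<in> borel_measurable borel" by (fact assms)
  show ?thesis unfolding haar_def
    by (subst integral_distr) (auto simp: integral_density)
qed

lemma integral_tchi: "k \<in> lat \<Longrightarrow> (\<integral>w. tchi k w \<partial>haar) = of_bool (k = 0)"
  using integral_unit_cell_ee[of k 0]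
  by (subst integral_haar) (auto simp: tchi_to_torus intro: borel_measurable_continuous_onI continuous_on_tchi)

lemma torus_bounded:
  fixes f :: "torus \<Rightarrow> 'b::real_normed_vector"
  assumes "continuous_on UNIV f"
  obtains B where "B > 0" "\<And>w. norm (f w) \<le> B"
proof -
  have "bounded (range f)"
    using compact_continuous_image[OF assms compact_torus] by (rule compact_imp_bounded)
  then show thesis unfolding bounded_pos using that by auto
qed

lemma continuous_integrable:
  fixes f :: "torus \<Rightarrow> 'b::{banach, second_countable_topology}"
  assumes "continuous_on UNIV f" "finite_measure M" "sets M = sets borel"
  shows "integrable M f"
proof -
  interpret finite_measure M by fact
  obtain B where "\<And>w. norm (f w) \<le> B" using torus_bounded[OF assms(1)] by blast
  moreover have "f \<in> borel_measurable M"
    using borel_measurable_continuous_onI[OF assms(1)] measurable_cong_sets[OF assms(3) refl] by blast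
  ultimately show ?thesis by (intro integrable_const_bound[of _ B]) auto
qed

lemma haar_integrable:
  fixes f :: "torus \<Rightarrow> 'b::{banach, second_countable_topology}"
  shows "continuous_on UNIV f \<Longrightarrow> integrable haar f"
  by (rule continuous_integrable) (simp_all add: haar.finite_measure_axioms)

lemma norm_integral_le:
  fixes f :: "torus \<Rightarrow> 'b::{banach, second_countable_topology}"
  assumes "prob_space M" "integrable M f" "\<And>w. norm (f w) \<le> B"
  shows "norm (integral\<^sup>L M f) \<le> B"
proof -
  interpret prob_space M by fact
  have "norm (integral\<^sup>L M f) \<le> (\<integral>w. norm (f w) \<partial>M)" by (rule integral_norm_bound)
  also have "\<dots> \<le> (\<integral>w. B \<partial>M)" using assms by (intro integral_mono) auto
  also have "\<dots> = B" using prob_space by simp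
  finally show ?thesis .
qed

text \<open>For a character both sides vanish unless the frequency is 0, and then the character is
  constant. Density does the rest, so no change of variables modulo the lattice is carried
  out.\<close>

lemma haar_tshift:
  fixes f :: "torus \<Rightarrow> complex"
  assumes "continuous_on UNIV f"
  shows "(\<integral>w. f (tshift u w) \<partial>haar) = (\<integral>w. f w \<partial>haar)"
  using assms
proof (induction rule: tchi.continuous_induct)
  case (mono k c)
  then show ?case by (simp add: tchi_tshift integral_tchi)
next
  case (add g h)
  have c: "continuous_on UNIV (\<lambda>w. q (tshift u w))" if "continuous_on UNIV q" for q :: "torus \<Rightarrow> complex"
    using that by (rule continuous_on_compose2) (auto intro: continuous_intros)
  show ?case using add by (simp add: haar_integrable c)
next
  case (limit g)
  have c: "continuous_on UNIV (\<lambda>w. q (tshift u w))" if "continuous_on UNIV q" for q :: "torus \<Rightarrow> complex"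
    using that by (rule continuous_on_compose2) (auto intro: continuous_intros)
  let ?D = "(\<integral>w. g (tshift u w) \<partial>haar) - (\<integral>w. g w \<partial>haar)"
  have "cmod ?D \<le> e" if "e > 0" for e
  proof -
    from limit(2)[of "e / 2"] that obtain h where h: "continuous_on UNIV h"
      "(\<integral>w. h (tshift u w) \<partial>haar) = (\<integral>w. h w \<partial>haar)" "\<And>w. cmod (g w - h w) < e / 2" by auto
    have "?D = (\<integral>w. g (tshift u w) - h (tshift u w) \<partial>haar) - (\<integral>w. g w - h w \<partial>haar)"
      using h limit(1) by (simp add: haar_integrable c)
    also have "cmod \<dots> \<le> e / 2 + e / 2"
      using h(1,3) limit(1) by (intro norm_triangle_le_diff add_mono norm_integral_le[OF prob_space_haar] haar_integrable
         continuous_on_diff c less_imp_le)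
    finally show ?thesis by simp
  qed
  then have "cmod ?D \<le> 0" by (rule field_le_epsilon[of _ 0, simplified])
  then show ?case by simp
qed

subsection \<open>Continuous functions determine Borel measures\<close>

text \<open>The functions \<open>min 1 (n * infdist x (- U))\<close> do it. The whole space is
  treated apart because \<open>infdist\<close> to the empty set is 0 by convention.\<close>

lemma open_indicator_approx:
  fixes U :: "'a::metric_space set"
  assumes "open U"
  obtains f :: "nat \<Rightarrow> 'a \<Rightarrow> real" where "\<And>n. continuous_on UNIV (f n)" "\<And>n x. 0 \<le> f n x" "\<And>n x. f n x \<le> 1"
    "\<And>x. (\<lambda>n. f n x) \<longlonglongrightarrow> indicator U x"
proof (cases "U = UNIV")
  case True
  then show thesis using that[of "\<lambda>_ _. 1"] by simp
next
  case False
  define f where "f = (\<lambda>n x. min 1 (real n * infdist x (- U)))"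
  have "(\<lambda>n. f n x) \<longlonglongrightarrow> indicator U x" for x
  proof (cases "x \<in> U")
    case True
    have "infdist x (- U) \<noteq> 0"
      using True \<open>open U\<close> False in_closed_iff_infdist_zero[of "- U" x] by (auto simp: closed_def)
    then have d: "infdist x (- U) > 0" using infdist_nonneg[of x "- U"] by simp
    have "\<forall>\<^sub>F n in sequentially. f n x = 1"
      using eventually_ge_at_top[of "nat \<lceil>1 / infdist x (- U)\<rceil>"]
    proof eventually_elim
      case (elim n)
      then have "1 / infdist x (- U) \<le> real n" by linarith
      then show ?case using d by (simp add: f_def field_simps)
    qed
    then show ?thesis using True by (simp add: tendsto_eventually)
  next
    case False
    then show ?thesis by (simp add: f_def)
  qed
  moreover have "continuous_on UNIV (f n)" for n unfolding f_def by (intro continuous_intros)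
  ultimately show thesis using that[of f] by (simp add: f_def infdist_nonneg)
qed

lemma open_L1_approx:
  fixes M :: "'a::metric_space measure"
  assumes "finite_measure M" "sets M = sets borel" "open U"
  shows "\<exists>f :: nat \<Rightarrow> 'a \<Rightarrow> real. (\<forall>n. continuous_on UNIV (f n)) \<and> (\<forall>n x. 0 \<le> f n x \<and> f n x \<le> 1) \<and>
    (\<lambda>n. \<integral>x. \<bar>indicator U x - f n x\<bar> \<partial>M) \<longlonglongrightarrow> 0"
proof -
  interpret finite_measure M by fact
  note [measurable_cong] = assms(2)
  obtain f :: "nat \<Rightarrow> 'a \<Rightarrow> real" where f: "\<And>n. continuous_on UNIV (f n)" "\<And>n x. 0 \<le> f n x" "\<And>n x. f n x \<le> 1"
    "\<And>x. (\<lambda>n. f n x) \<longlonglongrightarrow> indicator U x" using open_indicator_approx[OF assms(3)] by blast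
  have [measurable]: "f n \<in> borel_measurable borel" for n
    by (intro borel_measurable_continuous_onI f)
  have [measurable]: "U \<in> sets borel" using assms(3) by simp
  have "(\<lambda>n. \<integral>x. \<bar>indicator U x - f n x\<bar> \<partial>M) \<longlonglongrightarrow> (\<integral>x. 0 \<partial>M)"
  proof (rule integral_dominated_convergence[where w = "\<lambda>_. 1"])
    show "AE x in M. (\<lambda>n. \<bar>indicator U x - f n x\<bar>) \<longlonglongrightarrow> 0"
      using f(4) by (auto intro!: AE_I2 tendsto_eq_intros)
    show "AE x in M. norm \<bar>indicator U x - f n x\<bar> \<le> 1" for n
    proof (rule AE_I2)
      fix x show "norm \<bar>indicator U x - f n x\<bar> \<le> 1"
        using f(2)[of n x] f(3)[of n x] by (auto simp: indicator_def)
    qed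
  qed auto
  then show ?thesis using f(1-3) by (intro exI[of _ f]) simp
qed

text \<open>Dominated convergence along cutoff functions gives equality on open sets, which form an
  intersection-stable generator of the Borel sets.\<close>

lemma measure_eqI_continuous:
  fixes M N :: "'a::metric_space measure"
  assumes M: "finite_measure M" "sets M = sets borel" and N: "finite_measure N" "sets N = sets borel"
    and eq: "\<And>f :: 'a \<Rightarrow> real. continuous_on UNIV f \<Longrightarrow> (\<And>x. 0 \<le> f x) \<Longrightarrow> (\<And>x. f x \<le> 1) \<Longrightarrow>
      integral\<^sup>L M f = integral\<^sup>L N f"
  shows "M = N"
proof (rule measure_eqI_generator_eq[where E = "{S. open S}" and \<Omega> = UNIV and A = "\<lambda>_. UNIV"])
  interpret M: finite_measure M by fact
  interpret N: finite_measure N by fact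
  show "Int_stable {S :: 'a set. open S}" by (auto simp: Int_stable_def)
  show "sets M = sigma_sets UNIV {S. open S}" "sets N = sigma_sets UNIV {S. open S}"
    using M(2) N(2) by (simp_all add: borel_def)
  show "emeasure M UNIV \<noteq> \<infinity>" by simp
  show "emeasure M U = emeasure N U" if "U \<in> {S. open S}" for U
  proof -
    have "open U" using that by simp
    obtain f where f: "\<And>n. continuous_on UNIV (f n)" "\<And>n x. 0 \<le> f n x" "\<And>n x. f n x \<le> (1::real)"
      "\<And>x. (\<lambda>n. f n x) \<longlonglongrightarrow> indicator U x"
      using open_indicator_approx[OF \<open>open U\<close>] by blast
    have lim: "(\<lambda>n. \<integral>x. f n x \<partial>L) \<longlonglongrightarrow> measure L U" if L: "finite_measure L" "sets L = sets borel" for L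
    proof -
      interpret L: finite_measure L by fact
      note [measurable_cong] = L(2)
      have [measurable]: "f n \<in> borel_measurable borel" for n
        by (intro borel_measurable_continuous_onI f)
      have [measurable]: "U \<in> sets borel" using \<open>U \<in> {S. open S}\<close> by simp
      have "(\<lambda>n. \<integral>x. f n x \<partial>L) \<longlonglongrightarrow> (\<integral>x. indicator U x \<partial>L)"
      proof (rule integral_dominated_convergence[where w = "\<lambda>_. 1"])
        show "AE x in L. norm (f n x) \<le> 1" for n using f(2,3)[of n] by (auto intro!: AE_I2)
      qed (use f(4) in auto)
      then show ?thesis using L(2) by (simp add: sets_eq_imp_space_eq)
    qed
    have "measure M U = measure N U"
      using LIMSEQ_unique[OF lim[OF M]] lim[OF N] eq[OF f(1-3)] by simp
    then show ?thesis by (simp add: M.emeasure_eq_measure N.emeasure_eq_measure)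
  qed
qed auto

lemma eventually_sequentially_ex: "eventually P sequentially \<Longrightarrow> \<exists>n. P n"
  by (auto simp: eventually_sequentially)

text \<open>The sets that can be approximated for every \<open>e\<close> contain the open sets and
  are closed under complements and countable disjoint unions. Values are kept in the unit interval
  because products of such approximations are estimated later.\<close>

lemma L1_approx:
  fixes M :: "'a::metric_space measure"
  assumes M: "finite_measure M" "sets M = sets borel" and A: "A \<in> sets borel" and e: "0 < e"
  shows "\<exists>f. continuous_on UNIV f \<and> (\<forall>x. 0 \<le> f x \<and> f x \<le> 1) \<and> (\<integral>x. \<bar>indicator A x - f x :: real\<bar> \<partial>M) < e"
proof -
  interpret finite_measure M by fact
  note [measurable_cong] = M(2)
  have space: "space M = UNIV" using M(2) by (simp add: sets_eq_imp_space_eq)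
  have A': "A \<in> sigma_sets UNIV {S. open S}" using A by (simp add: borel_def)
  have stable: "Int_stable {S :: 'a set. open S}" by (auto simp: Int_stable_def)
  have sub: "{S :: 'a set. open S} \<subseteq> Pow UNIV" by simp
  have borel: "B \<in> sets borel" if "B \<in> sigma_sets UNIV {S. open S}" for B :: "'a set"
    using that by (simp add: borel_def)
  have ii: "integrable M f" if "f \<in> borel_measurable M" "\<And>x. \<bar>f x\<bar> \<le> (B::real)" for f B
  proof (rule integrable_const_bound)
    show "AE x in M. norm (f x) \<le> B" using that(2) by (simp add: AE_I2)
  qed (rule that(1))
  define Q where "Q = (\<lambda>A e. \<exists>f. continuous_on UNIV f \<and> (\<forall>x. 0 \<le> f x \<and> f x \<le> 1) \<and>
    (\<integral>x. \<bar>indicator A x - f x :: real\<bar> \<partial>M) < e)"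
  have "\<forall>e>0. Q A e"
    using stable sub A'
  proof (induction A rule: sigma_sets_induct_disjoint)
    case (basic U)
    show ?case
    proof (intro allI impI)
    fix e :: real assume e: "e > 0"
    have "open U" using basic by simp
    obtain f :: "nat \<Rightarrow> 'a \<Rightarrow> real" where f: "\<forall>n. continuous_on UNIV (f n)" "\<forall>n x. 0 \<le> f n x \<and> f n x \<le> 1"
      "(\<lambda>n. \<integral>x. \<bar>indicator U x - f n x\<bar> \<partial>M) \<longlonglongrightarrow> 0"
      using open_L1_approx[OF M \<open>open U\<close>] by (elim exE conjE)
    obtain n where "(\<integral>x. \<bar>indicator U x - f n x :: real\<bar> \<partial>M) < e"
      using eventually_sequentially_ex[OF order_tendstoD(2)[OF f(3) e]] ..
    then show "Q U e" unfolding Q_def using f(1,2) by (intro exI[of _ "f n"]) simp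
    qed
  next
    case empty
    show ?case unfolding Q_def by (intro allI impI exI[of _ "\<lambda>_. 0"]) simp
  next
    case (compl B)
    show ?case
    proof (intro allI impI)
    fix e :: real assume e: "e > 0"
    with compl have "Q B e" by simp
    then obtain f where f: "continuous_on UNIV f" "\<forall>x. 0 \<le> f x \<and> f x \<le> 1"
      "(\<integral>x. \<bar>indicator B x - f x :: real\<bar> \<partial>M) < e" unfolding Q_def by (elim exE conjE)
    have "\<bar>indicator (UNIV - B) x - (1 - f x)\<bar> = \<bar>indicator B x - f x :: real\<bar>" for x
      by (auto simp: indicator_def)
    then show "Q (UNIV - B) e" unfolding Q_def using f
      by (intro exI[of _ "\<lambda>x. 1 - f x"]) (auto intro: continuous_intros)
    qed
  next
    case (union B)
    show ?case
    proof (intro allI impI)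
    fix e :: real assume e: "e > 0"
    have [measurable]: "B i \<in> sets borel" for i using union(2) borel by blast
    \<comment> \<open>Only finitely many members of the union can be approximated at once; the tail
      is dropped at a cost of measure below \<open>e / 2\<close>.\<close>
    define S where "S n = (\<Union>i<n. B i)" for n
    have [measurable]: "S n \<in> sets borel" for n by (simp add: S_def)
    have "(\<lambda>n. measure M (S n)) \<longlonglongrightarrow> measure M (\<Union>n. S n)"
    proof (rule finite_Lim_measure_incseq)
      show "incseq S" unfolding S_def by (intro incseq_SucI UN_mono) auto
    qed auto
    moreover have "(\<Union>n. S n) = (\<Union>i. B i)" by (auto simp: S_def)
    ultimately have "(\<lambda>n. measure M (\<Union>i. B i) - measure M (S n)) \<longlonglongrightarrow>
        measure M (\<Union>i. B i) - measure M (\<Union>i. B i)"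
      by (intro tendsto_intros) simp
    then have "\<forall>\<^sub>F n in sequentially. measure M (\<Union>i. B i) - measure M (S n) < e / 2"
      by (rule order_tendstoD(2)) (use e in simp)
    from eventually_sequentially_ex[OF this]
    obtain n where n: "measure M (\<Union>i. B i) - measure M (S n) < e / 2" ..
    have "\<exists>f. continuous_on UNIV f \<and> (\<forall>x. 0 \<le> f x \<and> f x \<le> 1) \<and>
        (\<integral>x. \<bar>indicator (B i) x - f x :: real\<bar> \<partial>M) < e / (2 * (real n + 1))" for i
      using union(3)[of i] e unfolding Q_def by simp
    then have "\<exists>f. \<forall>i. continuous_on UNIV (f i) \<and> (\<forall>x. 0 \<le> f i x \<and> f i x \<le> 1) \<and>
        (\<integral>x. \<bar>indicator (B i) x - f i x :: real\<bar> \<partial>M) < e / (2 * (real n + 1))" by (intro choice allI)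
    then obtain f :: "nat \<Rightarrow> 'a \<Rightarrow> real" where f: "\<And>i. continuous_on UNIV (f i)" "\<And>i x. 0 \<le> f i x" "\<And>i x. f i x \<le> 1"
      "\<And>i. (\<integral>x. \<bar>indicator (B i) x - f i x :: real\<bar> \<partial>M) < e / (2 * (real n + 1))" by auto
    have [measurable]: "f i \<in> borel_measurable borel" for i
      by (intro borel_measurable_continuous_onI f)
    \<comment> \<open>Cutting off at 1 restores the bound and cannot increase the distance to an
      indicator function.\<close>
    define g where "g = (\<lambda>x. min 1 (\<Sum>i<n. f i x))"
    have g: "continuous_on UNIV g" "\<And>x. 0 \<le> g x" "\<And>x. g x \<le> 1"
      unfolding g_def by (auto intro!: continuous_intros f sum_nonneg)
    have [measurable]: "g \<in> borel_measurable borel" by (intro borel_measurable_continuous_onI g)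
    have bound: "\<bar>indicator (B i) x - f i x\<bar> \<le> 1" for i x
      using f(2,3)[of i x] by (auto simp: indicator_def)
    have pw: "\<bar>indicator (\<Union>i. B i) x - g x\<bar> \<le>
        (indicator (\<Union>i. B i) x - indicator (S n) x) + (\<Sum>i<n. \<bar>indicator (B i) x - f i x\<bar>)" for x
    proof -
      have "indicator (S n) x = (\<Sum>i<n. indicator (B i) x :: real)"
        unfolding S_def using union(1) by (intro indicator_UN_disjoint) (auto simp: disjoint_family_on_def)
      then have "\<bar>indicator (S n) x - (\<Sum>i<n. f i x)\<bar> \<le> (\<Sum>i<n. \<bar>indicator (B i) x - f i x\<bar>)"
        by (simp add: sum_subtractf[symmetric] sum_abs)
      moreover have "\<bar>indicator (S n) x - g x\<bar> \<le> \<bar>indicator (S n) x - (\<Sum>i<n. f i x)\<bar>"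
        by (auto simp: g_def indicator_def)
      moreover have "indicator (S n) x \<le> (indicator (\<Union>i. B i) x :: real)"
        by (auto simp: S_def indicator_def)
      ultimately show ?thesis by linarith
    qed
    have "(\<integral>x. \<bar>indicator (\<Union>i. B i) x - g x\<bar> \<partial>M) \<le>
        (\<integral>x. (indicator (\<Union>i. B i) x - indicator (S n) x) + (\<Sum>i<n. \<bar>indicator (B i) x - f i x\<bar>) \<partial>M)"
    proof (intro integral_mono pw)
      have "\<bar>indicator (\<Union>i. B i) x - g x\<bar> \<le> 1" for x using g(2,3)[of x] by (auto simp: indicator_def)
      then show "integrable M (\<lambda>x. \<bar>indicator (\<Union>i. B i) x - g x\<bar>)" by (intro ii[of _ 1]) auto
      show "integrable M (\<lambda>x. (indicator (\<Union>i. B i) x - indicator (S n) x) + (\<Sum>i<n. \<bar>indicator (B i) x - f i x\<bar>))"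
        using bound by (intro Bochner_Integration.integrable_add Bochner_Integration.integrable_diff
            Bochner_Integration.integrable_sum ii[of _ 1]) (auto simp: indicator_def)
    qed
    also have "\<dots> = (measure M (\<Union>i. B i) - measure M (S n)) + (\<Sum>i<n. \<integral>x. \<bar>indicator (B i) x - f i x\<bar> \<partial>M)"
    proof -
      have a: "integrable M (\<lambda>x. indicator (\<Union>i. B i) x :: real)" "integrable M (\<lambda>x. indicator (S n) x :: real)"
        by (intro ii[of _ 1]; auto simp: indicator_def)+
      have b: "integrable M (\<lambda>x. \<bar>indicator (B i) x - f i x\<bar>)" for i
        using bound by (intro ii[of _ 1]) auto
      show ?thesis using a b by (simp add: space)
    qed
    also have "(\<Sum>i<n. \<integral>x. \<bar>indicator (B i) x - f i x\<bar> \<partial>M) \<le> (\<Sum>i<n. e / (2 * (real n + 1)))"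
      using f(4) by (intro sum_mono less_imp_le)
    also have "\<dots> \<le> e / 2" using e by (simp add: field_simps)
    finally show "Q (\<Union>i. B i) e" unfolding Q_def using n g by (intro exI[of _ g]) auto
    qed
  qed
  then show ?thesis using e unfolding Q_def by blast
qed

section \<open>Weak mixing from mixing along a sequence\<close>

lemma antiderivative_real:
  fixes f :: "real \<Rightarrow> 'a::euclidean_space"
  assumes "continuous_on UNIV f"
  shows "\<exists>G. \<forall>x. (G has_vector_derivative f x) (at x)"
proof -
  have "\<And>x. isCont f x" using assms by (simp add: continuous_on_eq_continuous_at)
  then show ?thesis using einterval_antiderivative[of "-\<infinity>" "\<infinity>" f] by auto
qed

text \<open>An antiderivative is 1-Lipschitz, so shifting the interval changes the integral by at
  most \<open>\<bar>s\<bar>\<close> at each end, independently of \<open>T\<close>.\<close>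

lemma integral_shift_le:
  fixes f :: "real \<Rightarrow> real"
  assumes f: "continuous_on UNIV f" and bound: "\<And>x. 0 \<le> f x" "\<And>x. f x \<le> 1" and T: "0 \<le> T"
  shows "integral {0..T} f \<le> integral {0..T} (\<lambda>t. f (t + s)) + 2 * \<bar>s\<bar>"
proof -
  obtain G where G: "\<And>x. (G has_vector_derivative f x) (at x)"
    using antiderivative_real[OF f] by blast
  have lip: "\<bar>G x - G y\<bar> \<le> \<bar>x - y\<bar>" for x y
    using field_differentiable_bound[of UNIV G f 1 y x] G bound
    by (simp add: has_real_derivative_iff_has_vector_derivative)
  have "((\<lambda>t. f (t + s)) has_integral (G (T + s) - G (0 + s))) {0..T}"
  proof (rule fundamental_theorem_of_calculus[OF T])
    fix x
    have "((\<lambda>t. t + s) has_vector_derivative 1) (at x within {0..T})"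
      by (auto intro!: derivative_eq_intros)
    from vector_diff_chain_within[OF this has_vector_derivative_at_within[OF G]]
    show "((\<lambda>t. G (t + s)) has_vector_derivative f (x + s)) (at x within {0..T})"
      by (simp add: o_def)
  qed
  moreover have "(f has_integral (G T - G 0)) {0..T}"
    by (rule fundamental_theorem_of_calculus[OF T]) (auto intro: has_vector_derivative_at_within[OF G])
  ultimately show ?thesis
    using lip[of T "T + s"] lip[of "0 + s" 0] by (simp add: integral_unique)
qed

text \<open>A second-moment argument in place of spectral theory: instead of excluding
  eigenfunctions, it bounds the averages of the correlations themselves. Continuity in time is
  assumed because those averages are integrals over \<open>t\<close>.\<close>

lemma weakly_mixing_of_sequence:
  fixes M :: "'a::topological_space measure"
  assumes inv: "invariant_prob \<Phi> M"
    and flow: "\<And>s t z. \<Phi> (s + t) z = \<Phi> s (\<Phi> t z)"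
    and cont: "\<And>A B. A \<in> sets M \<Longrightarrow> B \<in> sets M \<Longrightarrow> continuous_on UNIV (\<lambda>t. measure M (\<Phi> t -` A \<inter> B))"
    and mix: "\<And>A B. A \<in> sets M \<Longrightarrow> B \<in> sets M \<Longrightarrow>
      (\<lambda>j. measure M (\<Phi> (\<tau> j) -` A \<inter> B)) \<longlonglongrightarrow> measure M A * measure M B"
  shows "weakly_mixing \<Phi> M"
  unfolding weakly_mixing_def
proof (intro ballI)
  fix A B assume A: "A \<in> sets M" and B: "B \<in> sets M"
  interpret prob_space M using inv by (simp add: invariant_prob_def)
  have sM: "sets M = sets borel" using inv by (simp add: invariant_prob_def)
  have space [simp]: "space M = UNIV" using sM by (simp add: sets_eq_imp_space_eq)
  have meas [measurable]: "\<Phi> t \<in> measurable M M" and distr: "distr M M (\<Phi> t) = M" for t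
    using inv by (simp_all add: invariant_prob_def)
  have pre: "\<Phi> t -` C \<in> sets M" "measure M (\<Phi> t -` C) = measure M C" if "C \<in> sets M" for t C
    using measurable_sets[OF meas that, of t] measure_distr[OF meas that, of t] distr[of t] by simp_all
  define a where "a = measure M A"
  define b where "b = measure M B"
  define c where "c t = measure M (\<Phi> t -` A \<inter> B) - a * b" for t
  have a01: "0 \<le> a" "a \<le> 1" "0 \<le> b" "b \<le> 1" by (simp_all add: a_def b_def)
  have c1: "\<bar>c t\<bar> \<le> 1" for t
  proof -
    have "0 \<le> a * b" "a * b \<le> 1" using a01 by (auto intro: mult_le_one)
    moreover have "0 \<le> measure M (\<Phi> t -` A \<inter> B)" "measure M (\<Phi> t -` A \<inter> B) \<le> 1" by simp_all
    ultimately show ?thesis unfolding c_def by linarith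
  qed
  have c_cont: "continuous_on UNIV c" unfolding c_def using cont[OF A B] by (intro continuous_intros)
  \<comment> \<open>Each new time is taken from \<open>\<tau>\<close>, far enough along that
    \<open>A\<close> is nearly independent of the finitely many preimages chosen before. By
    invariance these all have measure \<open>a\<close>, so the limit is
    \<open>a * a\<close>.\<close>
  have indep: "\<exists>s. \<forall>i<n. \<forall>l<i. \<bar>measure M (\<Phi> (s i) -` A \<inter> \<Phi> (s l) -` A) - a * a\<bar> \<le> \<epsilon>"
    if "\<epsilon> > 0" for n :: nat and \<epsilon>
  proof (induction n)
    case (Suc n)
    then obtain s where s: "\<forall>i<n. \<forall>l<i. \<bar>measure M (\<Phi> (s i) -` A \<inter> \<Phi> (s l) -` A) - a * a\<bar> \<le> \<epsilon>" by blast
    have "\<forall>l<n. \<forall>\<^sub>F j in sequentially. \<bar>measure M (\<Phi> (\<tau> j) -` A \<inter> \<Phi> (s l) -` A) - a * a\<bar> < \<epsilon>"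
      using tendstoD[OF mix[OF A pre(1)[OF A]] \<open>\<epsilon> > 0\<close>] by (simp add: pre A a_def dist_real_def)
    then have "\<forall>\<^sub>F j in sequentially. \<forall>l\<in>{..<n}. \<bar>measure M (\<Phi> (\<tau> j) -` A \<inter> \<Phi> (s l) -` A) - a * a\<bar> < \<epsilon>"
      by (intro eventually_ball_finite) auto
    from eventually_sequentially_ex[OF this]
    obtain j where j: "\<forall>l<n. \<bar>measure M (\<Phi> (\<tau> j) -` A \<inter> \<Phi> (s l) -` A) - a * a\<bar> < \<epsilon>" by auto
    have "\<forall>i<Suc n. \<forall>l<i. \<bar>measure M (\<Phi> ((s(n := \<tau> j)) i) -` A \<inter> \<Phi> ((s(n := \<tau> j)) l) -` A) - a * a\<bar> \<le> \<epsilon>"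
      using s j by (auto simp: less_Suc_eq intro: less_imp_le)
    then show ?case by blast
  qed simp
  txt \<open>Along the times \<open>s\<close> the preimages of \<open>A\<close> are nearly independent, so every signed sum of their
    centred indicators has \<open>L\<^sup>2\<close> norm \<open>O(sqrt n)\<close>, also after shifting by an arbitrary \<open>t\<close>. Hence the
    correlations are small on average along each translate of \<open>s\<close>.\<close>
  have key: "\<exists>s n. (n :: nat) > 0 \<and> (\<forall>t. (\<Sum>i<n. \<bar>c (t + s i)\<bar>) \<le> real n * \<delta>)" if \<delta>: "\<delta> > 0" for \<delta>
  proof -
    \<comment> \<open>Large enough for \<open>1 / \<delta> \<le> \<delta> * n / 2\<close>, which
      closes the final estimate.\<close>
    define n where "n = Suc (nat \<lceil>2 / \<delta>\<^sup>2\<rceil>)"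
    have n: "n > 0" "2 / \<delta>\<^sup>2 \<le> real n" unfolding n_def by (simp, linarith)
    \<comment> \<open>This accuracy is balanced: summed over all \<open>n * n\<close> pairs it
      contributes \<open>n\<close>, exactly as much as the diagonal.\<close>
    obtain s where s: "\<forall>i<n. \<forall>l<i. \<bar>measure M (\<Phi> (s i) -` A \<inter> \<Phi> (s l) -` A) - a * a\<bar> \<le> 1 / real n"
      using indep[of "1 / real n" n] n by auto
    have s': "\<bar>measure M (\<Phi> (s i) -` A \<inter> \<Phi> (s l) -` A) - a * a\<bar> \<le> 1 / real n + of_bool (i = l)"
      if "i < n" "l < n" for i l
    proof (cases "i = l")
      case True
      have "0 \<le> a * a" "a * a \<le> 1" using a01 by (auto intro: mult_le_one)
      moreover have "measure M (\<Phi> (s i) -` A \<inter> \<Phi> (s l) -` A) = a" using True A by (simp add: pre a_def)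
      moreover have "0 \<le> 1 / real n" by simp
      ultimately have "\<bar>measure M (\<Phi> (s i) -` A \<inter> \<Phi> (s l) -` A) - a * a\<bar> \<le> 1 / real n + 1"
        using a01 by linarith
      then show ?thesis using True by simp
    next
      case False
      then consider "l < i" | "i < l" by linarith
      then show ?thesis
      proof cases
        case 1
        then show ?thesis using s that False by simp
      next
        case 2
        then have "\<bar>measure M (\<Phi> (s l) -` A \<inter> \<Phi> (s i) -` A) - a * a\<bar> \<le> 1 / real n" using s that by blast
        then show ?thesis using False by (simp add: Int_commute)
      qed
    qed
    have "(\<Sum>i<n. \<bar>c (t + s i)\<bar>) \<le> real n * \<delta>" for t
    proof -
      \<comment> \<open>The signs turn the sum of absolute correlations into a single integral of
        \<open>F\<close> against \<open>B\<close>.\<close>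
      define \<epsilon> where "\<epsilon> i = sgn (c (t + s i))" for i
      define F where "F z = (\<Sum>i<n. \<epsilon> i * (indicator (\<Phi> (s i) -` A) z - a))" for z
      \<comment> \<open>The bound to be proved, used at the same time as the weight in
        \<open>x \<le> x\<^sup>2 / (2 * \<kappa>) + \<kappa> / 2\<close>. This inequality replaces
        Cauchy-Schwarz and leaves only the second moment of \<open>F\<close>, which no longer
        depends on \<open>t\<close>.\<close>
      define \<kappa> where "\<kappa> = \<delta> * real n"
      have \<kappa>: "\<kappa> > 0" using \<delta> n by (simp add: \<kappa>_def)
      have [measurable]: "\<Phi> (s i) -` A \<in> sets M" for i by (rule pre[OF A])
      have [measurable]: "F \<in> borel_measurable M" unfolding F_def by measurable
      have eps: "\<bar>\<epsilon> i\<bar> \<le> 1" for i by (simp add: \<epsilon>_def abs_sgn_eq)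
      have Fb: "\<bar>F z\<bar> \<le> real n" for z
      proof -
        have "\<bar>F z\<bar> \<le> (\<Sum>i<n. \<bar>\<epsilon> i * (indicator (\<Phi> (s i) -` A) z - a)\<bar>)" unfolding F_def by (rule sum_abs)
        also have "\<dots> \<le> (\<Sum>i<n. 1 * 1)"
          unfolding abs_mult using eps a01 by (intro sum_mono mult_mono) (auto simp: indicator_def)
        finally show ?thesis by simp
      qed
      have F2b: "norm ((F z)\<^sup>2) \<le> (real n)\<^sup>2" for z
        using power_mono[OF Fb abs_ge_zero, of z 2] by simp
      have ind: "integrable M (indicator C :: 'a \<Rightarrow> real)" if "C \<in> sets M" for C
        using that by (simp add: emeasure_eq_measure)
      have "(\<Sum>i<n. \<bar>c (t + s i)\<bar>) = (\<Sum>i<n. \<epsilon> i * c (t + s i))"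
        by (simp add: \<epsilon>_def mult.commute[of "sgn _"] mult_sgn_abs abs_mult_sgn abs_sgn)
      also have "\<dots> = (\<integral>z. F (\<Phi> t z) * indicator B z \<partial>M)"
      proof -
        have "(\<integral>z. F (\<Phi> t z) * indicator B z \<partial>M) =
            (\<integral>z. (\<Sum>i<n. \<epsilon> i * (indicator (\<Phi> (t + s i) -` A \<inter> B) z - a * indicator B z)) \<partial>M)"
        proof (intro Bochner_Integration.integral_cong refl)
          fix z
          have "indicator (\<Phi> (t + s i) -` A \<inter> B) z = (indicator (\<Phi> (s i) -` A) (\<Phi> t z) * indicator B z :: real)" for i
            by (simp add: indicator_def flow[symmetric] add.commute)
          then show "F (\<Phi> t z) * indicator B z =
              (\<Sum>i<n. \<epsilon> i * (indicator (\<Phi> (t + s i) -` A \<inter> B) z - a * indicator B z))"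
            unfolding F_def sum_distrib_right
            by (intro sum.cong refl) (simp only: left_diff_distrib right_diff_distrib mult.assoc)
        qed
        also have "\<dots> = (\<Sum>i<n. \<epsilon> i * c (t + s i))"
          using A B by (subst Bochner_Integration.integral_sum)
            (auto simp: c_def b_def ind pre intro!: Bochner_Integration.integrable_diff integrable_mult_right ind)
        finally show ?thesis by simp
      qed
      also have "\<dots> \<le> (\<integral>z. (F (\<Phi> t z))\<^sup>2 / (2 * \<kappa>) + \<kappa> / 2 \<partial>M)"
      proof (rule integral_mono)
        have [measurable]: "B \<in> sets M" by (fact B)
        have "AE z in M. norm (F (\<Phi> t z) * indicator B z) \<le> real n"
          using Fb by (intro AE_I2) (auto simp: indicator_def)
        then show "integrable M (\<lambda>z. F (\<Phi> t z) * indicator B z)"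
          by (rule integrable_const_bound) measurable
        have "AE z in M. norm ((F (\<Phi> t z))\<^sup>2) \<le> (real n)\<^sup>2"
          by (intro AE_I2 F2b)
        then have "integrable M (\<lambda>z. (F (\<Phi> t z))\<^sup>2)"
          by (rule integrable_const_bound) measurable
        then show "integrable M (\<lambda>z. (F (\<Phi> t z))\<^sup>2 / (2 * \<kappa>) + \<kappa> / 2)" by simp
        fix z
        have "0 \<le> (x - \<kappa>)\<^sup>2 / (2 * \<kappa>)" for x using \<kappa> by simp
        moreover have "(x - \<kappa>)\<^sup>2 / (2 * \<kappa>) = x\<^sup>2 / (2 * \<kappa>) + \<kappa> / 2 - x" for x
          using \<kappa> by (simp add: field_simps power2_eq_square)
        ultimately have "x \<le> x\<^sup>2 / (2 * \<kappa>) + \<kappa> / 2" for x by (smt (verit))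
        moreover have "0 \<le> (F (\<Phi> t z))\<^sup>2 / (2 * \<kappa>) + \<kappa> / 2" using \<kappa> by simp
        ultimately show "F (\<Phi> t z) * indicator B z \<le> (F (\<Phi> t z))\<^sup>2 / (2 * \<kappa>) + \<kappa> / 2"
          by (auto simp: indicator_def)
      qed
      also have "\<dots> = (\<integral>z. (F (\<Phi> t z))\<^sup>2 \<partial>M) / (2 * \<kappa>) + \<kappa> / 2"
      proof -
        have "AE z in M. norm ((F (\<Phi> t z))\<^sup>2) \<le> (real n)\<^sup>2"
          by (intro AE_I2 F2b)
        then have "integrable M (\<lambda>z. (F (\<Phi> t z))\<^sup>2)"
          by (rule integrable_const_bound) measurable
        then show ?thesis using prob_space by simp
      qed
      also have "(\<integral>z. (F (\<Phi> t z))\<^sup>2 \<partial>M) = (\<integral>z. (F z)\<^sup>2 \<partial>M)"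
        using integral_distr[OF meas, of "\<lambda>z. (F z)\<^sup>2" t] by (simp add: distr)
      also have "\<dots> = (\<integral>z. (\<Sum>i<n. \<Sum>l<n. \<epsilon> i * \<epsilon> l * (indicator (\<Phi> (s i) -` A \<inter> \<Phi> (s l) -` A) z
          - a * indicator (\<Phi> (s i) -` A) z - a * indicator (\<Phi> (s l) -` A) z + a * a)) \<partial>M)"
        unfolding F_def power2_eq_square sum_product
        by (intro Bochner_Integration.integral_cong refl sum.cong)
          (auto simp: indicator_def algebra_simps)
      also have "\<dots> = (\<Sum>i<n. \<Sum>l<n. \<epsilon> i * \<epsilon> l * (measure M (\<Phi> (s i) -` A \<inter> \<Phi> (s l) -` A) - a * a))"
      proof -
        have I: "integrable M (\<lambda>z. \<epsilon> i * \<epsilon> l * (indicator (\<Phi> (s i) -` A \<inter> \<Phi> (s l) -` A) z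
          - a * indicator (\<Phi> (s i) -` A) z - a * indicator (\<Phi> (s l) -` A) z + a * a))" for i l
          by (intro integrable_mult_right Bochner_Integration.integrable_add Bochner_Integration.integrable_diff ind) auto
        have J: "(\<integral>z. \<epsilon> i * \<epsilon> l * (indicator (\<Phi> (s i) -` A \<inter> \<Phi> (s l) -` A) z
          - a * indicator (\<Phi> (s i) -` A) z - a * indicator (\<Phi> (s l) -` A) z + a * a) \<partial>M) =
          \<epsilon> i * \<epsilon> l * (measure M (\<Phi> (s i) -` A \<inter> \<Phi> (s l) -` A) - a * a)" for i l
          using prob_space by (simp add: ind pre A a_def[symmetric])
        show ?thesis
          by (simp only: Bochner_Integration.integral_sum Bochner_Integration.integrable_sum I J)
      qed
      also have "\<dots> \<le> (\<Sum>i<n. \<Sum>l<n. 1 / real n + of_bool (i = l))"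
      proof (intro sum_mono)
        fix i l assume il: "i \<in> {..<n}" "l \<in> {..<n}"
        let ?x = "measure M (\<Phi> (s i) -` A \<inter> \<Phi> (s l) -` A) - a * a"
        have "\<epsilon> i * \<epsilon> l * ?x \<le> \<bar>\<epsilon> i\<bar> * \<bar>\<epsilon> l\<bar> * \<bar>?x\<bar>" by (metis abs_ge_self abs_mult)
        also have "\<dots> \<le> 1 * 1 * \<bar>?x\<bar>" using eps by (intro mult_right_mono mult_mono) auto
        also have "\<dots> \<le> 1 / real n + of_bool (i = l)" using s'[of i l] il by simp
        finally show "\<epsilon> i * \<epsilon> l * ?x \<le> 1 / real n + of_bool (i = l)" .
      qed
      also have "\<dots> = 2 * real n"
        using n by (simp add: sum.distrib of_bool_def sum.delta)
      finally have "(\<Sum>i<n. \<bar>c (t + s i)\<bar>) \<le> 2 * real n / (2 * \<kappa>) + \<kappa> / 2"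
        using \<kappa> by (simp add: divide_right_mono)
      also have "2 * real n / (2 * \<kappa>) = 1 / \<delta>" using n \<delta> by (simp add: \<kappa>_def field_simps)
      also have "1 / \<delta> \<le> \<kappa> / 2"
        using n \<delta> by (simp add: \<kappa>_def field_simps power2_eq_square)
      finally show ?thesis by (simp add: \<kappa>_def mult.commute)
    qed
    with n show ?thesis by blast
  qed
  have lim: "((\<lambda>T. 1 / T * integral {0..T} (\<lambda>t. \<bar>c t\<bar>)) \<longlongrightarrow> 0) at_top"
  proof (rule tendstoI)
    fix e :: real assume e: "e > 0"
    obtain s n where sn: "n > (0::nat)" "\<forall>t. (\<Sum>i<n. \<bar>c (t + s i)\<bar>) \<le> real n * (e / 3)"
      using key[of "e / 3"] e by auto
    define S where "S = (\<Sum>i<n. \<bar>s i\<bar>)"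
    \<comment> \<open>Integrating the estimate for translates over \<open>t\<close> and undoing each
      shift \<open>s i\<close> costs a total of \<open>2 * S\<close>, which does not grow with
      \<open>T\<close>.\<close>
    have bnd: "integral {0..T} (\<lambda>t. \<bar>c t\<bar>) \<le> T * (e / 3) + 2 * S" if T: "T > 0" for T
    proof -
      have cs: "continuous_on {0..T} (\<lambda>t. \<bar>c (t + x)\<bar>)" for x
        by (intro continuous_intros continuous_on_compose2[OF c_cont]) auto
      have "real n * integral {0..T} (\<lambda>t. \<bar>c t\<bar>) = (\<Sum>i<n. integral {0..T} (\<lambda>t. \<bar>c t\<bar>))" by simp
      also have "\<dots> \<le> (\<Sum>i<n. integral {0..T} (\<lambda>t. \<bar>c (t + s i)\<bar>) + 2 * \<bar>s i\<bar>)"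
        using T c1 by (intro sum_mono integral_shift_le[of "\<lambda>t. \<bar>c t\<bar>"] continuous_intros c_cont) auto
      also have "\<dots> = integral {0..T} (\<lambda>t. \<Sum>i<n. \<bar>c (t + s i)\<bar>) + 2 * S"
        by (subst Henstock_Kurzweil_Integration.integral_sum)
          (auto simp: sum.distrib S_def sum_distrib_left intro!: integrable_continuous_real cs)
      also have "integral {0..T} (\<lambda>t. \<Sum>i<n. \<bar>c (t + s i)\<bar>) \<le> integral {0..T} (\<lambda>t. real n * (e / 3))"
        using sn(2) by (intro integral_le integrable_continuous_real continuous_on_sum cs) auto
      also have "\<dots> = real n * (T * (e / 3))" using T by simp
      also have "2 * S \<le> real n * (2 * S)"
        using sn(1) by (simp add: S_def sum_nonneg)
          (metis One_nat_def Suc_leI mult_le_cancel_right1 not_le of_nat_1 of_nat_le_iff sum_nonneg abs_ge_zero)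
      finally have "real n * integral {0..T} (\<lambda>t. \<bar>c t\<bar>) \<le> real n * (T * (e / 3) + 2 * S)"
        by (simp add: algebra_simps)
      then show ?thesis using sn(1) by simp
    qed
    show "\<forall>\<^sub>F T in at_top. dist (1 / T * integral {0..T} (\<lambda>t. \<bar>c t\<bar>)) 0 < e"
      \<comment> \<open>Beyond \<open>6 * S / e\<close> the shift error \<open>2 * S / T\<close> is
        below \<open>e / 3\<close>.\<close>
      using eventually_gt_at_top[of "max 0 (6 * S / e)"]
    proof eventually_elim
      case (elim T)
      have "integral {0..T} (\<lambda>t. \<bar>c t\<bar>) \<ge> 0"
        by (intro integral_nonneg integrable_continuous_real continuous_intros continuous_on_subset[OF c_cont]) auto
      moreover have "6 * S < T * e" using elim e by (simp add: field_simps)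
      ultimately show ?case using bnd[of T] elim e by (simp add: field_simps)
    qed
  qed
  have eq: "(LINT t:{0..T}|lborel. \<bar>measure M ((\<Phi> t -` A \<inter> space M) \<inter> B) - measure M A * measure M B\<bar>) =
      integral {0..T} (\<lambda>t. \<bar>c t\<bar>)" for T
  proof -
    have "set_integrable lborel {0..T} (\<lambda>t. \<bar>c t\<bar>)"
      unfolding set_integrable_def
      by (intro borel_integrable_compact continuous_intros continuous_on_subset[OF c_cont]) auto
    from set_borel_integral_eq_integral(2)[OF this] show ?thesis
      by (simp add: c_def a_def b_def)
  qed
  show "((\<lambda>T. 1 / T * (LINT t:{0..T}|lborel.
      \<bar>measure M ((\<Phi> t -` A \<inter> space M) \<inter> B) - measure M A * measure M B\<bar>)) \<longlongrightarrow> 0) at_top"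
    unfolding eq by (rule lim)
qed

section \<open>Averages of exponential integrals\<close>

lemma ee_average_tendsto_0:
  assumes "x \<notin> \<int>"
  shows "(\<lambda>N. (\<Sum>n<N. ee (real n * x)) / of_nat N) \<longlonglongrightarrow> 0"
proof -
  have ne: "ee x \<noteq> 1" using assms by (simp add: ee_eq_1_iff)
  have lim: "(\<lambda>N. (2 / cmod (1 - ee x)) / real N) \<longlonglongrightarrow> 0"
    by (rule lim_const_over_n)
  have "norm ((\<Sum>n<N. ee (real n * x)) / of_nat N) \<le> (2 / cmod (1 - ee x)) / real N" for N
  proof -
    have "(\<Sum>n<N. ee (real n * x)) = (1 - ee x ^ N) / (1 - ee x)"
      unfolding ee_mult_nat using ne by (simp add: sum_gp_strict)
    moreover have "cmod (1 - ee x ^ N) \<le> 2"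
      using norm_triangle_ineq4[of 1 "ee x ^ N"] by (simp add: norm_power)
    ultimately show ?thesis
      using divide_right_mono[of "cmod (1 - ee x ^ N)" 2 "cmod (1 - ee x) * real N"]
      by (simp add: norm_divide norm_mult)
  qed
  then show ?thesis by (intro Lim_null_comparison[OF always_eventually lim] allI)
qed

text \<open>The last hypothesis says that \<open>\<omega>\<close> modulo 1 has no atoms. The squared
  modulus is an integral over pairs \<open>(w, w')\<close> of powers of
  \<open>ee (\<omega> w - \<omega> w')\<close>; their averages are geometric sums that tend to 0 for
  almost every pair, and dominated convergence applies.\<close>

lemma wiener_average:
  fixes G :: "'a \<Rightarrow> complex"
  assumes "prob_space M" and \<omega> [measurable]: "\<omega> \<in> borel_measurable M" and G [measurable]: "G \<in> borel_measurable M"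
    and bound: "\<And>w. cmod (G w) \<le> C"
    and ae: "AE w in M. AE w' in M. \<omega> w - \<omega> w' \<notin> \<int>"
  shows "(\<lambda>N. (\<Sum>n<N. (cmod (\<integral>w. G w * ee (real n * \<omega> w) \<partial>M))\<^sup>2) / real N) \<longlonglongrightarrow> 0"
proof -
  interpret prob_space M by fact
  interpret P: pair_prob_space M M ..
  have [measurable]: "ee \<in> borel_measurable borel"
    by (intro borel_measurable_continuous_onI continuous_intros)
  have C: "0 \<le> C" using bound[of undefined] norm_ge_zero[of "G undefined"] by linarith
  define H where "H n p = G (fst p) * cnj (G (snd p)) * ee (real n * (\<omega> (fst p) - \<omega> (snd p)))" for n p
  have Hm [measurable]: "H n \<in> borel_measurable (M \<Otimes>\<^sub>M M)" for n
  proof -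
    have "(\<lambda>p. ee (real n * (\<omega> (fst p) - \<omega> (snd p)))) \<in> borel_measurable (M \<Otimes>\<^sub>M M)"
      by (rule measurable_compose[of _ _ borel ee]) measurable
    moreover have "(\<lambda>p. cnj (G (snd p))) \<in> borel_measurable (M \<Otimes>\<^sub>M M)"
      by (rule measurable_compose[of _ _ borel cnj])
        (measurable, intro borel_measurable_continuous_onI continuous_intros)
    ultimately show ?thesis unfolding H_def by (intro borel_measurable_times) measurable
  qed
  have Hb: "cmod (H n p) \<le> C * C" for n p
    using bound C by (simp add: H_def norm_mult mult_mono)
  have Hi: "integrable (M \<Otimes>\<^sub>M M) (H n)" for n
    by (rule P.integrable_const_bound[of _ "C * C"]) (simp_all add: Hb)
  have sq: "complex_of_real ((cmod (\<integral>w. G w * ee (real n * \<omega> w) \<partial>M))\<^sup>2) = (\<integral>p. H n p \<partial>(M \<Otimes>\<^sub>M M))" for n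
  proof -
    define f where "f w = G w * ee (real n * \<omega> w)" for w
    have eq: "H n (x, y) = f x * cnj (f y)" for x y
      by (simp add: H_def f_def right_diff_distrib ee_diff mult_ac)
    have "(\<integral>p. H n p \<partial>(M \<Otimes>\<^sub>M M)) = (\<integral>x. \<integral>y. H n (x, y) \<partial>M \<partial>M)"
      using P.integral_fst'[OF Hi[of n]] by simp
    also have "\<dots> = (\<integral>x. f x \<partial>M) * cnj (\<integral>y. f y \<partial>M)" by (simp add: eq)
    finally show ?thesis unfolding f_def complex_norm_square by simp
  qed
  have "(\<lambda>N. \<integral>p. (\<Sum>n<N. H n p) / of_nat N \<partial>(M \<Otimes>\<^sub>M M)) \<longlonglongrightarrow> (\<integral>p. 0 \<partial>(M \<Otimes>\<^sub>M M))"
  proof (rule integral_dominated_convergence[where w = "\<lambda>_. C * C"])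
    show "AE p in M \<Otimes>\<^sub>M M. norm ((\<Sum>n<N. H n p) / of_nat N) \<le> C * C" for N
    proof (rule AE_I2)
      fix p
      have "norm (\<Sum>n<N. H n p) \<le> (\<Sum>n<N. C * C)" by (intro sum_norm_le Hb)
      then show "norm ((\<Sum>n<N. H n p) / of_nat N) \<le> C * C"
        using C by (cases "N = 0") (simp_all add: norm_divide field_simps)
    qed
    have m: "{x \<in> space (M \<Otimes>\<^sub>M M). \<omega> (fst x) - \<omega> (snd x) \<notin> \<int>} \<in> sets (M \<Otimes>\<^sub>M M)"
    proof -
      have [measurable]: "(\<int> :: real set) \<in> sets borel" by (intro borel_closed closed_Ints)
      show ?thesis by measurable
    qed
    have "AE p in M \<Otimes>\<^sub>M M. \<omega> (fst p) - \<omega> (snd p) \<notin> \<int>"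
      by (rule P.AE_pair_measure[OF m]) (use ae in simp)
    then show "AE p in M \<Otimes>\<^sub>M M. (\<lambda>N. (\<Sum>n<N. H n p) / of_nat N) \<longlonglongrightarrow> 0"
    proof (rule AE_mp, intro AE_I2 impI)
      fix p assume "\<omega> (fst p) - \<omega> (snd p) \<notin> \<int>"
      from tendsto_mult_left[OF ee_average_tendsto_0[OF this], of "G (fst p) * cnj (G (snd p))"]
      show "(\<lambda>N. (\<Sum>n<N. H n p) / of_nat N) \<longlonglongrightarrow> 0"
        by (simp add: H_def sum_distrib_left)
    qed
  qed simp_all
  moreover have "(\<integral>p. (\<Sum>n<N. H n p) / of_nat N \<partial>(M \<Otimes>\<^sub>M M)) =
      complex_of_real ((\<Sum>n<N. (cmod (\<integral>w. G w * ee (real n * \<omega> w) \<partial>M))\<^sup>2) / real N)" for N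
  proof -
    have "(\<integral>p. (\<Sum>n<N. H n p) / of_nat N \<partial>(M \<Otimes>\<^sub>M M)) = (\<Sum>n<N. \<integral>p. H n p \<partial>(M \<Otimes>\<^sub>M M)) / of_nat N"
      by (simp add: Hi)
    then show ?thesis by (simp only: sq[symmetric] of_real_sum of_real_divide of_real_of_nat_eq)
  qed
  ultimately have "(\<lambda>N. complex_of_real ((\<Sum>n<N. (cmod (\<integral>w. G w * ee (real n * \<omega> w) \<partial>M))\<^sup>2) / real N)) \<longlonglongrightarrow> complex_of_real 0"
    by (simp only: Bochner_Integration.integral_zero of_real_0)
  then show ?thesis by (simp only: tendsto_of_real_iff)
qed

lemma average_le_sqrt_average:
  fixes x :: "nat \<Rightarrow> real"
  shows "((\<Sum>n<N. x n) / real N)\<^sup>2 \<le> (\<Sum>n<N. (x n)\<^sup>2) / real N"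
proof (cases "N = 0")
  case False
  have "(\<Sum>n<N. x n)\<^sup>2 \<le> (\<Sum>n<N. (x n)\<^sup>2) * real N"
    using Cauchy_Schwarz_ineq_sum[of x "\<lambda>_. 1" "{..<N}"] by simp
  with False show ?thesis by (simp add: power_divide field_simps power2_eq_square)
qed simp

lemma wiener_average_abs:
  fixes G :: "'a \<Rightarrow> complex"
  assumes "prob_space M" "\<omega> \<in> borel_measurable M" "G \<in> borel_measurable M"
    and "\<And>w. cmod (G w) \<le> C" and "AE w in M. AE w' in M. \<omega> w - \<omega> w' \<notin> \<int>"
  shows "(\<lambda>N. (\<Sum>n<N. cmod (\<integral>w. G w * ee (real n * \<omega> w) \<partial>M)) / real N) \<longlonglongrightarrow> 0"
proof -
  have "(\<lambda>N. sqrt ((\<Sum>n<N. (cmod (\<integral>w. G w * ee (real n * \<omega> w) \<partial>M))\<^sup>2) / real N)) \<longlonglongrightarrow> sqrt 0"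
    by (intro tendsto_real_sqrt wiener_average[OF assms])
  then have *: "(\<lambda>N. sqrt ((\<Sum>n<N. (cmod (\<integral>w. G w * ee (real n * \<omega> w) \<partial>M))\<^sup>2) / real N)) \<longlonglongrightarrow> 0"
    by simp
  show ?thesis
  proof (rule Lim_null_comparison[OF _ *], rule always_eventually, rule allI)
    fix N
    show "norm ((\<Sum>n<N. cmod (\<integral>w. G w * ee (real n * \<omega> w) \<partial>M)) / real N) \<le>
        sqrt ((\<Sum>n<N. (cmod (\<integral>w. G w * ee (real n * \<omega> w) \<partial>M))\<^sup>2) / real N)"
      using real_le_rsqrt[OF average_le_sqrt_average] by (simp add: sum_nonneg)
  qed
qed

section \<open>Exponential sums over primes along a sparse sequence\<close>

definition prime_count :: "nat \<Rightarrow> nat" where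
  "prime_count N = card {p :: nat. prime p \<and> p < N}"

definition prime_avg :: "nat \<Rightarrow> (nat \<Rightarrow> complex) \<Rightarrow> complex" where
  "prime_avg N f = (\<Sum>p | prime p \<and> p < N. f p) / of_nat (prime_count N)"

lemma finite_primes_below: "finite {p :: nat. prime p \<and> p < N}"
  by (rule finite_subset[of _ "{..<N}"]) auto

lemma prime_count_unbounded: "\<exists>N. m \<le> prime_count N"
proof -
  obtain A where A: "finite A" "card A = m" "A \<subseteq> {p :: nat. prime p}"
    using infinite_arbitrarily_large[OF primes_infinite] by blast
  have "A \<subseteq> {p. prime p \<and> p < Suc (Max A)}" using A by (auto simp: less_Suc_eq_le)
  then have "m \<le> prime_count (Suc (Max A))"
    unfolding prime_count_def using A(2) card_mono[OF finite_primes_below] by blast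
  then show ?thesis ..
qed

lemma prime_count_le: "prime_count N \<le> N"
  unfolding prime_count_def using card_mono[of "{..<N}" "{p. prime p \<and> p < N}"] by auto

text \<open>The growth \<open>2 ^ l\<close> makes the mean squares \<open>1 / prime_count\<close>
  summable. Such an \<open>N\<close> exists simply because there are infinitely many primes.\<close>

definition prime_scale :: "nat \<Rightarrow> nat" where
  "prime_scale l = (SOME N. 2 ^ l \<le> prime_count N)"

lemma prime_scale: "2 ^ l \<le> prime_count (prime_scale l)"
  unfolding prime_scale_def using prime_count_unbounded by (rule someI_ex)

lemma prime_scale_ge: "l \<le> prime_scale l"
  using prime_scale[of l] prime_count_le[of "prime_scale l"] less_exp[of l] by linarith

text \<open>In the expanded square the frequency \<open>(p - q) k\<close> is a nonzero lattice
  vector unless \<open>p = q\<close>, so only the diagonal survives integration over a cell.\<close>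

lemma integral_prime_avg:
  assumes k: "k \<in> lat" "k \<noteq> 0" and N: "prime_count N > 0"
  shows "has_bochner_integral lborel
    (\<lambda>v. indicator (unit_cell c) v *\<^sub>R (cmod (prime_avg N (\<lambda>p. ee (real p * (k \<bullet> v)))))\<^sup>2) (1 / prime_count N)"
proof -
  let ?P = "{p :: nat. prime p \<and> p < N}"
  let ?f = "\<lambda>v. indicator (unit_cell c) v *\<^sub>R (cmod (prime_avg N (\<lambda>p. ee (real p * (k \<bullet> v)))))\<^sup>2"
  have lat: "(real p - real q) *\<^sub>R k \<in> lat" for p q using k(1) by (simp add: lat_iff Ints_mult)
  have int: "integrable lborel (\<lambda>v. indicator (unit_cell c) v *\<^sub>R ee (l \<bullet> v))" for l
    by (intro borel_integrable_compact continuous_intros) auto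
  have eq: "complex_of_real (?f v) = (\<Sum>p\<in>?P. \<Sum>q\<in>?P. indicator (unit_cell c) v *\<^sub>R ee (((real p - real q) *\<^sub>R k) \<bullet> v))
      / (of_nat (prime_count N))\<^sup>2" for v
  proof -
    have "complex_of_real ((cmod (\<Sum>p\<in>?P. ee (real p * (k \<bullet> v))))\<^sup>2) =
        (\<Sum>p\<in>?P. \<Sum>q\<in>?P. ee (((real p - real q) *\<^sub>R k) \<bullet> v))"
      unfolding complex_norm_square
      by (simp add: sum_product left_diff_distrib ee_diff cnj_sum)
    then show ?thesis
      by (cases "v \<in> unit_cell c") (simp_all add: prime_avg_def norm_divide power_divide)
  qed
  have i: "integrable lborel ?f"
  proof -
    have "continuous_on (unit_cell c) (\<lambda>v. (cmod (prime_avg N (\<lambda>p. ee (real p * (k \<bullet> v)))))\<^sup>2)"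
      unfolding prime_avg_def using N by (intro continuous_intros) auto
    from borel_integrable_compact[OF compact_cbox this] show ?thesis .
  qed
  have "complex_of_real (\<integral>v. ?f v \<partial>lborel) = (\<integral>v. complex_of_real (?f v) \<partial>lborel)" by (rule integral_of_real[OF i, symmetric])
  also have "\<dots> = (\<Sum>p\<in>?P. \<Sum>q\<in>?P. \<integral>v. indicator (unit_cell c) v *\<^sub>R ee (((real p - real q) *\<^sub>R k) \<bullet> v) \<partial>lborel)
      / (of_nat (prime_count N))\<^sup>2"
    unfolding eq
    by (simp only: Bochner_Integration.integral_divide_zero Bochner_Integration.integral_sum
        Bochner_Integration.integrable_sum int)
  also have "\<dots> = (\<Sum>p\<in>?P. \<Sum>q\<in>?P. of_bool ((real p - real q) *\<^sub>R k = 0)) / (of_nat (prime_count N))\<^sup>2"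
    by (simp only: integral_unit_cell_ee lat)
  also have "\<dots> = complex_of_real (1 / prime_count N)"
    using k(2) N finite_primes_below[of N]
    by (simp add: of_bool_def sum.delta prime_count_def power2_eq_square)
  finally have "(\<integral>v. ?f v \<partial>lborel) = 1 / prime_count N" by (simp only: of_real_eq_iff)
  then show ?thesis using i by (simp add: has_bochner_integral_iff)
qed

text \<open>The mean squares along \<open>prime_scale\<close> are bounded by a geometric series, so
  the series of squares converges almost everywhere and its terms tend to 0.\<close>

lemma AE_prime_avg:
  assumes k: "k \<in> lat" "k \<noteq> 0"
  shows "AE v in lborel. v \<in> unit_cell c \<longrightarrow> (\<lambda>l. prime_avg (prime_scale l) (\<lambda>p. ee (real p * (k \<bullet> v)))) \<longlonglongrightarrow> 0"
proof -
  define f where "f l v = indicator (unit_cell c) v *\<^sub>R (cmod (prime_avg (prime_scale l) (\<lambda>p. ee (real p * (k \<bullet> v)))))\<^sup>2" for l v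
  have pos: "prime_count (prime_scale l) > 0" for l
    using prime_scale[of l] by (metis gr0I le_zero_eq power_eq_0_iff zero_neq_numeral)
  have hb: "has_bochner_integral lborel (f l) (1 / prime_count (prime_scale l))" for l
    unfolding f_def using k pos by (rule integral_prime_avg)
  have [measurable]: "f l \<in> borel_measurable lborel" for l
    using borel_measurable_integrable[OF integrable.intros[OF hb[of l]]] by simp
  have nn: "0 \<le> f l v" for l v by (simp add: f_def)
  have "(\<integral>\<^sup>+ v. ennreal (f l v) \<partial>lborel) \<le> ennreal ((1/2) ^ l)" for l
  proof -
    have "(\<integral>\<^sup>+ v. ennreal (f l v) \<partial>lborel) = ennreal (1 / prime_count (prime_scale l))"
      using hb[of l] nn by (subst nn_integral_eq_integral) (auto simp: has_bochner_integral_iff)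
    also have "(2::real) ^ l \<le> real (prime_count (prime_scale l))"
      using prime_scale[of l] by (metis of_nat_le_iff of_nat_numeral of_nat_power)
    then have "ennreal (1 / prime_count (prime_scale l)) \<le> ennreal ((1/2) ^ l)"
      using pos[of l] by (intro ennreal_leI) (simp add: field_simps)
    finally show ?thesis .
  qed
  then have "(\<Sum>l. \<integral>\<^sup>+ v. ennreal (f l v) \<partial>lborel) \<le> (\<Sum>l. ennreal ((1/2) ^ l))"
    by (intro suminf_le summableI)
  also have "(\<Sum>l. ennreal ((1/2) ^ l)) = ennreal 2"
    using geometric_sums[of "1/2 :: real"] by (intro suminf_ennreal_eq) auto
  finally have "(\<integral>\<^sup>+ v. (\<Sum>l. ennreal (f l v)) \<partial>lborel) \<noteq> \<infinity>"
    by (subst nn_integral_suminf) (auto simp: top_unique)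
  then have "AE v in lborel. (\<Sum>l. ennreal (f l v)) \<noteq> \<infinity>"
    by (intro nn_integral_PInf_AE) measurable
  then show ?thesis
  proof (rule AE_mp, intro AE_I2 impI)
    fix v assume v: "v \<in> unit_cell c" and "(\<Sum>l. ennreal (f l v)) \<noteq> \<infinity>"
    then have "summable (\<lambda>l. f l v)" using nn by (intro summable_suminf_not_top) auto
    from summable_LIMSEQ_zero[OF this] v
    have "(\<lambda>l. (cmod (prime_avg (prime_scale l) (\<lambda>p. ee (real p * (k \<bullet> v)))))\<^sup>2) \<longlonglongrightarrow> 0"
      by (simp add: f_def)
    from tendsto_real_sqrt[OF this]
    show "(\<lambda>l. prime_avg (prime_scale l) (\<lambda>p. ee (real p * (k \<bullet> v)))) \<longlonglongrightarrow> 0"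
      by (simp add: tendsto_norm_zero_iff)
  qed
qed

text \<open>A condition on the direction alone, phrased for the linear flow; it transfers to
  finitely many nonresonant modes through the eigenfunctions \<open>Elin\<close>.\<close>

definition prime_generic :: "real \<times> real \<Rightarrow> bool" where
  "prime_generic v \<longleftrightarrow> (\<forall>k\<in>lat - {0}. (\<lambda>l. prime_avg (prime_scale l) (\<lambda>p. ee (real p * (k \<bullet> v)))) \<longlonglongrightarrow> 0)"

lemma prime_generic_dense:
  assumes V: "open V" "V \<noteq> {}"
  obtains v where "v \<in> V" "prime_generic v"
proof -
  from V obtain c where c: "c \<in> V" by blast
  \<comment> \<open>Centres the unit cell at \<open>c\<close>, so that \<open>c\<close> lies in its
    interior and \<open>W\<close> is an open neighbourhood of \<open>c\<close>.\<close>
  define c' where "c' = c - (1/2, 1/2)"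
  define W where "W = V \<inter> box c' (c' + (1, 1))"
  have "c \<in> W" using c by (auto simp: W_def c'_def mem_box Basis_prod_def inner_add_left inner_diff_left)
  moreover have "open W" using V by (simp add: W_def open_box open_Int)
  ultimately have W: "\<not> negligible W" using open_not_negligible by blast
  have "AE v in lborel. \<forall>k\<in>lat - {0}. v \<in> unit_cell c' \<longrightarrow>
      (\<lambda>l. prime_avg (prime_scale l) (\<lambda>p. ee (real p * (k \<bullet> v)))) \<longlonglongrightarrow> 0"
  proof -
    have cl: "countable (lat - {0})" using countable_lat by (rule countable_Diff)
    show ?thesis unfolding AE_ball_countable[OF cl] by (intro ballI AE_prime_avg) auto
  qed
  then obtain N where N: "N \<in> null_sets lborel"
    "{v \<in> space lborel. \<not> (\<forall>k\<in>lat - {0}. v \<in> unit_cell c' \<longrightarrow>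
      (\<lambda>l. prime_avg (prime_scale l) (\<lambda>p. ee (real p * (k \<bullet> v)))) \<longlonglongrightarrow> 0)} \<subseteq> N"
    unfolding eventually_ae_filter by (elim exE bexE conjE)
  have "negligible N" using N(1) by (simp add: negligible_iff_null_sets null_sets_completionI)
  with W have "\<not> W \<subseteq> N" using negligible_subset by metis
  then obtain v where v: "v \<in> W" "v \<notin> N" by blast
  moreover have "v \<in> unit_cell c'" using v(1) box_subset_cbox by (auto simp: W_def)
  ultimately have "prime_generic v" using N(2) by (auto simp: prime_generic_def)
  moreover have "v \<in> V" using v(1) by (simp add: W_def)
  ultimately show thesis using that by metis
qed

text \<open>At a resonance every term of the prime average is 1, so the average cannot tend to
  0.\<close>

lemma prime_generic_nonresonant:
  assumes v: "prime_generic v" and k: "k \<in> lat" "k \<noteq> 0"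
  shows "k \<bullet> v \<noteq> 0"
proof
  assume *: "k \<bullet> v = 0"
  have "prime_count (prime_scale l) \<noteq> 0" for l
    using prime_scale[of l] one_le_power[of "2 :: nat" l] by linarith
  then have "prime_avg (prime_scale l) (\<lambda>p. ee (real p * (k \<bullet> v))) = 1" for l
    using * by (simp add: prime_avg_def prime_count_def)
  moreover have "(\<lambda>l. prime_avg (prime_scale l) (\<lambda>p. ee (real p * (k \<bullet> v)))) \<longlonglongrightarrow> 0"
    using v k by (simp add: prime_generic_def)
  ultimately have "(\<lambda>l :: nat. 1 :: complex) \<longlonglongrightarrow> 0" by simp
  from LIMSEQ_unique[OF tendsto_const this] show False by simp
qed

section \<open>The family of flows\<close>

lemma continuous_on_series:
  fixes f :: "nat \<Rightarrow> 'a::topological_space \<Rightarrow> real"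
  assumes "\<And>i. continuous_on UNIV (f i)" and "\<And>i x. \<bar>f i x\<bar> \<le> M i" and "summable M"
  shows "continuous_on UNIV (\<lambda>x. \<Sum>i. f i x)"
proof (rule uniform_limit_theorem)
  show "uniform_limit UNIV (\<lambda>n x. \<Sum>i<n. f i x) (\<lambda>x. \<Sum>i. f i x) sequentially"
    using assms by (intro Weierstrass_m_test) auto
  show "\<forall>\<^sub>F n in sequentially. continuous_on UNIV (\<lambda>x. \<Sum>i<n. f i x)"
    using assms by (intro always_eventually allI continuous_on_sum)
qed simp

text \<open>Only frequencies orthogonal to some direction with nonnegative coordinates are used. The bounded factor
  \<open>sin\<close> makes every real sequence an admissible parameter, so that the parameter space is completely metrizable.\<close>

definition kap :: "nat \<Rightarrow> real \<times> real" where
  "kap i = (real (fst (prod_decode (Suc i))), - real (snd (prod_decode (Suc i))))"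

definition cf :: "(nat \<Rightarrow> real) \<Rightarrow> nat \<Rightarrow> real" where
  "cf a i = (1/2) ^ (i + 2) * sin (a i)"

text \<open>The reciprocal of the speed along \<open>v\<close>, hence the derivative of
  \<open>htime\<close> along lines and the density of \<open>mu\<close>. The coefficients add up to
  at most 1/2 in modulus, which keeps it between 1/2 and 3/2.\<close>

definition phi :: "(nat \<Rightarrow> real) \<Rightarrow> torus \<Rightarrow> real" where
  "phi a w = 1 + (\<Sum>i. cf a i * Re (tchi (kap i) w))"

text \<open>\<open>psi_int\<close> is \<open>\<integral>\<^sub>0\<^sup>s cos (A + u b) du\<close>, and \<open>jint\<close> is the same integral along
  the line of direction \<open>v\<close>, written so that it is visibly continuous in \<open>v\<close> at resonances.\<close>

definition psi_int :: "real \<Rightarrow> real \<Rightarrow> real \<Rightarrow> real" where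
  "psi_int A b s = (if b = 0 then s * cos A else (sin (A + s * b) - sin A) / b)"

definition jint :: "nat \<Rightarrow> real \<times> real \<Rightarrow> real \<Rightarrow> torus \<Rightarrow> real" where
  "jint i v s w = s * sinc (pi * s * (kap i \<bullet> v)) * Re (tchi (kap i) w * ee (s * (kap i \<bullet> v) / 2))"

text \<open>The time the flow takes from \<open>w\<close> to
  \<open>tshift (s *\<^sub>R v) w\<close>. As a termwise integrated series, rather than an integral,
  it is continuous in all parameters by the Weierstrass test.\<close>

definition htime :: "real \<times> real \<Rightarrow> (nat \<Rightarrow> real) \<Rightarrow> real \<Rightarrow> torus \<Rightarrow> real" where
  "htime v a s w = s + (\<Sum>i. cf a i * jint i v s w)"

lemma kap_lat: "kap i \<in> lat"
  by (simp add: kap_def lat_iff)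

lemma kap_nonzero: "kap i \<noteq> 0"
proof
  assume "kap i = 0"
  then have "prod_decode (Suc i) = (0, 0)" by (simp add: kap_def zero_prod_def prod_eq_iff)
  then have "Suc i = prod_encode (0, 0)" by (metis prod_decode_inverse)
  then show False by (simp add: prod_encode_def)
qed

text \<open>The pair \<open>(0, 0)\<close> has code 0, so the shift by \<open>Suc\<close> in
  \<open>kap\<close> omits exactly the zero frequency.\<close>

lemma kap_surj:
  assumes "(p, q) \<noteq> (0, 0)"
  shows "\<exists>i. kap i = (real p, - real q)"
proof -
  have "prod_decode 0 = (0, 0)" by (simp add: prod_decode_def prod_decode_aux.simps)
  then have "prod_encode (p, q) \<noteq> 0" using assms by (metis prod_encode_inverse)
  then obtain i where "prod_encode (p, q) = Suc i" using not0_implies_Suc by blast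
  then have "prod_decode (Suc i) = (p, q)" by (metis prod_encode_inverse)
  then show ?thesis by (intro exI[of _ i]) (simp add: kap_def)
qed

text \<open>A pairing code dominates both of its components, so frequencies grow at most linearly in
  the index. Decay of coefficients in \<open>i\<close> therefore controls derivatives.\<close>

lemma kap_bound: "\<bar>kap i \<bullet> v\<bar> \<le> 2 * real (Suc i) * norm v"
proof -
  have e: "prod_encode (fst (prod_decode (Suc i)), snd (prod_decode (Suc i))) = Suc i" by simp
  have "fst (prod_decode (Suc i)) \<le> Suc i" "snd (prod_decode (Suc i)) \<le> Suc i"
    using le_prod_encode_1[of "fst (prod_decode (Suc i))" "snd (prod_decode (Suc i))"]
      le_prod_encode_2[of "snd (prod_decode (Suc i))" "fst (prod_decode (Suc i))"] unfolding e by auto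
  then have "norm (kap i) \<le> 2 * real (Suc i)"
    using norm_Pair_le[of "real (fst (prod_decode (Suc i)))" "- real (snd (prod_decode (Suc i)))"]
    by (simp add: kap_def)
  then show ?thesis
    using Cauchy_Schwarz_ineq2[of "kap i" v] mult_right_mono[of "norm (kap i)" "2 * real (Suc i)" "norm v"] by simp
qed

lemma abs_cf: "\<bar>cf a i\<bar> \<le> (1/2) ^ (i + 2)"
  by (simp add: cf_def abs_mult mult_left_le)

lemma half_sums: "(\<lambda>i. (1/2) ^ (i + 2)) sums (1/2 :: real)"
  using sums_mult[OF geometric_sums[of "1/2 :: real"], of "1/4"] by (simp add: power_add mult.commute)

lemma summable_half: "summable (\<lambda>i. (1/2) ^ (i + 2) :: real)"
  using half_sums by (rule sums_summable)

lemma abs_sinc: "\<bar>sinc x\<bar> \<le> 1"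
  using abs_sin_x_le_abs_x[of x] by (simp add: divide_le_eq_1)

lemma Re_ee: "Re (ee x) = cos (2 * pi * x)" and Im_ee: "Im (ee x) = sin (2 * pi * x)"
  by (simp_all add: ee_def)

lemma abs_Re_mult_unit: "cmod z = 1 \<Longrightarrow> \<bar>Re z\<bar> \<le> 1"
  using abs_Re_le_cmod[of z] by simp

lemma abs_phi_term: "\<bar>cf a i * Re (tchi (kap i) w)\<bar> \<le> (1/2) ^ (i + 2)"
  unfolding abs_mult
  using mult_mono[OF abs_cf[of a i] abs_Re_mult_unit[of "tchi (kap i) w"]] by simp

lemma abs_jint: "\<bar>jint i v s w\<bar> \<le> \<bar>s\<bar>"
proof -
  have "\<bar>s\<bar> * \<bar>sinc (pi * s * (kap i \<bullet> v))\<bar> * \<bar>Re (tchi (kap i) w * ee (s * (kap i \<bullet> v) / 2))\<bar> \<le> \<bar>s\<bar> * 1 * 1"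
    by (intro mult_mono abs_sinc abs_Re_mult_unit) (auto simp: norm_mult)
  then show ?thesis by (simp add: jint_def abs_mult)
qed

lemma abs_htime_term: "\<bar>cf a i * jint i v s w\<bar> \<le> \<bar>s\<bar> * (1/2) ^ (i + 2)"
  unfolding abs_mult using mult_mono[OF abs_cf[of a i] abs_jint[of i v s w]] by (simp add: mult.commute)

lemma summable_htime: "summable (\<lambda>i. cf a i * jint i v s w)"
  using abs_htime_term by (intro summable_comparison_test'[OF summable_mult[OF summable_half, of "\<bar>s\<bar>"]]) simp

lemma phi_bounds: "1/2 \<le> phi a w" "phi a w \<le> 3/2"
proof -
  have "norm (\<Sum>i. cf a i * Re (tchi (kap i) w)) \<le> (\<Sum>i. (1/2) ^ (i + 2))"
    by (rule norm_suminf_le[OF _ summable_half]) (use abs_phi_term in simp)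
  then have "\<bar>phi a w - 1\<bar> \<le> 1/2" using sums_unique[OF half_sums] by (simp add: phi_def)
  then show "1/2 \<le> phi a w" "phi a w \<le> 3/2" by linarith+
qed

lemma phi_pos [simp]: "phi a w > 0"
  using phi_bounds(1)[of a w] by linarith

lemma continuous_on_coord:
  fixes f :: "'a::topological_space \<Rightarrow> nat \<Rightarrow> real"
  assumes "continuous_on UNIV f" shows "continuous_on UNIV (\<lambda>x. f x i)"
  using assms by (rule continuous_on_product_then_coordinatewise)

lemma continuous_on_cf:
  assumes "continuous_on UNIV f" shows "continuous_on UNIV (\<lambda>x. cf (f x) i)"
  unfolding cf_def
  using continuous_on_compose2[OF continuous_on_sin[OF continuous_on_id] continuous_on_coord[OF assms, of i]]
  by (intro continuous_on_mult continuous_on_const) auto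

lemma continuous_on_phi [continuous_intros]:
  assumes "continuous_on UNIV f" "continuous_on UNIV g"
  shows "continuous_on UNIV (\<lambda>x. phi (f x) (g x))"
  unfolding phi_def
  by (intro continuous_intros continuous_on_series[OF _ abs_phi_term summable_half] continuous_on_cf assms kap_lat)

text \<open>The displacement \<open>s\<close> stays fixed here; continuity of the inverse
  \<open>sg\<close> will compare with a frozen displacement only.\<close>

lemma continuous_on_htime:
  assumes "continuous_on UNIV f" "continuous_on UNIV g" "continuous_on UNIV h"
  shows "continuous_on UNIV (\<lambda>x. htime (f x) (g x) s (h x))"
proof -
  have "continuous_on UNIV (\<lambda>x. cf (g x) i * jint i (f x) s (h x))" for i
    unfolding jint_def by (intro continuous_intros continuous_on_cf continuous_on_sinc assms kap_lat) auto
  from continuous_on_series[OF this abs_htime_term summable_mult[OF summable_half]]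
  show ?thesis unfolding htime_def by (intro continuous_on_add continuous_on_const)
qed

lemma jint_to_torus: "jint i v s (to_torus z) = psi_int (2 * pi * (kap i \<bullet> z)) (2 * pi * (kap i \<bullet> v)) s"
proof (cases "kap i \<bullet> v = 0 \<or> s = 0")
  case True
  then show ?thesis by (auto simp: jint_def psi_int_def tchi_to_torus kap_lat Re_ee)
next
  case False
  define A where "A = 2 * pi * (kap i \<bullet> z)"
  define b where "b = 2 * pi * (kap i \<bullet> v)"
  have b: "b \<noteq> 0" using False by (simp add: b_def)
  have "Re (tchi (kap i) (to_torus z) * ee (s * (kap i \<bullet> v) / 2)) = cos (A + s * b / 2)"
    unfolding tchi_to_torus[OF kap_lat] ee_add[symmetric] Re_ee A_def b_def by (simp add: algebra_simps)
  moreover have "pi * s * (kap i \<bullet> v) = s * b / 2" by (simp add: b_def)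
  ultimately have "jint i v s (to_torus z) = s * (sin (s * b / 2) / (s * b / 2)) * cos (A + s * b / 2)"
    using False b by (simp only: jint_def) simp
  also have "\<dots> = 2 * sin (s * b / 2) * cos (A + s * b / 2) / b"
    using False b by (simp add: field_simps)
  also have "2 * sin (s * b / 2) * cos (A + s * b / 2) = sin (A + s * b) - sin A"
    using sin_diff_sin[of "A + s * b" A] by (simp add: algebra_simps add_divide_distrib)
  finally show ?thesis using b by (simp add: psi_int_def A_def[symmetric] b_def[symmetric])
qed

lemma psi_int_add: "psi_int A b (s + t) = psi_int A b s + psi_int (A + s * b) b t"
  by (simp add: psi_int_def algebra_simps add_divide_distrib[symmetric] diff_divide_distrib[symmetric])

lemma psi_int_has_derivative: "((\<lambda>s. psi_int A b s) has_real_derivative cos (A + s * b)) (at s)"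
  by (cases "b = 0") (auto simp: psi_int_def intro!: derivative_eq_intros)

lemma jint_add: "jint i v (s + t) w = jint i v s w + jint i v t (tshift (s *\<^sub>R v) w)"
  by (cases w rule: torus_cases)
    (simp add: tshift_to_torus jint_to_torus psi_int_add inner_add_right algebra_simps)

lemma jint_has_derivative:
  "((\<lambda>s. jint i v s w) has_real_derivative Re (tchi (kap i) (tshift (s *\<^sub>R v) w))) (at s)"
proof -
  obtain z where w: "w = to_torus z" by (rule torus_cases)
  have "Re (tchi (kap i) (tshift (s *\<^sub>R v) w)) = cos (2 * pi * (kap i \<bullet> z) + s * (2 * pi * (kap i \<bullet> v)))"
    by (simp add: w tshift_to_torus tchi_to_torus kap_lat Re_ee inner_add_right algebra_simps)
  then show ?thesis using psi_int_has_derivative[of "2 * pi * (kap i \<bullet> z)" "2 * pi * (kap i \<bullet> v)" s]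
    by (simp only: w jint_to_torus)
qed

lemma htime_0 [simp]: "htime v a 0 w = 0"
  by (simp add: htime_def jint_def)

text \<open>The cocycle identity over the translations along \<open>v\<close>; it becomes the flow
  property of \<open>Phi\<close> once \<open>htime\<close> is inverted.\<close>

lemma htime_add: "htime v a (s + t) w = htime v a s w + htime v a t (tshift (s *\<^sub>R v) w)"
  using suminf_add[OF summable_htime[of a v s w] summable_htime[of a v t "tshift (s *\<^sub>R v) w"]]
  by (simp add: htime_def jint_add algebra_simps)

lemma htime_has_derivative:
  "((\<lambda>s. htime v a s w) has_real_derivative phi a (tshift (s *\<^sub>R v) w)) (at s)"
proof -
  have "((\<lambda>x. \<Sum>i. cf a i * jint i v x w) has_real_derivative (\<Sum>i. cf a i * Re (tchi (kap i) (tshift (s *\<^sub>R v) w)))) (at s)"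
  proof -
    have 1: "((\<lambda>s. cf a i * jint i v s w) has_real_derivative cf a i * Re (tchi (kap i) (tshift (x *\<^sub>R v) w))) (at x within UNIV)" for i x
      by (intro DERIV_cmult jint_has_derivative)
    have 2: "uniformly_convergent_on UNIV (\<lambda>n x. \<Sum>i<n. cf a i * Re (tchi (kap i) (tshift (x *\<^sub>R v) w)))"
      using abs_phi_term by (intro Weierstrass_m_test'[OF _ summable_half]) simp
    show ?thesis
      using has_field_derivative_series'(2)[OF convex_UNIV 1 2 UNIV_I summable_htime, of s] by simp
  qed
  then show ?thesis unfolding htime_def phi_def
    by (auto intro!: derivative_eq_intros)
qed

text \<open>Since \<open>phi\<close> is at least 1/2, elapsed time grows at least half as fast as
  the displacement. Injectivity, surjectivity and a Lipschitz inverse all come from this.\<close>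

lemma htime_mono:
  assumes "s \<le> t" shows "(t - s) / 2 \<le> htime v a t w - htime v a s w"
proof -
  have "((\<lambda>u. htime v a u w - u / 2) has_real_derivative phi a (tshift (u *\<^sub>R v) w) - 1/2) (at u)" for u
    by (auto intro!: derivative_eq_intros htime_has_derivative)
  then have "htime v a s w - s / 2 \<le> htime v a t w - t / 2"
    using phi_bounds(1) by (intro DERIV_nonneg_imp_nondecreasing[OF assms]) (metis diff_ge_0_iff_ge)
  then show ?thesis by (simp add: field_simps)
qed

lemma htime_inverse_lipschitz: "\<bar>s - t\<bar> \<le> 2 * \<bar>htime v a s w - htime v a t w\<bar>"
  using htime_mono[of s t v a w] htime_mono[of t s v a w] by (cases "s \<le> t") auto

lemma htime_inj: "htime v a s w = htime v a t w \<Longrightarrow> s = t"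
  using htime_inverse_lipschitz[of s t v a w] by simp

lemma htime_surj: "\<exists>s. htime v a s w = t"
proof -
  have c: "isCont (\<lambda>s. htime v a s w) x" for x
    using htime_has_derivative by (rule DERIV_isCont)
  have "htime v a (- 2 * \<bar>t\<bar>) w \<le> t" "t \<le> htime v a (2 * \<bar>t\<bar>) w"
    using htime_mono[of "- 2 * \<bar>t\<bar>" 0 v a w] htime_mono[of 0 "2 * \<bar>t\<bar>" v a w] by simp_all
  then have "\<exists>x\<ge>- 2 * \<bar>t\<bar>. x \<le> 2 * \<bar>t\<bar> \<and> htime v a x w = t"
    using c by (intro IVT) auto
  then show ?thesis by blast
qed

section \<open>The inverse time change and the flow\<close>

definition sg :: "real \<times> real \<Rightarrow> (nat \<Rightarrow> real) \<Rightarrow> real \<Rightarrow> torus \<Rightarrow> real" where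
  "sg v a t w = (THE s. htime v a s w = t)"

lemma htime_sg [simp]: "htime v a (sg v a t w) w = t"
  unfolding sg_def
proof (rule theI', rule ex_ex1I)
  show "\<exists>s. htime v a s w = t" by (rule htime_surj)
  show "s = s'" if "htime v a s w = t" "htime v a s' w = t" for s s'
    using that by (intro htime_inj[of v a s w s']) simp
qed

lemma sg_eqI: "htime v a s w = t \<Longrightarrow> sg v a t w = s"
  using htime_inj[of v a "sg v a t w" w s] by simp

lemma sg_0 [simp]: "sg v a 0 w = 0"
  by (rule sg_eqI) simp

text \<open>Freeze \<open>s\<close>, the value at \<open>x\<close>. At a nearby \<open>y\<close> the
  inverse Lipschitz bound compares the true displacement with \<open>s\<close> through the defect of
  \<open>htime\<close> at the fixed \<open>s\<close>, which is already known to be continuous; no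
  implicit function theorem enters.\<close>

lemma continuous_on_sg [continuous_intros]:
  fixes f :: "'x::t2_space \<Rightarrow> real \<times> real"
  assumes "continuous_on UNIV f" "continuous_on UNIV g" "continuous_on UNIV \<tau>" "continuous_on UNIV h"
  shows "continuous_on UNIV (\<lambda>x. sg (f x) (g x) (\<tau> x) (h x))"
  unfolding continuous_on_eq_continuous_at[OF open_UNIV] continuous_at
proof (rule ballI)
  fix x
  define s where "s = sg (f x) (g x) (\<tau> x) (h x)"
  have c: "continuous_on UNIV (\<lambda>y. htime (f y) (g y) s (h y))"
    by (rule continuous_on_htime) (rule assms)+
  have 1: "((\<lambda>y. htime (f y) (g y) s (h y)) \<longlongrightarrow> \<tau> x) (at x)"
  proof -
    from c have "isCont (\<lambda>y. htime (f y) (g y) s (h y)) x" by (simp add: continuous_on_eq_continuous_at)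
    moreover have "htime (f x) (g x) s (h x) = \<tau> x" by (simp add: s_def)
    ultimately show ?thesis by (simp add: isCont_def)
  qed
  have 2: "(\<tau> \<longlongrightarrow> \<tau> x) (at x)" using assms(3) by (simp add: continuous_on_eq_continuous_at continuous_at)
  have "((\<lambda>y. 2 * \<bar>\<tau> y - htime (f y) (g y) s (h y)\<bar>) \<longlongrightarrow> 2 * \<bar>\<tau> x - \<tau> x\<bar>) (at x)"
    by (intro tendsto_intros 1 2)
  then have 3: "((\<lambda>y. 2 * \<bar>\<tau> y - htime (f y) (g y) s (h y)\<bar>) \<longlongrightarrow> 0) (at x)" by simp
  have "((\<lambda>y. sg (f y) (g y) (\<tau> y) (h y) - s) \<longlongrightarrow> 0) (at x)"
  proof (rule Lim_null_comparison[OF _ 3], rule always_eventually, rule allI)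
    fix y
    show "norm (sg (f y) (g y) (\<tau> y) (h y) - s) \<le> 2 * \<bar>\<tau> y - htime (f y) (g y) s (h y)\<bar>"
      using htime_inverse_lipschitz[of "sg (f y) (g y) (\<tau> y) (h y)" s "f y" "g y" "h y"] by simp
  qed
  then show "((\<lambda>y. sg (f y) (g y) (\<tau> y) (h y)) \<longlongrightarrow> sg (f x) (g x) (\<tau> x) (h x)) (at x)"
    unfolding s_def[symmetric] by (simp add: LIM_zero_iff)
qed

definition Phi :: "real \<times> real \<Rightarrow> (nat \<Rightarrow> real) \<Rightarrow> real \<Rightarrow> torus \<Rightarrow> torus" where
  "Phi v a t w = tshift (sg v a t w *\<^sub>R v) w"

lemma Phi_0 [simp]: "Phi v a 0 w = w"
  by (simp add: Phi_def)

lemma Phi_htime: "Phi v a (htime v a s w) w = tshift (s *\<^sub>R v) w"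
  by (simp add: Phi_def sg_eqI)

lemma Phi_add: "Phi v a (s + t) w = Phi v a s (Phi v a t w)"
proof -
  have "sg v a (s + t) w = sg v a t w + sg v a s (Phi v a t w)"
    by (rule sg_eqI) (simp add: htime_add Phi_def[symmetric])
  then show ?thesis by (simp add: Phi_def tshift_tshift scaleR_add_left add.commute)
qed

lemma continuous_on_Phi [continuous_intros]:
  fixes f :: "'x::t2_space \<Rightarrow> real \<times> real"
  assumes "continuous_on UNIV f" "continuous_on UNIV g" "continuous_on UNIV \<tau>" "continuous_on UNIV h"
  shows "continuous_on UNIV (\<lambda>x. Phi (f x) (g x) (\<tau> x) (h x))"
  unfolding Phi_def by (intro continuous_intros assms)

lemma sg_has_derivative:
  "((\<lambda>t. sg v a t w) has_real_derivative 1 / phi a (Phi v a t w)) (at t)"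
proof -
  have "((\<lambda>t. sg v a t w) has_real_derivative inverse (phi a (Phi v a t w))) (at t)"
  proof (rule DERIV_inverse_function[where a = "t - 1" and b = "t + 1" and f = "\<lambda>s. htime v a s w"])
    show "((\<lambda>s. htime v a s w) has_real_derivative phi a (Phi v a t w)) (at (sg v a t w))"
      unfolding Phi_def by (rule htime_has_derivative)
    show "phi a (Phi v a t w) \<noteq> 0" using phi_pos[of a "Phi v a t w"] by linarith
    have "continuous_on UNIV (\<lambda>t. sg v a t w)" by (intro continuous_intros)
    then show "isCont (\<lambda>t. sg v a t w) t" by (simp add: continuous_on_eq_continuous_at)
  qed auto
  then show ?thesis by (simp add: inverse_eq_divide)
qed

lemma reparametrized_flow_Phi:
  assumes "fst v \<noteq> 0"
  shows "reparametrized_flow (snd v / fst v) (\<lambda>w. fst v / phi a w) (Phi v a)"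
  unfolding reparametrized_flow_def
proof (intro allI conjI)
  fix z
  show "\<exists>\<gamma>. \<forall>t. to_torus (\<gamma> t) = Phi v a t z \<and> (\<gamma> has_vector_derivative
      (fst v / phi a (Phi v a t z), snd v / fst v * (fst v / phi a (Phi v a t z)))) (at t)"
  proof (intro exI[of _ "\<lambda>t. rep_torus z + sg v a t z *\<^sub>R v"] allI conjI)
    fix t
    show "to_torus (rep_torus z + sg v a t z *\<^sub>R v) = Phi v a t z" by (simp add: Phi_def tshift_def)
    have "((\<lambda>t. rep_torus z + sg v a t z *\<^sub>R v) has_vector_derivative (1 / phi a (Phi v a t z)) *\<^sub>R v) (at t)"
      using sg_has_derivative[of v a z t]
      by (auto intro!: derivative_eq_intros simp: has_vector_derivative_def has_field_derivative_def mult.commute)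
    moreover have "(1 / phi a (Phi v a t z)) *\<^sub>R v = (fst v / phi a (Phi v a t z), snd v / fst v * (fst v / phi a (Phi v a t z)))"
      using assms by (simp add: prod_eq_iff)
    ultimately show "((\<lambda>t. rep_torus z + sg v a t z *\<^sub>R v) has_vector_derivative
      (fst v / phi a (Phi v a t z), snd v / fst v * (fst v / phi a (Phi v a t z)))) (at t)" by simp
  qed
qed simp

section \<open>Coboundaries and the invariant measure\<close>

text \<open>\<open>Y\<close> is the derivative of \<open>X\<close> along the linear flow in
  direction \<open>v\<close>. For the time-changed flow the derivative is \<open>Y / phi\<close>,
  which is why factors \<open>phi a\<close> accompany the coboundaries below. The derivative at 0
  for all \<open>w\<close> gives the derivative along the whole line.\<close>

definition cob :: "real \<times> real \<Rightarrow> (torus \<Rightarrow> complex) \<Rightarrow> (torus \<Rightarrow> complex) \<Rightarrow> bool" where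
  "cob v X Y \<longleftrightarrow> continuous_on UNIV X \<and>
     (\<forall>w. ((\<lambda>u. X (tshift (u *\<^sub>R v) w)) has_vector_derivative Y w) (at 0))"

lemma cobD:
  assumes "cob v X Y"
  shows "continuous_on UNIV X" "((\<lambda>u. X (tshift (u *\<^sub>R v) w)) has_vector_derivative Y w) (at 0)"
  using assms unfolding cob_def by blast+

lemma cob_at:
  assumes "cob v X Y"
  shows "((\<lambda>u. X (tshift (u *\<^sub>R v) w)) has_vector_derivative Y (tshift (s *\<^sub>R v) w)) (at s)"
proof -
  let ?f = "\<lambda>u. X (tshift (u *\<^sub>R v) (tshift (s *\<^sub>R v) w))"
  have "(?f has_vector_derivative Y (tshift (s *\<^sub>R v) w)) (at (s - s))"
    using cobD(2)[OF assms] by simp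
  moreover have "((\<lambda>u. u - s) has_vector_derivative 1) (at s)"
    by (auto intro!: derivative_eq_intros)
  ultimately have "((?f \<circ> (\<lambda>u. u - s)) has_vector_derivative 1 *\<^sub>R Y (tshift (s *\<^sub>R v) w)) (at s)"
    by (intro vector_diff_chain_at)
  then show ?thesis by (simp add: o_def tshift_tshift scaleR_left_diff_distrib)
qed

lemma cob_integral:
  assumes cob: "cob v X Y" and "0 \<le> T" 
  shows "((\<lambda>s. Y (tshift (s *\<^sub>R v) w)) has_integral X (tshift (T *\<^sub>R v) w) - X w) {0..T}"
proof -
  have "((\<lambda>s. Y (tshift (s *\<^sub>R v) w)) has_integral X (tshift (T *\<^sub>R v) w) - X (tshift (0 *\<^sub>R v) w)) {0..T}"
    by (intro fundamental_theorem_of_calculus assms has_vector_derivative_at_within[OF cob_at[OF cob]])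
  then show ?thesis by simp
qed

lemma cob_add: "cob v X Y \<Longrightarrow> cob v X' Y' \<Longrightarrow> cob v (\<lambda>w. X w + X' w) (\<lambda>w. Y w + Y' w)"
  unfolding cob_def by (auto intro!: continuous_intros has_vector_derivative_add)

lemma cob_scale: "cob v X Y \<Longrightarrow> cob v (\<lambda>w. c * X w) (\<lambda>w. c * Y w)"
  unfolding cob_def by (auto intro!: continuous_intros has_vector_derivative_mult_right)

lemma cob_bounded_difference:
  assumes cob: "cob v X Y" and B: "\<And>w. cmod (Y w) \<le> B"
  shows "cmod (X (tshift (s *\<^sub>R v) w) - X w) \<le> B * \<bar>s\<bar>"
proof -
  have "norm (X (tshift (s *\<^sub>R v) w) - X (tshift (0 *\<^sub>R v) w)) \<le> B * norm (s - 0)"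
  proof (rule differentiable_bound[of UNIV])
    show "((\<lambda>s. X (tshift (s *\<^sub>R v) w)) has_derivative (\<lambda>h. h *\<^sub>R Y (tshift (x *\<^sub>R v) w))) (at x within UNIV)" for x
      using cob_at[OF cob] by (simp add: has_vector_derivative_def)
    show "onorm (\<lambda>h::real. h *\<^sub>R Y (tshift (x *\<^sub>R v) w)) \<le> B" for x
      by (intro onorm_le) (simp add: mult.commute[of B] mult_left_mono B)
  qed auto
  then show ?thesis by simp
qed

text \<open>Difference quotients of \<open>X\<close> have integral 0 by translation invariance, are
  bounded by the supremum of \<open>Y\<close>, and converge pointwise to \<open>Y\<close>.\<close>

lemma cob_haar:
  assumes cob: "cob v X Y" and Y: "continuous_on UNIV Y"
  shows "(\<integral>w. Y w \<partial>haar) = 0"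
proof -
  have X: "continuous_on UNIV X" by (rule cobD(1)[OF cob])
  obtain B where B: "B > 0" "\<And>w. cmod (Y w) \<le> B" using torus_bounded[OF Y] by metis
  define D where "D n w = of_nat (Suc n) * (X (tshift ((1 / real (Suc n)) *\<^sub>R v) w) - X w)" for n w
  have cD: "continuous_on UNIV (\<lambda>w. X (tshift u w))" for u
    by (rule continuous_on_compose2[OF X]) (auto intro: continuous_intros)
  have Di: "(\<integral>w. D n w \<partial>haar) = 0" for n
    unfolding D_def using haar_integrable[OF cD] haar_integrable[OF X] haar_tshift[OF X]
    by simp
  have "(\<lambda>n. \<integral>w. D n w \<partial>haar) \<longlonglongrightarrow> (\<integral>w. Y w \<partial>haar)"
  proof (rule integral_dominated_convergence[where w = "\<lambda>_. B"])
    show "Y \<in> borel_measurable haar" using haar_integrable[OF Y] by (rule borel_measurable_integrable)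
    have "continuous_on UNIV (D n)" for n unfolding D_def by (intro continuous_intros cD X)
    then show "D n \<in> borel_measurable haar" for n using haar_integrable borel_measurable_integrable by blast
    show "AE w in haar. norm (D n w) \<le> B" for n
    proof (rule AE_I2)
      fix w
      have "norm (D n w) \<le> real (Suc n) * (B * \<bar>1 / real (Suc n)\<bar>)"
        unfolding D_def norm_mult norm_of_nat
        by (intro mult_left_mono cob_bounded_difference[OF cob B(2)]) simp
      then show "norm (D n w) \<le> B" by simp
    qed
    show "AE w in haar. (\<lambda>n. D n w) \<longlonglongrightarrow> Y w"
    proof (rule AE_I2)
      fix w
      let ?f = "\<lambda>u. X (tshift (u *\<^sub>R v) w)"
      have "(?f has_vector_derivative Y w) (at 0)" by (rule cobD(2)[OF cob])
      then have "((\<lambda>h. norm (?f (0 + h) - ?f 0 - h *\<^sub>R Y w) / norm h) \<longlongrightarrow> 0) (at 0)"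
        by (simp add: has_vector_derivative_def has_derivative_at)
      moreover have "filterlim (\<lambda>n. 1 / real (Suc n)) (at 0) sequentially"
        using LIMSEQ_Suc[OF lim_1_over_n] by (simp add: filterlim_at)
      ultimately have "(\<lambda>n. norm (?f (0 + 1 / real (Suc n)) - ?f 0 - (1 / real (Suc n)) *\<^sub>R Y w) / norm (1 / real (Suc n))) \<longlonglongrightarrow> 0"
        by (rule filterlim_compose)
      moreover have "norm (?f (0 + 1 / real (Suc n)) - ?f 0 - (1 / real (Suc n)) *\<^sub>R Y w) / norm (1 / real (Suc n)) =
          norm (D n w - Y w)" for n
      proof -
        have "D n w - Y w = of_nat (Suc n) * (?f (0 + 1 / real (Suc n)) - ?f 0 - (1 / real (Suc n)) *\<^sub>R Y w)"
          by (simp add: D_def scaleR_conv_of_real right_diff_distrib del: of_nat_Suc)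
        then show ?thesis by (simp only: norm_mult norm_of_nat) (simp del: of_nat_Suc)
      qed
      ultimately have "(\<lambda>n. norm (D n w - Y w)) \<longlonglongrightarrow> 0" by simp
      then show "(\<lambda>n. D n w) \<longlonglongrightarrow> Y w"
        by (simp only: tendsto_norm_zero_iff LIM_zero_iff)
    qed
  qed simp
  then show ?thesis unfolding Di by (rule LIMSEQ_unique) simp
qed

section \<open>The invariant measure\<close>

definition mu :: "(nat \<Rightarrow> real) \<Rightarrow> torus measure" where
  "mu a = density haar (\<lambda>w. ennreal (phi a w))"

lemma sets_mu [simp, measurable_cong]: "sets (mu a) = sets borel"
  by (simp add: mu_def)

lemma space_mu [simp]: "space (mu a) = UNIV"
  by (simp add: mu_def)

lemma phi_nonneg [simp]: "0 \<le> phi a w"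
  using phi_pos[of a w] by linarith

lemma phi_measurable [measurable]: "phi a \<in> borel_measurable borel"
  by (intro borel_measurable_continuous_onI continuous_intros)

lemma integral_mu:
  fixes f :: "torus \<Rightarrow> 'b::{banach, second_countable_topology}"
  assumes [measurable]: "f \<in> borel_measurable borel"
  shows "integral\<^sup>L (mu a) f = (\<integral>w. phi a w *\<^sub>R f w \<partial>haar)"
  unfolding mu_def by (rule integral_density) auto

text \<open>All frequencies \<open>kap i\<close> are nonzero, so termwise integration leaves only
  the constant 1.\<close>

lemma integral_phi: "(\<integral>w. phi a w \<partial>haar) = 1"
proof -
  have i: "integrable haar (\<lambda>w. cf a i * Re (tchi (kap i) w))" for i
    by (intro haar_integrable continuous_intros kap_lat)
  have t: "(\<integral>w. cf a i * Re (tchi (kap i) w) \<partial>haar) = 0" for i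
    using integral_Re[OF haar_integrable[OF continuous_on_tchi[OF kap_lat]]] integral_tchi[OF kap_lat] kap_nonzero
    by simp
  have b: "(\<integral>w. \<bar>cf a i * Re (tchi (kap i) w)\<bar> \<partial>haar) \<le> (1/2) ^ (i + 2)" for i
    using norm_integral_le[OF prob_space_haar, of "\<lambda>w. \<bar>cf a i * Re (tchi (kap i) w)\<bar>" "(1/2) ^ (i + 2)"] i[of i] abs_phi_term[of a i]
    by simp
  have "(\<integral>w. (\<Sum>i. cf a i * Re (tchi (kap i) w)) \<partial>haar) = (\<Sum>i. \<integral>w. cf a i * Re (tchi (kap i) w) \<partial>haar)"
  proof (rule integral_suminf[OF i])
    show "AE w in haar. summable (\<lambda>i. norm (cf a i * Re (tchi (kap i) w)))"
      using abs_phi_term by (intro AE_I2 summable_comparison_test'[OF summable_half]) simp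
    show "summable (\<lambda>i. \<integral>w. norm (cf a i * Re (tchi (kap i) w)) \<partial>haar)"
      using b by (intro summable_comparison_test'[OF summable_half]) simp
  qed
  then have z: "(\<integral>w. (\<Sum>i. cf a i * Re (tchi (kap i) w)) \<partial>haar) = 0" unfolding t by simp
  have "integrable haar (phi a)" by (intro haar_integrable continuous_intros)
  then have "integrable haar (\<lambda>w. phi a w - 1)" by simp
  then have "integrable haar (\<lambda>w. \<Sum>i. cf a i * Re (tchi (kap i) w))" by (simp add: phi_def)
  then have "(\<integral>w. 1 + (\<Sum>i. cf a i * Re (tchi (kap i) w)) \<partial>haar) = (\<integral>w. 1 \<partial>haar) + 0"
    unfolding z[symmetric] by (intro Bochner_Integration.integral_add) auto
  then show ?thesis using haar.prob_space by (simp add: phi_def[abs_def])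
qed

lemma prob_space_mu: "prob_space (mu a)"
proof
  have "integrable haar (phi a)" by (intro haar_integrable continuous_intros)
  then have "(\<integral>\<^sup>+ w. ennreal (phi a w) \<partial>haar) = ennreal 1"
    using integral_phi[of a] by (subst nn_integral_eq_integral) auto
  then show "emeasure (mu a) (space (mu a)) = 1"
    unfolding mu_def by (subst emeasure_density) auto
qed

lemma mu_integrable:
  fixes f :: "torus \<Rightarrow> 'b::{banach, second_countable_topology}"
  shows "continuous_on UNIV f \<Longrightarrow> integrable (mu a) f"
  by (rule continuous_integrable) (simp_all add: prob_space.finite_measure[OF prob_space_mu])

lemma continuous_on_Phi_w: "continuous_on UNIV g \<Longrightarrow> continuous_on UNIV (\<lambda>w. g (Phi v a t w))"
  by (rule continuous_on_compose2) (auto intro!: continuous_intros)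

text \<open>Invariance says that \<open>phi * (g \<circ> Phi t - g)\<close> has Haar integral 0, and
  this function is a coboundary: its primitive along \<open>v\<close> is the integral of
  \<open>g\<close> over the orbit segment of duration \<open>t\<close>.\<close>

lemma mu_invariant_pos:
  fixes g :: "torus \<Rightarrow> complex"
  assumes g: "continuous_on UNIV g" and t: "0 \<le> t"
  shows "(\<integral>w. g (Phi v a t w) \<partial>mu a) = (\<integral>w. g w \<partial>mu a)"
proof -
  define X where "X w = integral (cbox 0 t) (\<lambda>\<tau>. g (Phi v a \<tau> w))" for w
  have "cob v X (\<lambda>w. of_real (phi a w) * (g (Phi v a t w) - g w))"
    unfolding cob_def
  proof (intro conjI allI)
    have "continuous_on UNIV (\<lambda>p. g (Phi v a (snd p) (fst p)))"
      by (rule continuous_on_compose2[OF g]) (auto intro!: continuous_intros)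
    then show "continuous_on UNIV X"
      unfolding X_def by (intro integral_continuous_on_param) (auto simp: case_prod_unfold intro: continuous_on_subset)
    fix w
    define F where "F \<tau> = g (Phi v a \<tau> w)" for \<tau>
    have "continuous_on UNIV F"
      unfolding F_def by (rule continuous_on_compose2[OF g]) (auto intro!: continuous_intros)
    from antiderivative_real[OF this] obtain G where G: "\<forall>x. (G has_vector_derivative F x) (at x)" ..
    \<comment> \<open>Moving by \<open>u *\<^sub>R v\<close> advances the time window by
      \<open>htime v a u w\<close>, so along the line \<open>X\<close> is the difference of an
      antiderivative at the two ends of the moved window.\<close>
    have X_eq: "X (tshift (u *\<^sub>R v) w) = G (htime v a u w + t) - G (htime v a u w)" for u
    proof -
      let ?h = "htime v a u w"
      have "((\<lambda>\<tau>. G (\<tau> + ?h)) has_vector_derivative F (\<tau> + ?h)) (at \<tau>)" for \<tau>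
      proof -
        have "((\<lambda>\<tau>. \<tau> + ?h) has_vector_derivative 1) (at \<tau>)" by (auto intro!: derivative_eq_intros)
        from vector_diff_chain_at[OF this, of G "F (\<tau> + ?h)"] show ?thesis using G by (simp add: o_def)
      qed
      then have "((\<lambda>\<tau>. F (\<tau> + ?h)) has_integral G (t + ?h) - G (0 + ?h)) {0..t}"
        by (intro fundamental_theorem_of_calculus t) (auto intro: has_vector_derivative_at_within)
      moreover have "g (Phi v a \<tau> (tshift (u *\<^sub>R v) w)) = F (\<tau> + ?h)" for \<tau>
        by (simp add: F_def Phi_add Phi_htime)
      ultimately show ?thesis by (simp add: X_def integral_unique add.commute)
    qed
    have h: "((\<lambda>u. htime v a u w) has_vector_derivative phi a w) (at 0)"
      using htime_has_derivative[of v a w 0] by (simp add: has_real_derivative_iff_has_vector_derivative)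
    then have h': "((\<lambda>u. htime v a u w + t) has_vector_derivative phi a w) (at 0)"
      by (auto intro!: derivative_eq_intros)
    have "((\<lambda>u. G (htime v a u w + t) - G (htime v a u w)) has_vector_derivative
        phi a w *\<^sub>R F (0 + t) - phi a w *\<^sub>R F 0) (at 0)"
      using vector_diff_chain_at[OF h', of G "F (0 + t)"] vector_diff_chain_at[OF h, of G "F 0"] G
      by (intro has_vector_derivative_diff) (simp_all add: o_def)
    then show "((\<lambda>u. X (tshift (u *\<^sub>R v) w)) has_vector_derivative of_real (phi a w) * (g (Phi v a t w) - g w)) (at 0)"
      unfolding X_eq by (simp add: F_def scaleR_conv_of_real right_diff_distrib)
  qed
  moreover have c: "continuous_on UNIV (\<lambda>w. of_real (phi a w) * (g (Phi v a t w) - g w))"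
    by (intro continuous_intros continuous_on_Phi_w g)
  ultimately have "(\<integral>w. of_real (phi a w) * (g (Phi v a t w) - g w) \<partial>haar) = 0" by (rule cob_haar)
  moreover have "integral\<^sup>L (mu a) (\<lambda>w. g (Phi v a t w) - g w) = (\<integral>w. of_real (phi a w) * (g (Phi v a t w) - g w) \<partial>haar)"
    by (subst integral_mu) (auto simp: scaleR_conv_of_real intro!: borel_measurable_continuous_onI continuous_intros continuous_on_Phi_w g)
  ultimately show ?thesis
    using mu_integrable[OF g] mu_integrable[OF continuous_on_Phi_w[OF g]] by simp
qed

lemma Phi_measurable [measurable]: "Phi v a t \<in> borel_measurable borel"
  by (intro borel_measurable_continuous_onI continuous_intros)

lemma distr_mu_pos:
  assumes "0 \<le> t" shows "distr (mu a) (mu a) (Phi v a t) = mu a"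
proof (rule measure_eqI_continuous)
  interpret prob_space "mu a" by (rule prob_space_mu)
  have "prob_space (distr (mu a) (mu a) (Phi v a t))" by (rule prob_space_distr) measurable
  then show "finite_measure (distr (mu a) (mu a) (Phi v a t))" by (rule prob_space.finite_measure)
  show "finite_measure (mu a)" by (rule finite_measure_axioms)
  fix f :: "torus \<Rightarrow> real" assume f: "continuous_on UNIV f"
  have [measurable]: "f \<in> borel_measurable borel" by (intro borel_measurable_continuous_onI f)
  have "complex_of_real (\<integral>w. f (Phi v a t w) \<partial>mu a) = complex_of_real (\<integral>w. f w \<partial>mu a)"
    using mu_invariant_pos[where g = "\<lambda>w. complex_of_real (f w)" and t = t and v = v and a = a] assms f
    by (simp add: continuous_on_of_real)
  then show "integral\<^sup>L (distr (mu a) (mu a) (Phi v a t)) f = integral\<^sup>L (mu a) f"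
    by (subst integral_distr) auto
qed simp_all

lemma invariant_prob_mu: "invariant_prob (Phi v a) (mu a)"
  unfolding invariant_prob_def
proof (intro conjI allI)
  show "prob_space (mu a)" by (rule prob_space_mu)
  show "Phi v a t \<in> measurable (mu a) (mu a)" for t by measurable
  fix t
  show "distr (mu a) (mu a) (Phi v a t) = mu a"
  proof (cases "0 \<le> t")
    case False
    then have "mu a = distr (mu a) (mu a) (Phi v a (- t))" by (simp add: distr_mu_pos)
    then have "distr (mu a) (mu a) (Phi v a t) = distr (distr (mu a) (mu a) (Phi v a (- t))) (mu a) (Phi v a t)" by simp
    also have "\<dots> = distr (mu a) (mu a) (Phi v a t \<circ> Phi v a (- t))" by (rule distr_distr) measurable
    also have "Phi v a t \<circ> Phi v a (- t) = (\<lambda>w. w)" by (auto simp: Phi_add[symmetric])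
    also have "distr (mu a) (mu a) (\<lambda>w. w) = mu a" by (rule distr_id)
    finally show ?thesis .
  qed (rule distr_mu_pos)
qed simp_all

lemma mu_invariant:
  fixes g :: "torus \<Rightarrow> complex"
  assumes g: "continuous_on UNIV g"
  shows "(\<integral>w. g (Phi v a t w) \<partial>mu a) = (\<integral>w. g w \<partial>mu a)"
proof -
  have "(\<integral>w. g w \<partial>distr (mu a) (mu a) (Phi v a t)) = (\<integral>w. g (Phi v a t w) \<partial>mu a)"
  proof (rule integral_distr)
    show "g \<in> borel_measurable (mu a)"
      using borel_measurable_integrable[OF mu_integrable[OF g]] .
  qed measurable
  then show ?thesis using invariant_prob_mu[of v a] by (simp add: invariant_prob_def)
qed

section \<open>Parameter dependence\<close>

lemma continuous_on_integral_haar: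
  fixes F :: "'x::metric_space \<Rightarrow> torus \<Rightarrow> complex"
  assumes F: "continuous_on UNIV (\<lambda>p. F (fst p) (snd p))" and B: "\<And>x w. cmod (F x w) \<le> B"
  shows "continuous_on UNIV (\<lambda>x. \<integral>w. F x w \<partial>haar)"
  unfolding continuous_on_sequentially
proof (intro allI ballI impI, elim conjE)
  fix x :: "nat \<Rightarrow> 'x" and l assume x: "x \<longlonglongrightarrow> l"
  have c: "continuous_on UNIV (F y)" for y
    using continuous_on_compose2[OF F continuous_on_Pair[OF continuous_on_const[of UNIV y] continuous_on_id]] by simp
  have m: "F y \<in> borel_measurable haar" for y
    using haar_integrable[OF c] by (rule borel_measurable_integrable)
  show "((\<lambda>x. \<integral>w. F x w \<partial>haar) \<circ> x) \<longlonglongrightarrow> (\<integral>w. F l w \<partial>haar)"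
    unfolding o_def
  proof (rule integral_dominated_convergence[where w = "\<lambda>_. B"])
    show "AE w in haar. (\<lambda>n. F (x n) w) \<longlonglongrightarrow> F l w"
    proof (rule AE_I2)
      fix w
      have "continuous_on UNIV (\<lambda>y. F y w)"
        using continuous_on_compose2[OF F continuous_on_Pair[OF continuous_on_id continuous_on_const[of UNIV w]]] by simp
      then show "(\<lambda>n. F (x n) w) \<longlonglongrightarrow> F l w"
        using x unfolding continuous_on_sequentially by (auto simp: o_def)
    qed
  qed (auto simp: m B)
qed

text \<open>Compactness of the torus: by the tube lemma one neighbourhood of the parameter serves
  all \<open>w\<close> at once.\<close>

lemma open_uniform_less:
  fixes F :: "'x::topological_space \<Rightarrow> torus \<Rightarrow> real"
  assumes F: "continuous_on UNIV (\<lambda>p. F (fst p) (snd p))"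
  shows "open {x. \<forall>w. F x w < e}"
proof (subst open_subopen, intro ballI)
  fix x assume x: "x \<in> {x. \<forall>w. F x w < e}"
  define W where "W = {p. F (fst p) (snd p) < e}"
  have "open W" unfolding W_def by (intro open_Collect_less F continuous_on_const)
  moreover have "{x} \<times> UNIV \<subseteq> W" using x by (auto simp: W_def)
  ultimately obtain X0 where "x \<in> X0" "open X0" "X0 \<times> UNIV \<subseteq> W"
    using Elementary_Topology.tube_lemma[OF compact_torus] by metis
  moreover have "F y w < e" if "y \<in> X0" for y w
  proof -
    have "(y, w) \<in> W" using that \<open>X0 \<times> UNIV \<subseteq> W\<close> by blast
    then show ?thesis by (simp add: W_def)
  qed
  ultimately show "\<exists>T. open T \<and> x \<in> T \<and> T \<subseteq> {x. \<forall>w. F x w < e}" by blast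
qed

section \<open>Smoothness\<close>

lemma C_k_SucI:
  assumes "\<And>x. (f has_derivative f' x) (at x)" "\<And>v. C_k k (\<lambda>x. f' x v)"
  shows "C_k (Suc k) f"
proof -
  have "frechet_derivative f (at x) = f' x" for x
    using frechet_derivative_at[OF assms(1)] by simp
  then show ?thesis using assms by (auto simp: differentiable_def)
qed

lemma C_k_SucD:
  assumes "C_k (Suc k) f"
  shows "(f has_derivative frechet_derivative f (at x)) (at x)" "C_k k (\<lambda>x. frechet_derivative f (at x) v)"
  using assms by (auto simp: frechet_derivative_works)

lemma C_k_continuous: "C_k k f \<Longrightarrow> continuous_on UNIV f"
  by (cases k) (auto simp: continuous_on_eq_continuous_at intro: differentiable_imp_continuous_within)

lemma C_k_le: "C_k (Suc k) f \<Longrightarrow> C_k k f"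
proof (induction k arbitrary: f)
  case 0
  then show ?case using C_k_continuous by fastforce
next
  case (Suc k)
  then show ?case by (metis C_k.simps(2))
qed

lemma C_k_const: "C_k k (\<lambda>_. c)"
proof (induction k arbitrary: c)
  case (Suc k)
  then show ?case by (intro C_k_SucI[where f' = "\<lambda>_ _. 0"]) auto
qed simp

lemma C_k_add:
  fixes f g :: "'a::real_normed_vector \<Rightarrow> 'b::real_normed_vector"
  shows "C_k k f \<Longrightarrow> C_k k g \<Longrightarrow> C_k k (\<lambda>x. f x + g x)"
proof (induction k arbitrary: f g)
  case 0
  then show ?case by (simp add: continuous_on_add)
next
  case (Suc k)
  show ?case
    by (rule C_k_SucI[OF has_derivative_add[OF C_k_SucD(1)[OF Suc.prems(1)] C_k_SucD(1)[OF Suc.prems(2)]]])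
      (rule Suc.IH[OF C_k_SucD(2)[OF Suc.prems(1)] C_k_SucD(2)[OF Suc.prems(2)]])
qed

lemma C_k_mult:
  fixes f g :: "'a::real_normed_vector \<Rightarrow> real"
  shows "C_k k f \<Longrightarrow> C_k k g \<Longrightarrow> C_k k (\<lambda>x. f x * g x)"
proof (induction k arbitrary: f g)
  case 0
  then show ?case by (simp add: continuous_on_mult)
next
  case (Suc k)
  show ?case
    by (rule C_k_SucI[OF has_derivative_mult[OF C_k_SucD(1)[OF Suc.prems(1)] C_k_SucD(1)[OF Suc.prems(2)]]])
      (rule C_k_add[OF Suc.IH[OF C_k_le[OF Suc.prems(1)] C_k_SucD(2)[OF Suc.prems(2)]]
            Suc.IH[OF C_k_SucD(2)[OF Suc.prems(1)] C_k_le[OF Suc.prems(2)]]])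
qed

lemma C_k_inverse:
  fixes f :: "'a::real_normed_vector \<Rightarrow> real"
  assumes "\<And>x. f x \<noteq> 0"
  shows "C_k k f \<Longrightarrow> C_k k (\<lambda>x. inverse (f x))"
proof (induction k)
  case 0
  then show ?case using assms by (simp add: continuous_on_inverse)
next
  case (Suc k)
  show ?case
  proof (rule C_k_SucI)
    show "((\<lambda>x. inverse (f x)) has_derivative (\<lambda>h. - 1 * (inverse (f x) * frechet_derivative f (at x) h * inverse (f x)))) (at x)" for x
      using Deriv.has_derivative_inverse[OF assms C_k_SucD(1)[OF Suc.prems]] by simp
    show "C_k k (\<lambda>x. - 1 * (inverse (f x) * frechet_derivative f (at x) v * inverse (f x)))" for v
      using Suc.IH[OF C_k_le[OF Suc.prems]] C_k_SucD(2)[OF Suc.prems]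
      by (intro C_k_mult C_k_const)
  qed
qed

section \<open>Smoothness of rapidly decaying cosine series\<close>

definition rapid :: "(nat \<Rightarrow> real) \<Rightarrow> bool" where
  "rapid c \<longleftrightarrow> (\<forall>k. summable (\<lambda>i. \<bar>c i\<bar> * real (Suc i) ^ k))"

text \<open>The phases \<open>d\<close> close the class under differentiation: a derivative shifts
  every phase by \<open>pi / 2\<close> and multiplies the coefficients by frequencies, and
  \<open>rapid\<close> is stable under the latter.\<close>

definition cos_series :: "(nat \<Rightarrow> real) \<Rightarrow> (nat \<Rightarrow> real) \<Rightarrow> real \<times> real \<Rightarrow> real" where
  "cos_series c d z = (\<Sum>i. c i * cos (2 * pi * (kap i \<bullet> z) + d i))"

lemma rapid_derivative:
  assumes "rapid c" shows "rapid (\<lambda>i. c i * (2 * pi * (kap i \<bullet> v)))"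
  unfolding rapid_def
proof
  fix k
  have "summable (\<lambda>i. ((2 * pi) * (2 * norm v)) * (\<bar>c i\<bar> * real (Suc i) ^ Suc k))"
    using assms unfolding rapid_def by (intro summable_mult) blast
  then show "summable (\<lambda>i. \<bar>c i * (2 * pi * (kap i \<bullet> v))\<bar> * real (Suc i) ^ k)"
  proof (rule summable_comparison_test'[where N = 0])
    fix i
    have "\<bar>c i\<bar> * (2 * pi) * \<bar>kap i \<bullet> v\<bar> * real (Suc i) ^ k \<le> \<bar>c i\<bar> * (2 * pi) * (2 * real (Suc i) * norm v) * real (Suc i) ^ k"
      by (intro mult_right_mono mult_left_mono kap_bound) auto
    then show "norm (\<bar>c i * (2 * pi * (kap i \<bullet> v))\<bar> * real (Suc i) ^ k) \<le> ((2 * pi) * (2 * norm v)) * (\<bar>c i\<bar> * real (Suc i) ^ Suc k)"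
      by (simp only: abs_mult real_norm_def abs_mult power_Suc mult_ac) simp
  qed
qed

lemma summable_cos_series:
  assumes "rapid c" shows "summable (\<lambda>i. c i * cos (x i))"
proof (rule summable_comparison_test'[where N = 0])
  show "summable (\<lambda>i. \<bar>c i\<bar>)" using assms[unfolded rapid_def, rule_format, of 0] by simp
  show "norm (c i * cos (x i)) \<le> \<bar>c i\<bar>" for i
    using mult_left_le[of "\<bar>cos (x i)\<bar>" "\<bar>c i\<bar>"] by (simp add: abs_mult)
qed

lemma cos_series_has_derivative:
  assumes c: "rapid c"
  shows "(cos_series c d has_derivative
    (\<lambda>h. cos_series (\<lambda>i. c i * (2 * pi * (kap i \<bullet> h))) (\<lambda>i. d i + pi / 2) z)) (at z)"
proof -
  define f where "f i z = c i * cos (2 * pi * (kap i \<bullet> z) + d i)" for i z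
  define f' where "f' i z h = (c i * (2 * pi * (kap i \<bullet> h))) * cos (2 * pi * (kap i \<bullet> z) + (d i + pi / 2))" for i z h
  define M where "M i = 4 * pi * (\<bar>c i\<bar> * real (Suc i) ^ 1)" for i
  have M: "summable M" unfolding M_def using c unfolding rapid_def by (intro summable_mult) blast
  have f'_le: "norm (f' i z h) \<le> M i * norm h" for i z h
  proof -
    have "\<bar>c i\<bar> * (2 * pi) * \<bar>kap i \<bullet> h\<bar> * \<bar>cos (2 * pi * (kap i \<bullet> z) + (d i + pi / 2))\<bar>
        \<le> \<bar>c i\<bar> * (2 * pi) * (2 * real (Suc i) * norm h) * 1"
      by (intro mult_mono mult_left_mono kap_bound) auto
    then show ?thesis by (simp add: f'_def M_def abs_mult mult_ac)
  qed
  have "\<exists>g. \<forall>x\<in>UNIV. (\<lambda>n. f n x) sums g x \<and> (g has_derivative (\<lambda>h. \<Sum>i. f' i x h)) (at x within UNIV)"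
  proof (rule has_derivative_series)
    show "(f n has_derivative f' n x) (at x within UNIV)" for n x
    proof -
      have "(f n has_derivative (\<lambda>h. c n * (- sin (2 * pi * (kap n \<bullet> x) + d n) * (2 * pi * (kap n \<bullet> h))))) (at x)"
        unfolding f_def by (auto intro!: derivative_eq_intros)
      moreover have "(\<lambda>h. c n * (- sin (2 * pi * (kap n \<bullet> x) + d n) * (2 * pi * (kap n \<bullet> h)))) = f' n x"
        by (auto simp: f'_def cos_add sin_add add.assoc[symmetric] fun_eq_iff)
      ultimately show ?thesis by simp
    qed
    show "(\<lambda>n. f n 0) sums (\<Sum>n. f n 0)"
      unfolding f_def using summable_cos_series[OF c] by (rule summable_sums)
    fix e :: real assume e: "e > 0"
    have "(\<lambda>n. \<Sum>i. M (i + n)) \<longlonglongrightarrow> 0" using M by (rule suminf_exist_split2)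
    then have "\<forall>\<^sub>F n in sequentially. (\<Sum>i. M (i + n)) < e"
      using e by (rule order_tendstoD(2))
    then show "\<forall>\<^sub>F n in sequentially. \<forall>x\<in>UNIV. \<forall>h. norm ((\<Sum>i<n. f' i x h) - (\<Sum>i. f' i x h)) \<le> e * norm h"
    proof (eventually_elim, intro ballI allI)
      fix n and x h :: "real \<times> real" assume n: "(\<Sum>i. M (i + n)) < e"
      have Mh: "summable (\<lambda>i. M i * norm h)" using M by (rule summable_mult2)
      have s: "summable (\<lambda>i. f' i x h)"
        using f'_le by (intro summable_comparison_test'[OF Mh]) auto
      have "norm ((\<Sum>i<n. f' i x h) - (\<Sum>i. f' i x h)) = norm (\<Sum>i. f' (i + n) x h)"
        using suminf_minus_initial_segment[OF s, of n] by (simp add: norm_minus_commute)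
      also have "\<dots> \<le> (\<Sum>i. M (i + n) * norm h)"
        using f'_le summable_ignore_initial_segment[OF Mh, of n] by (intro norm_suminf_le)
      also have "\<dots> = (\<Sum>i. M (i + n)) * norm h"
        using summable_ignore_initial_segment[OF M, of n] by (rule suminf_mult2[symmetric])
      also have "\<dots> \<le> e * norm h" using n by (intro mult_right_mono) auto
      finally show "norm ((\<Sum>i<n. f' i x h) - (\<Sum>i. f' i x h)) \<le> e * norm h" .
    qed
  qed auto
  then obtain g where g: "\<And>x. (\<lambda>n. f n x) sums g x" "\<And>x. (g has_derivative (\<lambda>h. \<Sum>i. f' i x h)) (at x)"
    by auto
  have "g = cos_series c d" using sums_unique[OF g(1)] by (auto simp: cos_series_def f_def fun_eq_iff)
  with g(2)[of z] show ?thesis by (simp add: cos_series_def f'_def)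
qed

lemma C_k_cos_series: "rapid c \<Longrightarrow> C_k k (cos_series c d)"
proof (induction k arbitrary: c d)
  case 0
  have "continuous_on UNIV (cos_series c d)"
    using cos_series_has_derivative[OF 0] by (intro has_derivative_continuous_on) auto
  then show ?case by simp
next
  case (Suc k)
  show ?case
    by (rule C_k_SucI[OF cos_series_has_derivative[OF Suc.prems]]) (intro Suc.IH rapid_derivative Suc.prems)
qed

lemma rapid_cf: "rapid (cf a)"
  unfolding rapid_def
proof
  fix k
  let ?f = "\<lambda>i. (1/2) ^ (i + 2) * real (Suc i) ^ k"
  \<comment> \<open>The ratio of consecutive terms of \<open>?f\<close> tends to 1/2; the bound 3/4
    is just a number strictly between 1/2 and 1.\<close>
  have "(\<lambda>n. 1/2 * (1 + inverse (real (Suc n))) ^ k) \<longlonglongrightarrow> 1/2 * 1 ^ k"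
    by (intro tendsto_intros LIMSEQ_inverse_real_of_nat_add)
  then have "\<forall>\<^sub>F n in sequentially. 1/2 * (1 + inverse (real (Suc n))) ^ k < 3/4"
    by (rule order_tendstoD(2)) simp
  then obtain N where N: "\<And>n. n \<ge> N \<Longrightarrow> 1/2 * (1 + inverse (real (Suc n))) ^ k < 3/4"
    unfolding eventually_sequentially by blast
  have "summable ?f"
  proof (rule summable_ratio_test[where c = "3/4" and N = N])
    fix n assume "N \<le> n"
    have "real (Suc (Suc n)) = (1 + inverse (real (Suc n))) * real (Suc n)" by (simp add: field_simps)
    then have "?f (Suc n) = (1/2 * (1 + inverse (real (Suc n))) ^ k) * ?f n"
      by (simp only: power_mult_distrib) simp
    also have "\<dots> \<le> 3/4 * ?f n"
      using N[OF \<open>N \<le> n\<close>] by (intro mult_right_mono) auto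
    finally show "norm (?f (Suc n)) \<le> 3/4 * norm (?f n)" by simp
  qed simp
  then show "summable (\<lambda>i. \<bar>cf a i\<bar> * real (Suc i) ^ k)"
  proof (rule summable_comparison_test'[where N = 0])
    show "norm (\<bar>cf a i\<bar> * real (Suc i) ^ k) \<le> ?f i" for i
      using mult_right_mono[OF abs_cf[of a i], of "real (Suc i) ^ k"] by simp
  qed
qed

lemma smooth_speed: "smooth_on_torus (\<lambda>w. c / phi a w)"
  unfolding smooth_on_torus_def
proof
  fix k
  have eq: "phi a (to_torus z) = 1 + cos_series (cf a) (\<lambda>_. 0) z" for z
    by (simp add: phi_def cos_series_def tchi_to_torus kap_lat Re_ee)
  have "C_k k (\<lambda>z. c * inverse (phi a (to_torus z)))"
  proof (intro C_k_mult C_k_const C_k_inverse)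
    show "phi a (to_torus z) \<noteq> 0" for z using phi_pos[of a "to_torus z"] by linarith
    show "C_k k (\<lambda>z. phi a (to_torus z))"
      unfolding eq by (intro C_k_add C_k_const C_k_cos_series rapid_cf)
  qed
  then show "C_k k ((\<lambda>w. c / phi a w) \<circ> to_torus)" by (simp add: o_def divide_inverse)
qed

section \<open>Equidistribution at primes is generic\<close>

lemma prime_avg_add: "prime_avg N (\<lambda>p. f p + g p) = prime_avg N f + prime_avg N g"
  by (simp add: prime_avg_def sum.distrib add_divide_distrib)

lemma prime_avg_mult: "prime_avg N (\<lambda>p. c * f p) = c * prime_avg N f"
  by (simp add: prime_avg_def sum_distrib_left)

lemma prime_avg_const: "prime_count N > 0 \<Longrightarrow> prime_avg N (\<lambda>_. c) = c"
  by (simp only: prime_avg_def sum_constant prime_count_def[symmetric]) simp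

lemma norm_prime_avg_le:
  assumes "\<And>p. cmod (f p) \<le> B" "0 \<le> B" shows "cmod (prime_avg N f) \<le> B"
proof -
  have "cmod (\<Sum>p | prime p \<and> p < N. f p) \<le> (\<Sum>p | prime p \<and> p < N. B)"
    by (intro sum_norm_le assms)
  then have "cmod (\<Sum>p | prime p \<and> p < N. f p) \<le> real (prime_count N) * B"
    by (simp add: prime_count_def)
  then show ?thesis
    using assms(2) by (cases "prime_count N = 0") (simp_all add: prime_avg_def norm_divide field_simps)
qed

text \<open>Uniformity in the starting point is built in: the bound can then be integrated against
  an arbitrary invariant measure, which is how unique ergodicity is obtained.\<close>

definition equidist :: "(nat \<Rightarrow> nat) \<Rightarrow> real \<times> real \<Rightarrow> (nat \<Rightarrow> real) \<Rightarrow> (torus \<Rightarrow> complex) \<Rightarrow> bool" where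
  "equidist N v a f \<longleftrightarrow> (\<forall>e>0. \<forall>\<^sub>F l in sequentially. \<forall>w.
     cmod (prime_avg (N l) (\<lambda>p. f (Phi v a (real p) w)) - (\<integral>w. f w \<partial>mu a)) < e)"

text \<open>Needed for two families: \<open>Elin\<close> when the flow is conjugate to a linear one,
  and \<open>tchi\<close> for the generic parameter, where no conjugacy is available.\<close>

lemma (in char_family) equidist_all:
  assumes chars: "\<And>k. k \<in> lat \<Longrightarrow> equidist N v a (E k)" and f: "continuous_on UNIV f"
  shows "equidist N v a f"
  using f
proof (induction rule: continuous_induct)
  case (mono k c)
  show ?case unfolding equidist_def
  proof (intro allI impI)
    fix e :: real assume "e > 0"
    \<comment> \<open>The added 1 keeps the quotient positive when \<open>c = 0\<close>.\<close>
    then have "e / (cmod c + 1) > 0" by (simp add: add_nonneg_pos)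
    with chars[OF mono] have "\<forall>\<^sub>F l in sequentially. \<forall>w.
       cmod (prime_avg (N l) (\<lambda>p. E k (Phi v a (real p) w)) - (\<integral>w. E k w \<partial>mu a)) < e / (cmod c + 1)"
      unfolding equidist_def by blast
    then show "\<forall>\<^sub>F l in sequentially. \<forall>w.
       cmod (prime_avg (N l) (\<lambda>p. c * E k (Phi v a (real p) w)) - (\<integral>w. c * E k w \<partial>mu a)) < e"
    proof (eventually_elim, intro allI)
      fix l w assume *: "\<forall>w. cmod (prime_avg (N l) (\<lambda>p. E k (Phi v a (real p) w)) - (\<integral>w. E k w \<partial>mu a)) < e / (cmod c + 1)"
      let ?D = "prime_avg (N l) (\<lambda>p. E k (Phi v a (real p) w)) - (\<integral>w. E k w \<partial>mu a)"
      have "cmod (prime_avg (N l) (\<lambda>p. c * E k (Phi v a (real p) w)) - (\<integral>w. c * E k w \<partial>mu a)) = cmod c * cmod ?D"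
        by (simp add: prime_avg_mult right_diff_distrib[symmetric] norm_mult)
      also have "\<dots> \<le> (cmod c + 1) * cmod ?D" by (intro mult_right_mono) auto
      also have "\<dots> < (cmod c + 1) * (e / (cmod c + 1))"
        using spec[OF *, of w] by (intro mult_strict_left_mono) (simp_all add: add_nonneg_pos)
      also have "\<dots> = e" using norm_ge_zero[of c] by (simp add: add_nonneg_eq_0_iff)
      finally show "cmod (prime_avg (N l) (\<lambda>p. c * E k (Phi v a (real p) w)) - (\<integral>w. c * E k w \<partial>mu a)) < e" .
    qed
  qed
next
  case (add g h)
  show ?case unfolding equidist_def
  proof (intro allI impI)
    fix e :: real assume "e > 0"
    then have e: "e / 2 > 0" by simp
    have "\<forall>\<^sub>F l in sequentially. \<forall>w. cmod (prime_avg (N l) (\<lambda>p. g (Phi v a (real p) w)) - (\<integral>w. g w \<partial>mu a)) < e / 2"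
      "\<forall>\<^sub>F l in sequentially. \<forall>w. cmod (prime_avg (N l) (\<lambda>p. h (Phi v a (real p) w)) - (\<integral>w. h w \<partial>mu a)) < e / 2"
      using add(3,4) e unfolding equidist_def by blast+
    then show "\<forall>\<^sub>F l in sequentially. \<forall>w.
       cmod (prime_avg (N l) (\<lambda>p. g (Phi v a (real p) w) + h (Phi v a (real p) w)) - (\<integral>w. g w + h w \<partial>mu a)) < e"
    proof (eventually_elim, intro allI)
      fix l w
      let ?G = "prime_avg (N l) (\<lambda>p. g (Phi v a (real p) w)) - (\<integral>w. g w \<partial>mu a)"
      let ?H = "prime_avg (N l) (\<lambda>p. h (Phi v a (real p) w)) - (\<integral>w. h w \<partial>mu a)"
      assume "\<forall>w. cmod (prime_avg (N l) (\<lambda>p. g (Phi v a (real p) w)) - (\<integral>w. g w \<partial>mu a)) < e / 2"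
        "\<forall>w. cmod (prime_avg (N l) (\<lambda>p. h (Phi v a (real p) w)) - (\<integral>w. h w \<partial>mu a)) < e / 2"
      then have "cmod ?G < e / 2" "cmod ?H < e / 2" by blast+
      then have "cmod (?G + ?H) < e" using norm_triangle_ineq[of ?G ?H] by linarith
      moreover have "prime_avg (N l) (\<lambda>p. g (Phi v a (real p) w) + h (Phi v a (real p) w)) - (\<integral>w. g w + h w \<partial>mu a) = ?G + ?H"
        using mu_integrable[OF add(1)] mu_integrable[OF add(2)] by (simp add: prime_avg_add)
      ultimately show "cmod (prime_avg (N l) (\<lambda>p. g (Phi v a (real p) w) + h (Phi v a (real p) w)) - (\<integral>w. g w + h w \<partial>mu a)) < e"
        by simp
    qed
  qed
next
  case (limit g)
  show ?case unfolding equidist_def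
  proof (intro allI impI)
    fix e :: real assume "e > 0"
    then have e: "e / 3 > 0" by simp
    from limit(2)[OF this] obtain h where h: "continuous_on UNIV h" "equidist N v a h" "\<forall>w. cmod (g w - h w) < e / 3"
      by blast
    have "\<forall>\<^sub>F l in sequentially. \<forall>w. cmod (prime_avg (N l) (\<lambda>p. h (Phi v a (real p) w)) - (\<integral>w. h w \<partial>mu a)) < e / 3"
      using h(2) e unfolding equidist_def by blast
    then show "\<forall>\<^sub>F l in sequentially. \<forall>w. cmod (prime_avg (N l) (\<lambda>p. g (Phi v a (real p) w)) - (\<integral>w. g w \<partial>mu a)) < e"
    proof (eventually_elim, intro allI)
      fix l w
      let ?H = "prime_avg (N l) (\<lambda>p. h (Phi v a (real p) w)) - (\<integral>w. h w \<partial>mu a)"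
      let ?D = "prime_avg (N l) (\<lambda>p. g (Phi v a (real p) w) - h (Phi v a (real p) w))"
      let ?I = "\<integral>w. g w - h w \<partial>mu a"
      assume "\<forall>w. cmod (prime_avg (N l) (\<lambda>p. h (Phi v a (real p) w)) - (\<integral>w. h w \<partial>mu a)) < e / 3"
      then have 1: "cmod ?H < e / 3" by blast
      have hb: "cmod (g w - h w) \<le> e / 3" for w
        using spec[OF h(3), of w] by (rule less_imp_le)
      have 2: "cmod ?D \<le> e / 3" using e by (intro norm_prime_avg_le hb) simp
      have 3: "cmod ?I \<le> e / 3"
        by (intro norm_integral_le[OF prob_space_mu] mu_integrable continuous_on_diff limit(1) h(1) hb)
      have "prime_avg (N l) (\<lambda>p. g (Phi v a (real p) w)) = prime_avg (N l) (\<lambda>p. h (Phi v a (real p) w)) + ?D"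
        using prime_avg_add[of "N l" "\<lambda>p. h (Phi v a (real p) w)" "\<lambda>p. g (Phi v a (real p) w) - h (Phi v a (real p) w)"] by simp
      moreover have "(\<integral>w. g w \<partial>mu a) = (\<integral>w. h w \<partial>mu a) + ?I"
        using mu_integrable[OF limit(1)] mu_integrable[OF h(1)] by simp
      ultimately have "prime_avg (N l) (\<lambda>p. g (Phi v a (real p) w)) - (\<integral>w. g w \<partial>mu a) = ?H + (?D - ?I)"
        by (simp only:) (simp add: algebra_simps)
      moreover have "cmod (?H + (?D - ?I)) < e"
        using norm_triangle_ineq[of ?H "?D - ?I"] norm_triangle_ineq4[of ?D ?I] 1 2 3 by linarith
      ultimately show "cmod (prime_avg (N l) (\<lambda>p. g (Phi v a (real p) w)) - (\<integral>w. g w \<partial>mu a)) < e"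
        by (simp only:)
    qed
  qed
qed

subsection \<open>Trigonometric polynomials are conjugate to linear flows\<close>

text \<open>The transfer function: its derivative along \<open>v\<close> is the sum of the first
  \<open>n\<close> modes of \<open>phi\<close>. The divisors \<open>kap i \<bullet> v\<close> may be
  small, but as there are finitely many terms it is enough that none of them vanishes.\<close>

definition psi :: "real \<times> real \<Rightarrow> (nat \<Rightarrow> real) \<Rightarrow> nat \<Rightarrow> torus \<Rightarrow> real" where
  "psi v a n w = (\<Sum>i<n. cf a i * (Im (tchi (kap i) w) / (2 * pi * (kap i \<bullet> v))))"

lemma continuous_on_psi: "continuous_on UNIV (psi v a n)"
proof -
  have "continuous_on UNIV (\<lambda>w. Im (tchi (kap i) w))" for i
    by (intro continuous_intros kap_lat)
  then show ?thesis unfolding psi_def divide_inverse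
    by (intro continuous_on_sum continuous_on_mult continuous_on_const)
qed

lemma jint_nonresonant:
  assumes "kap i \<bullet> v \<noteq> 0"
  shows "jint i v s w = Im (tchi (kap i) (tshift (s *\<^sub>R v) w)) / (2 * pi * (kap i \<bullet> v)) - Im (tchi (kap i) w) / (2 * pi * (kap i \<bullet> v))"
proof -
  obtain z where w: "w = to_torus z" by (rule torus_cases)
  show ?thesis using assms
    by (simp add: w jint_to_torus psi_int_def tshift_to_torus tchi_to_torus[OF kap_lat] Im_ee inner_add_right
        diff_divide_distrib algebra_simps)
qed

lemma jint_resonant: "kap i \<bullet> v = 0 \<Longrightarrow> jint i v s w = s * Re (tchi (kap i) w)"
  by (simp add: jint_def)

lemma psi_tshift:
  assumes "\<forall>i<n. kap i \<bullet> v \<noteq> 0"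
  shows "(\<Sum>i<n. cf a i * jint i v s w) = psi v a n (tshift (s *\<^sub>R v) w) - psi v a n w"
  using assms by (simp add: psi_def sum_subtractf jint_nonresonant right_diff_distrib)

lemma htime_nonresonant:
  assumes a: "\<forall>i\<ge>n. a i = 0" and v: "\<forall>i<n. kap i \<bullet> v \<noteq> 0"
  shows "htime v a s w = s + psi v a n (tshift (s *\<^sub>R v) w) - psi v a n w"
proof -
  have "(\<Sum>i. cf a i * jint i v s w) = (\<Sum>i<n. cf a i * jint i v s w)"
    using a by (intro suminf_finite) (auto simp: cf_def)
  then show ?thesis by (simp add: htime_def psi_tshift[OF v])
qed

text \<open>This is \<open>tchi k\<close> evaluated at
  \<open>tshift (psi v a n w *\<^sub>R v) w\<close>. The map from \<open>w\<close> to that point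
  carries \<open>Phi\<close> to the linear flow along \<open>v\<close>, so these are eigenfunctions
  of \<open>Phi\<close>.\<close>

definition Elin :: "real \<times> real \<Rightarrow> (nat \<Rightarrow> real) \<Rightarrow> nat \<Rightarrow> real \<times> real \<Rightarrow> torus \<Rightarrow> complex" where
  "Elin v a n k w = tchi k w * ee (psi v a n w * (k \<bullet> v))"

lemma ee_cancel: "x * ee s = y * ee t \<Longrightarrow> y = x * ee (s - t)"
proof -
  assume "x * ee s = y * ee t"
  then have "x * ee s * cnj (ee t) = y * (ee t * cnj (ee t))" by (simp add: mult.assoc)
  then show "y = x * ee (s - t)" by (simp add: ee_diff mult.assoc complex_norm_square[symmetric])
qed

context
  fixes v :: "real \<times> real" and a :: "nat \<Rightarrow> real" and n :: nat
  assumes a: "\<forall>i\<ge>n. a i = 0" and v: "\<forall>i<n. kap i \<bullet> v \<noteq> 0"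
begin

lemma Elin_Phi: "k \<in> lat \<Longrightarrow> Elin v a n k (Phi v a t w) = ee (t * (k \<bullet> v)) * Elin v a n k w"
proof -
  assume k: "k \<in> lat"
  define s where "s = sg v a t w"
  have "s + psi v a n (tshift (s *\<^sub>R v) w) - psi v a n w = t"
    using htime_nonresonant[OF a v, of s w] by (simp add: s_def)
  then have "psi v a n (tshift (s *\<^sub>R v) w) = t + psi v a n w - s" by simp
  then have "Elin v a n k (Phi v a t w) = tchi k w * ee (s * (k \<bullet> v) + (t + psi v a n w - s) * (k \<bullet> v))"
    using k unfolding Elin_def Phi_def s_def[symmetric] by (simp add: tchi_tshift ee_add)
  also have "s * (k \<bullet> v) + (t + psi v a n w - s) * (k \<bullet> v) = t * (k \<bullet> v) + psi v a n w * (k \<bullet> v)"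
    by (simp add: algebra_simps)
  finally show ?thesis by (simp add: Elin_def ee_add)
qed

lemma char_family_Elin: "char_family (Elin v a n)"
proof
  show "continuous_on UNIV (Elin v a n k)" if "k \<in> lat" for k
    unfolding Elin_def using that by (intro continuous_intros continuous_on_psi)
  show "Elin v a n (k + l) w = Elin v a n k w * Elin v a n l w" for k l w
    by (simp add: Elin_def tchi_add inner_add_left distrib_left ee_add mult_ac)
  show "Elin v a n (- k) w = cnj (Elin v a n k w)" for k w
    by (simp add: Elin_def tchi_uminus ee_minus)
  show "w = w'" if *: "\<And>k. k \<in> lat \<Longrightarrow> Elin v a n k w = Elin v a n k w'" for w w'
  proof -
    \<comment> \<open>If all \<open>Elin\<close> agree, then \<open>w'\<close> lies on the line
      through \<open>w\<close> at displacement \<open>s\<close>. The travel time to it comes out as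
      0, and strict monotonicity of \<open>htime\<close> forces \<open>s = 0\<close>.\<close>
    define s where "s = psi v a n w - psi v a n w'"
    have "w' = tshift (s *\<^sub>R v) w"
    proof (rule tchi_separates)
      fix k assume k: "k \<in> lat"
      have "tchi k w' = tchi k w * ee (psi v a n w * (k \<bullet> v) - psi v a n w' * (k \<bullet> v))"
        by (rule ee_cancel) (use *[OF k] in \<open>simp add: Elin_def\<close>)
      then show "tchi k w' = tchi k (tshift (s *\<^sub>R v) w)"
        using k by (simp add: tchi_tshift s_def left_diff_distrib right_diff_distrib mult.commute)
    qed
    moreover from this have "htime v a s w = 0"
      using htime_nonresonant[OF a v, of s w] by (simp add: s_def)
    then have "s = 0" using htime_inj[of v a s w 0] by simp
    ultimately show ?thesis by simp
  qed
qed (simp add: Elin_def)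

text \<open>The time \<open>1 / (2 * (k \<bullet> v))\<close> is half a period of the eigenfunction
  and reverses its sign, while the integral is invariant.\<close>

lemma integral_Elin:
  assumes k: "k \<in> lat" "k \<bullet> v \<noteq> 0"
  shows "(\<integral>w. Elin v a n k w \<partial>mu a) = 0"
proof -
  have "ee (1 / 2) = - 1" by (simp add: ee_def)
  then have "Elin v a n k (Phi v a (1 / (2 * (k \<bullet> v))) w) = - Elin v a n k w" for w
    using k by (simp add: Elin_Phi)
  moreover have "continuous_on UNIV (Elin v a n k)"
    using char_family.cont[OF char_family_Elin k(1)] .
  ultimately have "- (\<integral>w. Elin v a n k w \<partial>mu a) = (\<integral>w. Elin v a n k w \<partial>mu a)"
    using mu_invariant[where g = "Elin v a n k" and v = v and a = a and t = "1 / (2 * (k \<bullet> v))"] by simp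
  then show ?thesis by (simp add: equation_minus_iff eq_neg_iff_add_eq_0)
qed

lemma equidist_generic:
  assumes gen: "prime_generic v" and f: "continuous_on UNIV f"
  shows "equidist prime_scale v a f"
proof (rule char_family.equidist_all[OF char_family_Elin _ f])
  fix k assume k: "k \<in> lat"
  have pos: "prime_count (prime_scale l) > 0" for l
    using prime_scale[of l] one_le_power[of "2 :: nat" l] by linarith
  show "equidist prime_scale v a (Elin v a n k)"
  proof (cases "k = 0")
    case True
    then have "Elin v a n k = (\<lambda>_. 1)" by (auto simp: Elin_def)
    then show ?thesis
      using prob_space.prob_space[OF prob_space_mu, of a] by (simp add: equidist_def prime_avg_const[OF pos])
  next
    case False
    then have nr: "k \<bullet> v \<noteq> 0" using prime_generic_nonresonant[OF gen k] by simp
    have lim: "(\<lambda>l. prime_avg (prime_scale l) (\<lambda>p. ee (real p * (k \<bullet> v)))) \<longlonglongrightarrow> 0"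
      using gen k False by (simp add: prime_generic_def)
    \<comment> \<open>The eigenfunction contributes a factor of modulus 1, so the error does not
      depend on \<open>w\<close> and convergence is automatically uniform.\<close>
    have "cmod (prime_avg (prime_scale l) (\<lambda>p. Elin v a n k (Phi v a (real p) w)) - (\<integral>w. Elin v a n k w \<partial>mu a)) =
        cmod (prime_avg (prime_scale l) (\<lambda>p. ee (real p * (k \<bullet> v))))" for l w
      unfolding Elin_Phi[OF k] integral_Elin[OF k nr]
      by (subst mult.commute) (simp add: prime_avg_mult norm_mult Elin_def)
    then show ?thesis
      using tendstoD[OF lim] by (simp add: equidist_def)
  qed
qed

end

subsection \<open>The open dense sets\<close>

definition lat_box :: "nat \<Rightarrow> (real \<times> real) set" where
  "lat_box j = (\<lambda>(m, n). (of_int m, of_int n)) ` ({- int j..int j} \<times> {- int j..int j})"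

lemma finite_lat_box: "finite (lat_box j)"
  by (simp add: lat_box_def)

lemma lat_box_subset: "lat_box j \<subseteq> lat"
  by (auto simp: lat_box_def lat_iff)

lemma lat_box_exhaust:
  assumes "k \<in> lat" shows "\<exists>j0. \<forall>j\<ge>j0. k \<in> lat_box j"
proof -
  obtain m n where k: "k = (of_int m, of_int n)"
    using assms by (cases k) (auto simp: lat_iff elim!: Ints_cases)
  have "k \<in> lat_box j" if "j \<ge> nat (max \<bar>m\<bar> \<bar>n\<bar>)" for j
    unfolding lat_box_def k using that by (intro image_eqI[of _ _ "(m, n)"]) auto
  then show ?thesis by blast
qed

text \<open>The path \<open>h\<close> starts at \<open>a\<close>, is continuous in \<open>e\<close>,
  and consists of finitely supported sequences for \<open>e > 0\<close>. Pulling \<open>U\<close>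
  back along it avoids handling basic open sets of the product topology.\<close>

lemma finitely_supported_in_open:
  fixes U :: "((real \<times> real) \<times> (nat \<Rightarrow> real)) set"
  assumes "open U" "(v, a) \<in> U"
  shows "\<exists>a' n. (v, a') \<in> U \<and> (\<forall>i\<ge>n. a' i = 0)"
proof -
  define h where "h e i = a i * max 0 (1 - e * real i)" for e :: real and i :: nat
  have "continuous_on UNIV (\<lambda>e. (v, h e))"
    unfolding h_def
    by (intro continuous_on_Pair continuous_on_const continuous_on_coordinatewise_then_product continuous_intros)
  then have "open ((\<lambda>e. (v, h e)) -` U)" using \<open>open U\<close> by (simp add: open_vimage)
  moreover have "h 0 = a" by (auto simp: h_def)
  then have "0 \<in> (\<lambda>e. (v, h e)) -` U" using assms(2) by simp
  ultimately obtain d where d: "d > 0" "\<And>e. dist e 0 < d \<Longrightarrow> (v, h e) \<in> U"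
    unfolding open_dist by blast
  define e where "e = d / 2"
  have "(v, h e) \<in> U" using d by (simp add: e_def)
  moreover have "h e i = 0" if "i \<ge> nat \<lceil>1 / e\<rceil>" for i
  proof -
    have "1 / e \<le> real i" using that by linarith
    then show ?thesis using d by (simp add: h_def e_def field_simps)
  qed
  ultimately show ?thesis by blast
qed

definition prime_set :: "nat \<Rightarrow> ((real \<times> real) \<times> (nat \<Rightarrow> real)) set" where
  "prime_set j = {x. \<exists>N\<ge>j. \<forall>k\<in>lat_box j. \<forall>w.
     cmod (prime_avg N (\<lambda>p. tchi k (Phi (fst x) (snd x) (real p) w)) - (\<integral>w. tchi k w \<partial>mu (snd x))) < 1 / (real j + 1)}"

lemma continuous_on_integral_mu:
  fixes F :: "(real \<times> real) \<times> (nat \<Rightarrow> real) \<Rightarrow> torus \<Rightarrow> complex"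
  assumes F: "continuous_on UNIV (\<lambda>p. F (fst p) (snd p))" and B: "\<And>x w. cmod (F x w) \<le> 1"
  shows "continuous_on UNIV (\<lambda>x. \<integral>w. F x w \<partial>mu (snd x))"
proof -
  have c: "continuous_on UNIV (F x)" for x
    using continuous_on_compose2[OF F continuous_on_Pair[OF continuous_on_const[of UNIV x] continuous_on_id]] by simp
  have "continuous_on UNIV (\<lambda>x. \<integral>w. phi (snd x) w *\<^sub>R F x w \<partial>haar)"
  proof (rule continuous_on_integral_haar[where B = "3/2 * 1"])
    show "continuous_on UNIV (\<lambda>p. phi (snd (fst p)) (snd p) *\<^sub>R F (fst p) (snd p))"
      by (intro continuous_on_scaleR F continuous_on_phi continuous_intros)
    show "cmod (phi (snd x) w *\<^sub>R F x w) \<le> 3/2 * 1" for x w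
      unfolding norm_scaleR using phi_bounds[of "snd x" w] B by (intro mult_mono) auto
  qed
  then show ?thesis
    by (subst integral_mu) (auto intro: borel_measurable_continuous_onI c)
qed

lemma open_prime_set: "open (prime_set j)"
proof -
  let ?F = "\<lambda>N k x w. cmod (prime_avg N (\<lambda>p. tchi k (Phi (fst x) (snd x) (real p) w)) - (\<integral>w. tchi k w \<partial>mu (snd x)))"
  have "open {x. \<forall>w. ?F N k x w < 1 / (real j + 1)}" if "k \<in> lat_box j" for N k
  proof (rule open_uniform_less)
    have k: "k \<in> lat" using that lat_box_subset by blast
    have "continuous_on UNIV (\<lambda>x::(real \<times> real) \<times> (nat \<Rightarrow> real). \<integral>w. tchi k w \<partial>mu (snd x))"
      by (rule continuous_on_integral_mu) (auto intro!: continuous_intros k)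
    from continuous_on_compose2[OF this continuous_on_fst[OF continuous_on_id]]
    have 1: "continuous_on UNIV (\<lambda>p::((real \<times> real) \<times> (nat \<Rightarrow> real)) \<times> torus. \<integral>w. tchi k w \<partial>mu (snd (fst p)))" by simp
    have 2: "continuous_on UNIV (\<lambda>q::((real \<times> real) \<times> (nat \<Rightarrow> real)) \<times> torus. prime_avg N (\<lambda>p. tchi k (Phi (fst (fst q)) (snd (fst q)) (real p) (snd q))))"
      unfolding prime_avg_def divide_inverse
      by (intro continuous_on_mult continuous_on_sum continuous_on_const continuous_intros k)
    show "continuous_on UNIV (\<lambda>q. ?F N k (fst q) (snd q))"
      by (intro continuous_on_norm continuous_on_diff 1 2)
  qed
  then have "open (\<Union>N\<in>{j..}. \<Inter>k\<in>lat_box j. {x. \<forall>w. ?F N k x w < 1 / (real j + 1)})"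
    by (intro open_UN open_INT finite_lat_box ballI)
  moreover have "prime_set j = (\<Union>N\<in>{j..}. \<Inter>k\<in>lat_box j. {x. \<forall>w. ?F N k x w < 1 / (real j + 1)})"
    by (auto simp: prime_set_def)
  ultimately show ?thesis by simp
qed

lemma dense_prime_set:
  assumes U: "open U" "x \<in> U" shows "U \<inter> prime_set j \<noteq> {}"
proof -
  obtain a n where an: "(fst x, a) \<in> U" "\<forall>i\<ge>n. a i = 0"
    using finitely_supported_in_open[of U "fst x" "snd x"] U by auto
  define V where "V = (\<lambda>v. (v, a)) -` U"
  have "open V" unfolding V_def using U(1) by (intro open_vimage continuous_intros)
  moreover have "V \<noteq> {}" using an(1) by (auto simp: V_def)
  ultimately obtain v where v: "v \<in> V" "prime_generic v" using prime_generic_dense by blast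
  have nr: "\<forall>i<n. kap i \<bullet> v \<noteq> 0"
    using prime_generic_nonresonant[OF v(2) kap_lat kap_nonzero] by blast
  have ev: "\<forall>\<^sub>F l in sequentially. \<forall>w. cmod (prime_avg (prime_scale l) (\<lambda>p. tchi k (Phi v a (real p) w)) -
      (\<integral>w. tchi k w \<partial>mu a)) < 1 / (real j + 1)" if "k \<in> lat_box j" for k
  proof -
    have "equidist prime_scale v a (tchi k)"
      using that lat_box_subset by (intro equidist_generic[OF an(2) nr v(2)] continuous_on_tchi) auto
    then show ?thesis unfolding equidist_def by auto
  qed
  have "\<forall>\<^sub>F l in sequentially. j \<le> l \<and> (\<forall>k\<in>lat_box j. \<forall>w. cmod (prime_avg (prime_scale l) (\<lambda>p. tchi k (Phi v a (real p) w)) -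
      (\<integral>w. tchi k w \<partial>mu a)) < 1 / (real j + 1))"
    using ev by (intro eventually_conj eventually_ge_at_top eventually_ball_finite[OF finite_lat_box]) auto
  from eventually_sequentially_ex[OF this] obtain l where l: "j \<le> l"
    "\<forall>k\<in>lat_box j. \<forall>w. cmod (prime_avg (prime_scale l) (\<lambda>p. tchi k (Phi v a (real p) w)) -
      (\<integral>w. tchi k w \<partial>mu a)) < 1 / (real j + 1)" by blast
  have "j \<le> prime_scale l" using l(1) prime_scale_ge[of l] by linarith
  then have "(v, a) \<in> prime_set j" using l(2) unfolding prime_set_def by auto
  moreover have "(v, a) \<in> U" using v(1) by (simp add: V_def)
  ultimately show ?thesis by blast
qed

section \<open>Mixing times are generic\<close>

text \<open>A coboundary up to a constant. The constant may stay anonymous while terms are added up;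
  it is identified at the end by integrating against Haar measure.\<close>

definition quasi_cob :: "real \<times> real \<Rightarrow> (torus \<Rightarrow> complex) \<Rightarrow> bool" where
  "quasi_cob v Y \<longleftrightarrow> continuous_on UNIV Y \<and> (\<exists>X c. cob v X (\<lambda>w. Y w - c))"

lemma quasi_cob_add:
  assumes "quasi_cob v Y" "quasi_cob v Z" shows "quasi_cob v (\<lambda>w. Y w + Z w)"
proof -
  obtain X c X' c' where "cob v X (\<lambda>w. Y w - c)" "cob v X' (\<lambda>w. Z w - c')"
    using assms unfolding quasi_cob_def by blast
  from cob_add[OF this] have "cob v (\<lambda>w. X w + X' w) (\<lambda>w. (Y w + Z w) - (c + c'))"
    by (simp add: algebra_simps)
  moreover have "continuous_on UNIV (\<lambda>w. Y w + Z w)"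
    using assms unfolding quasi_cob_def by (intro continuous_on_add) blast+
  ultimately show ?thesis unfolding quasi_cob_def by blast
qed

lemma quasi_cob_scale:
  assumes "quasi_cob v Y" shows "quasi_cob v (\<lambda>w. d * Y w)"
proof -
  obtain X c where "cob v X (\<lambda>w. Y w - c)"
    using assms unfolding quasi_cob_def by blast
  from cob_scale[OF this, of d] have "cob v (\<lambda>w. d * X w) (\<lambda>w. d * Y w - d * c)"
    by (simp add: right_diff_distrib)
  moreover have "continuous_on UNIV (\<lambda>w. d * Y w)"
    using assms unfolding quasi_cob_def by (intro continuous_on_mult continuous_on_const) blast
  ultimately show ?thesis unfolding quasi_cob_def by blast
qed

lemma cob_0: "cob v (\<lambda>_. 0) (\<lambda>_. 0)"
  by (simp add: cob_def)

lemma quasi_cob_const: "quasi_cob v (\<lambda>_. d)"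
proof -
  have "cob v (\<lambda>_. 0) (\<lambda>_. d - d)" using cob_0 by simp
  then show ?thesis unfolding quasi_cob_def by (intro conjI exI continuous_on_const)
qed

lemma quasi_cob_sum:
  assumes "finite A" "\<And>i. i \<in> A \<Longrightarrow> quasi_cob v (f i)" shows "quasi_cob v (\<lambda>w. \<Sum>i\<in>A. f i w)"
  using assms
proof (induction A rule: finite_induct)
  case empty
  show ?case using quasi_cob_const[of v 0] by simp
next
  case (insert i A)
  then show ?case using quasi_cob_add[of v "f i" "\<lambda>w. \<Sum>i\<in>A. f i w"] by simp
qed

lemma ee_line_derivative:
  assumes "(g has_real_derivative d) (at 0)"
  shows "((\<lambda>u. ee (c * g u) * y) has_vector_derivative (2 * pi * c * d) *\<^sub>R (\<i> * ee (c * g 0) * y)) (at 0)"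
proof -
  have "(g has_vector_derivative d) (at 0)"
    using assms by (simp add: has_real_derivative_iff_has_vector_derivative)
  from vector_diff_chain_at[OF this ee_has_vector_derivative[of c]]
  have "((\<lambda>u. ee (c * g u)) has_vector_derivative d *\<^sub>R ((2 * pi * c) *\<^sub>R (\<i> * ee (c * g 0)))) (at 0)"
    by (simp add: o_def)
  from has_vector_derivative_mult_left[OF this, of y] show ?thesis by (simp add: mult_ac)
qed

lemma quasi_cob_tchi:
  assumes k: "k \<in> lat" and nr: "k = 0 \<or> k \<bullet> v \<noteq> 0"
  shows "quasi_cob v (tchi k)"
proof (cases "k = 0")
  case True
  then have "tchi k = (\<lambda>_. 1)" by auto
  then show ?thesis using quasi_cob_const[of v 1] by simp
next
  case False
  define d where "d = 1 / (of_real (2 * pi * (k \<bullet> v)) * \<i>)"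
  have "cob v (\<lambda>w. d * tchi k w) (\<lambda>w. tchi k w - 0)"
    unfolding cob_def
  proof (intro conjI allI)
    show "continuous_on UNIV (\<lambda>w. d * tchi k w)" by (intro continuous_intros k)
    fix w
    have "((\<lambda>u. ee ((k \<bullet> v) * u) * (d * tchi k w)) has_vector_derivative
        (2 * pi * (k \<bullet> v) * 1) *\<^sub>R (\<i> * ee ((k \<bullet> v) * 0) * (d * tchi k w))) (at 0)"
      by (rule ee_line_derivative) (auto intro!: derivative_eq_intros)
    moreover have "(2 * pi * (k \<bullet> v) * 1) *\<^sub>R (\<i> * ee ((k \<bullet> v) * 0) * (d * tchi k w)) = tchi k w - 0"
      using nr False by (simp add: d_def scaleR_conv_of_real field_simps)
    moreover have "ee ((k \<bullet> v) * u) * (d * tchi k w) = d * tchi k (tshift (u *\<^sub>R v) w)" for u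
      using k by (simp add: tchi_tshift mult_ac)
    ultimately show "((\<lambda>u. d * tchi k (tshift (u *\<^sub>R v) w)) has_vector_derivative tchi k w - 0) (at 0)" by simp
  qed
  then show ?thesis unfolding quasi_cob_def using continuous_on_tchi[OF k] by blast
qed

lemma Re_conv: "complex_of_real (Re z) = (1/2) * z + (1/2) * cnj z"
  by (simp add: complex_eq_iff)

text \<open>The product is half the sum of the characters with frequencies \<open>k + l\<close> and
  \<open>k - l\<close>; hence the two nonresonance conditions.\<close>

lemma quasi_cob_tchi_Re:
  assumes "k \<in> lat" "l \<in> lat" "k + l = 0 \<or> (k + l) \<bullet> v \<noteq> 0" "k - l = 0 \<or> (k - l) \<bullet> v \<noteq> 0"
  shows "quasi_cob v (\<lambda>w. c * (tchi k w * complex_of_real (Re (tchi l w))))"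
proof -
  have eq: "tchi k w * complex_of_real (Re (tchi l w)) = (1/2) * tchi (k + l) w + (1/2) * tchi (k - l) w" for w
    unfolding Re_conv tchi_uminus[symmetric] diff_conv_add_uminus tchi_add by (simp add: algebra_simps)
  show ?thesis
    unfolding eq by (intro quasi_cob_scale quasi_cob_add quasi_cob_tchi lat_add lat_diff assms)
qed

text \<open>On each vertical line the values in \<open>C\<close> are attained at countably many
  points because \<open>snd k \<noteq> 0\<close>; Fubini finishes. It will show that orbits with a
  prescribed period are negligible.\<close>

lemma AE_Re_tchi:
  assumes k: "k \<in> lat" "snd k \<noteq> 0" and C: "countable C"
  shows "AE w in haar. Re (tchi k w) \<notin> C"
proof -
  have [measurable]: "C \<in> sets borel" by (rule sets.countable[OF _ C]) simp
  have [measurable]: "tchi k \<in> borel_measurable borel" by (intro borel_measurable_continuous_onI continuous_on_tchi k(1))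
  have D: "countable (\<Union>d\<in>C. {u :: real. cos u = d})"
  proof (intro countable_UN C)
    fix d
    show "countable {u :: real. cos u = d}"
    proof (cases "\<exists>u0. cos u0 = d")
      case True
      then obtain u0 where u0: "cos u0 = d" ..
      have "{u. cos u = d} \<subseteq> (\<lambda>m. u0 + 2 * m * pi) ` \<int> \<union> (\<lambda>m. - u0 + 2 * m * pi) ` \<int>"
        using cos_eq[of _ u0] u0 by auto
      moreover have "countable (\<int> :: real set)" unfolding Ints_def by simp
      ultimately show ?thesis by (meson countable_Un countable_image countable_subset)
    qed simp
  qed
  have null: "AE y in lborel. cos (2 * pi * (k \<bullet> (x, y))) \<notin> C" for x
  proof -
    let ?S = "{y. cos (2 * pi * (k \<bullet> (x, y))) \<in> C}"
    have "inj (\<lambda>y. 2 * pi * (k \<bullet> (x, y)))" using k(2) by (auto simp: inj_def inner_prod_def)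
    then have inj: "inj_on (\<lambda>y. 2 * pi * (k \<bullet> (x, y))) ?S" by (rule inj_on_subset) simp
    have "countable ((\<lambda>y. 2 * pi * (k \<bullet> (x, y))) ` ?S)"
      by (rule countable_subset[OF _ D]) auto
    then have "countable ?S" using inj by (rule countable_image_inj_on)
    then show ?thesis by (intro AE_I'[OF countable_imp_null_set_lborel]) auto
  qed
  have "AE z in lborel \<Otimes>\<^sub>M lborel. cos (2 * pi * (k \<bullet> z)) \<notin> C"
  proof (rule lborel_pair.AE_pair_measure)
    have "(\<lambda>z. cos (2 * pi * (k \<bullet> z))) \<in> borel_measurable borel"
      by (intro borel_measurable_continuous_onI continuous_intros)
    then have "(\<lambda>z. cos (2 * pi * (k \<bullet> z))) \<in> borel_measurable (lborel \<Otimes>\<^sub>M lborel)"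
      by (simp add: lborel_prod)
    from measurable_sets[OF this, of "- C"]
    show "{z \<in> space (lborel \<Otimes>\<^sub>M lborel). cos (2 * pi * (k \<bullet> z)) \<notin> C} \<in> sets (lborel \<Otimes>\<^sub>M lborel)"
      by (simp add: vimage_def Int_def conj_commute)
  qed (use null in simp)
  then have "AE z in lborel. Re (tchi k (to_torus z)) \<notin> C"
    unfolding lborel_prod tchi_to_torus[OF k(1)] Re_ee .
  then have "AE z in density lborel (\<lambda>z. ennreal (indicator (unit_cell 0) z)). Re (tchi k (to_torus z)) \<notin> C"
    by (subst AE_density) auto
  then show ?thesis unfolding haar_def by (subst AE_distr_iff) auto
qed

text \<open>Pigeonhole on the sum over \<open>I\<close>: if its average is below \<open>e\<close>,
  some single index makes the sum, and by nonnegativity every summand, smaller than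
  \<open>e\<close>. So finitely many correlations are small at a common time.\<close>

lemma average_small_ex:
  fixes x :: "'i \<Rightarrow> nat \<Rightarrow> real"
  assumes I: "finite I" and lim: "\<And>i. i \<in> I \<Longrightarrow> (\<lambda>N. (\<Sum>j<N. x i j) / real N) \<longlonglongrightarrow> 0"
    and nonneg: "\<And>i j. 0 \<le> x i j" and e: "e > 0"
  shows "\<exists>j. \<forall>i\<in>I. x i j < e"
proof -
  have "(\<lambda>N. \<Sum>i\<in>I. (\<Sum>j<N. x i j) / real N) \<longlonglongrightarrow> (\<Sum>i\<in>I. 0)" by (intro tendsto_sum lim)
  then have "(\<lambda>N. \<Sum>i\<in>I. (\<Sum>j<N. x i j) / real N) \<longlonglongrightarrow> 0" by simp
  from order_tendstoD(2)[OF this e] have "\<forall>\<^sub>F N in sequentially. 0 < N \<and> (\<Sum>i\<in>I. (\<Sum>j<N. x i j) / real N) < e"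
    by (intro eventually_conj eventually_gt_at_top)
  from eventually_sequentially_ex[OF this] obtain N where N: "0 < N" "(\<Sum>i\<in>I. (\<Sum>j<N. x i j) / real N) < e" by blast
  have "(\<Sum>j<N. \<Sum>i\<in>I. x i j) = (\<Sum>i\<in>I. \<Sum>j<N. x i j)" by (rule sum.swap)
  then have "(\<Sum>j<N. \<Sum>i\<in>I. x i j) < (\<Sum>j<N. e)"
    using N by (simp add: sum_divide_distrib[symmetric] field_simps)
  then obtain j where j: "(\<Sum>i\<in>I. x i j) < e" by (meson not_le sum_mono)
  have "x i j \<le> (\<Sum>i\<in>I. x i j)" if "i \<in> I" for i using that nonneg I by (intro member_le_sum) auto
  with j show ?thesis by (meson le_less_trans)
qed

section \<open>Flows with closed orbits of varying period\<close>

text \<open>A flow along a rational direction \<open>(q, p)\<close>, with exactly one resonant mode \<open>kap i\<close>.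
  The section \<open>b\<close> completes \<open>kap i\<close> to a basis of the lattice. All orbits are closed, and
  \<open>rho / lam\<close> is their period; it varies from orbit to orbit since \<open>cf a i \<noteq> 0\<close>.\<close>

locale rational_flow =
  fixes lam :: real and q p :: nat and b :: "real \<times> real" and n i :: nat and a :: "nat \<Rightarrow> real"
    and v :: "real \<times> real"
  assumes lam: "lam > 0" and v_def: "v = lam *\<^sub>R (real q, real p)"
    and kap_i: "kap i = (real p, - real q)" and q_pos: "q > 0"
    and b: "b \<in> lat" "b \<bullet> (real q, real p) = 1"
    and i_ge: "n \<le> i" and a_fin: "\<forall>l\<ge>n. l \<noteq> i \<longrightarrow> a l = 0"
    and nonres: "\<forall>l<n. kap l \<bullet> v \<noteq> 0"
    and c_nonzero: "cf a i \<noteq> 0"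
begin

text \<open>The mean of \<open>phi\<close> over the closed line through \<open>w\<close>: the
  resonant mode is constant there and the other modes average out.\<close>

definition rho :: "torus \<Rightarrow> real" where
  "rho w = 1 + cf a i * Re (tchi (kap i) w)"

lemma kap_v: "kap i \<bullet> v = 0"
  by (simp add: kap_i v_def)

lemma suminf_modes:
  "(\<Sum>l. cf a l * f l) = (\<Sum>l<n. cf a l * f l) + cf a i * f i"
proof -
  have "(\<Sum>l. cf a l * f l) = (\<Sum>l\<in>insert i {..<n}. cf a l * f l)"
    using a_fin by (intro suminf_finite) (auto simp: cf_def not_less)
  then show ?thesis using i_ge by (simp add: add.commute)
qed

lemma htime_eq: "htime v a s w = s * rho w + psi v a n (tshift (s *\<^sub>R v) w) - psi v a n w"
  using suminf_modes[of "\<lambda>l. jint l v s w"]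
  by (simp add: htime_def psi_tshift[OF nonres] jint_resonant[OF kap_v] rho_def algebra_simps)

lemma phi_eq: "phi a w = 1 + (\<Sum>l<n. cf a l * Re (tchi (kap l) w)) + cf a i * Re (tchi (kap i) w)"
  using suminf_modes[of "\<lambda>l. Re (tchi (kap l) w)"] by (simp add: phi_def)

lemma tchi_kap_tshift: "tchi (kap i) (tshift (s *\<^sub>R v) w) = tchi (kap i) w"
  by (simp add: tchi_tshift kap_lat kap_v)

lemma rho_tshift: "rho (tshift (s *\<^sub>R v) w) = rho w"
  by (simp add: rho_def tchi_kap_tshift)

lemma rho_Phi: "rho (Phi v a t w) = rho w"
  by (simp add: Phi_def rho_tshift)

lemma abs_c: "\<bar>cf a i\<bar> \<le> 1/4"
proof -
  have "(1/2 :: real) ^ (i + 2) \<le> (1/2) ^ 2" by (rule power_decreasing) auto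
  then show ?thesis using abs_cf[of a i] by (simp add: power2_eq_square)
qed

lemma abs_rho: "\<bar>rho w - 1\<bar> \<le> \<bar>cf a i\<bar>"
  using mult_left_mono[OF abs_Re_mult_unit[of "tchi (kap i) w"], of "\<bar>cf a i\<bar>"]
  by (simp add: rho_def abs_mult)

lemma rho_ge: "1/2 \<le> rho w"
  using abs_rho[of w] abs_c by linarith

lemma rho_nonzero [simp]: "rho w \<noteq> 0"
  using rho_ge[of w] by linarith

lemma continuous_on_rho [continuous_intros]: "continuous_on UNIV rho"
  unfolding rho_def by (intro continuous_intros kap_lat)

text \<open>The characters of the coordinates \<open>(L + lam psi / rho, kap i)\<close>, in which the flow is a rotation
  of the first coordinate with speed \<open>lam / rho\<close>.\<close>

definition Er :: "real \<times> real \<Rightarrow> torus \<Rightarrow> complex" where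
  "Er k w = tchi (fst k *\<^sub>R b + snd k *\<^sub>R kap i) w * ee (fst k * (lam * (psi v a n w / rho w)))"

lemma lat_comb: "k \<in> lat \<Longrightarrow> fst k *\<^sub>R b + snd k *\<^sub>R kap i \<in> lat"
  using b(1) kap_lat[of i] by (auto simp: lat_iff)

lemma comb_v: "(fst k *\<^sub>R b + snd k *\<^sub>R kap i) \<bullet> v = fst k * lam"
proof -
  have "kap i \<bullet> (real q, real p) = 0" by (simp add: kap_i)
  then show ?thesis
    by (simp only: v_def inner_scaleR_right inner_add_left inner_scaleR_left b(2)) simp
qed

lemma Er_tshift: "k \<in> lat \<Longrightarrow> Er k (tshift (s *\<^sub>R v) w) = ee ((fst k * lam / rho w) * htime v a s w) * Er k w"
proof -
  assume k: "k \<in> lat"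
  have psi': "psi v a n (tshift (s *\<^sub>R v) w) = psi v a n w + htime v a s w - s * rho w"
    by (simp add: htime_eq)
  have "Er k (tshift (s *\<^sub>R v) w) = tchi (fst k *\<^sub>R b + snd k *\<^sub>R kap i) w *
      ee (s * (fst k * lam) + fst k * (lam * ((psi v a n w + htime v a s w - s * rho w) / rho w)))"
    unfolding Er_def rho_tshift psi'
    by (simp add: tchi_tshift[OF lat_comb[OF k]] comb_v ee_add)
  also have "s * (fst k * lam) + fst k * (lam * ((psi v a n w + htime v a s w - s * rho w) / rho w)) =
      (fst k * lam / rho w) * htime v a s w + fst k * (lam * (psi v a n w / rho w))"
    by (simp add: field_simps)
  finally show ?thesis by (simp add: Er_def ee_add)
qed

lemma Er_Phi: "k \<in> lat \<Longrightarrow> Er k (Phi v a t w) = ee (t * (fst k * lam / rho w)) * Er k w"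
  unfolding Phi_def by (simp add: Er_tshift mult.commute)

text \<open>The condition on \<open>b\<close> says that \<open>b\<close> and \<open>kap i\<close>
  span a parallelogram of area 1; the coefficients are those of Cramer's rule and are integers for
  lattice vectors.\<close>

lemma lat_decompose:
  "k = (k \<bullet> (real q, real p)) *\<^sub>R b + (k \<bullet> (snd b, - fst b)) *\<^sub>R kap i"
proof -
  obtain k1 k2 b1 b2 where kb: "k = (k1, k2)" "b = (b1, b2)" by (cases k; cases b)
  have *: "b1 * real q + b2 * real p = 1" using b(2) by (simp add: kb)
  have "(k1 * real q + k2 * real p) * b1 + (k1 * b2 - k2 * b1) * real p = k1 * (b1 * real q + b2 * real p)"
    "(k1 * real q + k2 * real p) * b2 - (k1 * b2 - k2 * b1) * real q = k2 * (b1 * real q + b2 * real p)"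
    by (simp_all add: algebra_simps)
  then show ?thesis unfolding * by (simp add: kb kap_i)
qed

lemma char_family_Er: "char_family Er"
proof
  show "continuous_on UNIV (Er k)" if "k \<in> lat" for k
    unfolding Er_def by (intro continuous_intros continuous_on_psi lat_comb[OF that]) simp
  show "Er 0 w = 1" for w by (simp add: Er_def)
  show "Er (k + l) w = Er k w * Er l w" for k l w
  proof -
    have "fst (k + l) *\<^sub>R b + snd (k + l) *\<^sub>R kap i = (fst k *\<^sub>R b + snd k *\<^sub>R kap i) + (fst l *\<^sub>R b + snd l *\<^sub>R kap i)"
      by (simp add: scaleR_add_left)
    moreover have "fst (k + l) * (lam * (psi v a n w / rho w)) = fst k * (lam * (psi v a n w / rho w)) + fst l * (lam * (psi v a n w / rho w))"
      by (simp add: distrib_right add_divide_distrib)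
    ultimately show ?thesis
      unfolding Er_def
      by (simp only: tchi_add[of "fst k *\<^sub>R b + snd k *\<^sub>R kap i" "fst l *\<^sub>R b + snd l *\<^sub>R kap i"] ee_add mult_ac)
  qed
  show "Er (- k) w = cnj (Er k w)" for k w
  proof -
    have "fst (- k) *\<^sub>R b + snd (- k) *\<^sub>R kap i = - (fst k *\<^sub>R b + snd k *\<^sub>R kap i)" by simp
    then show ?thesis unfolding Er_def by (simp only: tchi_uminus) (simp add: ee_minus)
  qed
  show "w = w'" if *: "\<And>k. k \<in> lat \<Longrightarrow> Er k w = Er k w'" for w w'
  proof -
    \<comment> \<open>The frequency \<open>(0, 1)\<close> comes first: it shows that both points
      have the same \<open>rho\<close>, so the remaining equations have a common
      denominator.\<close>
    have "tchi (kap i) w = tchi (kap i) w'" using *[of "(0, 1)"] by (simp add: Er_def lat_iff)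
    then have r: "rho w' = rho w" by (simp add: rho_def)
    define s where "s = (psi v a n w - psi v a n w') / rho w"
    have "w' = tshift (s *\<^sub>R v) w"
    proof (rule tchi_separates)
      fix k assume k: "k \<in> lat"
      define m where "m = (k \<bullet> (real q, real p), k \<bullet> (snd b, - fst b))"
      have "m \<in> lat"
        using k b(1) unfolding m_def by (auto simp: lat_iff inner_prod_def)
      have km: "fst m *\<^sub>R b + snd m *\<^sub>R kap i = k" unfolding m_def using lat_decompose[of k] by simp
      have "tchi k w' = tchi k w * ee (fst m * (lam * (psi v a n w / rho w)) - fst m * (lam * (psi v a n w' / rho w)))"
        by (rule ee_cancel) (use *[OF \<open>m \<in> lat\<close>] in \<open>simp add: Er_def km r\<close>)
      also have "fst m * (lam * (psi v a n w / rho w)) - fst m * (lam * (psi v a n w' / rho w)) = s * (k \<bullet> v)"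
      proof -
        have "k \<bullet> v = lam * (k \<bullet> (real q, real p))" by (simp only: v_def inner_scaleR_right)
        then show ?thesis
          unfolding s_def m_def by (simp add: right_diff_distrib diff_divide_distrib left_diff_distrib mult_ac)
      qed
      finally show "tchi k w' = tchi k (tshift (s *\<^sub>R v) w)"
        using k by (simp add: tchi_tshift mult.commute)
    qed
    moreover from this have "htime v a s w = 0" by (simp add: htime_eq s_def)
    then have "s = 0" using htime_inj[of v a s w 0] by simp
    ultimately show ?thesis by simp
  qed
qed

text \<open>After displacement \<open>1 / lam\<close> the line has moved by the lattice vector
  \<open>(q, p)\<close>.\<close>

lemma closed_orbit: "tshift ((1 / lam) *\<^sub>R v) w = w"
  using lam by (intro tshift_lat) (simp add: v_def lat_iff)

text \<open>On each orbit \<open>Er k\<close> oscillates with frequency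
  \<open>fst k * lam / rho\<close>. This varies between orbits but is constant on each of them, so
  dividing by it gives a primitive; the factor \<open>phi a\<close> is the derivative of
  \<open>htime\<close>.\<close>

lemma cob_Er:
  assumes k: "k \<in> lat" "fst k \<noteq> 0"
  shows "\<exists>X. cob v X (\<lambda>w. c * Er k w * of_real (phi a w))"
proof -
  define X where "X w = c * (of_real (rho w) / (of_real (2 * pi * fst k * lam) * \<i>)) * Er k w" for w
  have "cob v X (\<lambda>w. c * Er k w * of_real (phi a w))"
    unfolding cob_def
  proof (intro conjI allI)
    show "continuous_on UNIV X" unfolding X_def
      by (intro continuous_intros char_family.cont[OF char_family_Er k(1)]) (use lam k(2) in auto)
    fix w
    have "((\<lambda>u. htime v a u w) has_real_derivative phi a w) (at 0)"
      using htime_has_derivative[of v a w 0] by simp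
    from ee_line_derivative[OF this, of "fst k * lam / rho w" "X w"]
    have "((\<lambda>u. ee ((fst k * lam / rho w) * htime v a u w) * X w) has_vector_derivative
        (2 * pi * (fst k * lam / rho w) * phi a w) *\<^sub>R (\<i> * X w)) (at 0)" by simp
    moreover have "(2 * pi * (fst k * lam / rho w) * phi a w) *\<^sub>R (\<i> * X w) = c * Er k w * of_real (phi a w)"
      using lam k(2) by (simp add: X_def scaleR_conv_of_real field_simps)
    moreover have "ee ((fst k * lam / rho w) * htime v a u w) * X w = X (tshift (u *\<^sub>R v) w)" for u
      by (simp add: X_def rho_tshift Er_tshift[OF k(1)] mult_ac)
    ultimately show "((\<lambda>u. X (tshift (u *\<^sub>R v) w)) has_vector_derivative c * Er k w * of_real (phi a w)) (at 0)" by simp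
  qed
  then show ?thesis by blast
qed

text \<open>For fixed \<open>w\<close> and a fixed integer \<open>z\<close> the equation determines
  the value of the resonant mode at \<open>w'\<close>, because \<open>cf a i \<noteq> 0\<close>. As
  \<open>z\<close> varies this gives the countable set \<open>C\<close>, and \<open>q > 0\<close>
  makes its preimage null.\<close>

lemma AE_rho:
  assumes m: "m \<noteq> 0" shows "AE w in haar. AE w' in haar. m * lam / rho w - m * lam / rho w' \<notin> \<int>"
proof (rule AE_I2)
  fix w
  define C where "C = (\<lambda>z. (m * lam / (m * lam / rho w - z) - 1) / cf a i) ` \<int>"
  have "countable C" unfolding C_def Ints_def by simp
  moreover have "snd (kap i) \<noteq> 0" using q_pos by (simp add: kap_i)
  ultimately have "AE w' in haar. Re (tchi (kap i) w') \<notin> C" by (intro AE_Re_tchi kap_lat)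
  then show "AE w' in haar. m * lam / rho w - m * lam / rho w' \<notin> \<int>"
  proof (rule AE_mp, intro AE_I2 impI notI)
    fix w' assume C: "Re (tchi (kap i) w') \<notin> C" and z: "m * lam / rho w - m * lam / rho w' \<in> \<int>"
    define z where "z = m * lam / rho w - m * lam / rho w'"
    have "m * lam / rho w - z = m * lam / rho w'" by (simp add: z_def)
    then have "(m * lam / (m * lam / rho w - z) - 1) / cf a i = Re (tchi (kap i) w')"
      using m lam c_nonzero by (simp add: rho_def)
    moreover have "z \<in> \<int>" using z by (simp add: z_def)
    ultimately have "Re (tchi (kap i) w') \<in> C" unfolding C_def by (intro image_eqI[of _ _ z]) simp_all
    with C show False by contradiction
  qed
qed

text \<open>Along the flow \<open>Er k\<close> acquires the factor \<open>ee (j * \<omega>)\<close>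
  with \<open>\<omega> = fst k * lam / rho\<close>, so the correlations have the form treated by
  \<open>wiener_average_abs\<close>, and \<open>AE_rho\<close> supplies the absence of
  atoms.\<close>

lemma average_Er:
  assumes k: "k \<in> lat" "fst k \<noteq> 0" and g: "continuous_on UNIV g"
  shows "(\<lambda>N. (\<Sum>j<N. cmod (\<integral>w. c * Er k (Phi v a (real j) w) * g w \<partial>haar)) / real N) \<longlonglongrightarrow> 0"
proof -
  have G: "continuous_on UNIV (\<lambda>w. c * Er k w * g w)"
    by (intro continuous_intros char_family.cont[OF char_family_Er k(1)] g)
  obtain B where "\<And>w. cmod (c * Er k w * g w) \<le> B" using torus_bounded[OF G] by metis
  moreover have "continuous_on UNIV (\<lambda>w. fst k * lam / rho w)"
    by (intro continuous_intros) simp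
  ultimately have "(\<lambda>N. (\<Sum>j<N. cmod (\<integral>w. (c * Er k w * g w) * ee (real j * (fst k * lam / rho w)) \<partial>haar)) / real N) \<longlonglongrightarrow> 0"
    by (intro wiener_average_abs[OF prob_space_haar _ _ _ AE_rho[OF k(2)]]
        borel_measurable_integrable[OF haar_integrable] G)
  moreover have "(c * Er k w * g w) * ee (real j * (fst k * lam / rho w)) = c * Er k (Phi v a (real j) w) * g w" for j w
    by (simp add: Er_Phi[OF k(1)] mult_ac)
  ultimately show ?thesis by (simp only:)
qed

section \<open>Functions constant on orbits and decay of the rest\<close>

definition line_invariant :: "(torus \<Rightarrow> complex) \<Rightarrow> bool" where
  "line_invariant Q \<longleftrightarrow> (\<forall>s w. Q (tshift (s *\<^sub>R v) w) = Q w)"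

text \<open>\<open>Q0\<close> is the part of \<open>Q\<close> that the flow cannot mix. The
  coboundary clause pins it down as the orbit mean of \<open>Q\<close> weighted by
  \<open>phi\<close>; the last clause says that the remainder decorrelates on average from every
  continuous \<open>g\<close>.\<close>

definition splits :: "(torus \<Rightarrow> complex) \<Rightarrow> (torus \<Rightarrow> complex) \<Rightarrow> bool" where
  "splits Q Q0 \<longleftrightarrow> continuous_on UNIV Q \<and> continuous_on UNIV Q0 \<and> line_invariant Q0 \<and>
     (\<exists>X. cob v X (\<lambda>w. (Q w - Q0 w) * of_real (phi a w))) \<and>
     (\<forall>g. continuous_on UNIV g \<longrightarrow>
       (\<lambda>N. (\<Sum>j<N. cmod (\<integral>w. (Q (Phi v a (real j) w) - Q0 w) * g w \<partial>haar)) / real N) \<longlonglongrightarrow> 0)"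

lemma splitsD:
  assumes "splits Q Q0"
  shows "continuous_on UNIV Q" "continuous_on UNIV Q0" "line_invariant Q0"
    "\<exists>X. cob v X (\<lambda>w. (Q w - Q0 w) * of_real (phi a w))"
    "continuous_on UNIV g \<Longrightarrow>
       (\<lambda>N. (\<Sum>j<N. cmod (\<integral>w. (Q (Phi v a (real j) w) - Q0 w) * g w \<partial>haar)) / real N) \<longlonglongrightarrow> 0"
proof -
  show "continuous_on UNIV Q" using assms unfolding splits_def by (elim conjE)
  show "continuous_on UNIV Q0" using assms unfolding splits_def by (elim conjE)
  show "line_invariant Q0" using assms unfolding splits_def by (elim conjE)
  show "\<exists>X. cob v X (\<lambda>w. (Q w - Q0 w) * of_real (phi a w))"
    using assms unfolding splits_def by (elim conjE)
  show "(\<lambda>N. (\<Sum>j<N. cmod (\<integral>w. (Q (Phi v a (real j) w) - Q0 w) * g w \<partial>haar)) / real N) \<longlonglongrightarrow> 0"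
    if "continuous_on UNIV g"
    using assms that unfolding splits_def by (elim conjE) (drule spec, erule mp)
qed

lemma splits_add:
  assumes "splits P P0" "splits Q Q0" shows "splits (\<lambda>w. P w + Q w) (\<lambda>w. P0 w + Q0 w)"
proof -
  have c: "continuous_on UNIV P" "continuous_on UNIV P0" "continuous_on UNIV Q" "continuous_on UNIV Q0"
    and inv: "line_invariant P0" "line_invariant Q0"
    by (rule splitsD[OF assms(1)] splitsD[OF assms(2)])+
  obtain X Y where "cob v X (\<lambda>w. (P w - P0 w) * of_real (phi a w))" "cob v Y (\<lambda>w. (Q w - Q0 w) * of_real (phi a w))"
    using splitsD(4)[OF assms(1)] splitsD(4)[OF assms(2)] by (elim exE)
  from cob_add[OF this] have 1: "cob v (\<lambda>w. X w + Y w) (\<lambda>w. ((P w + Q w) - (P0 w + Q0 w)) * of_real (phi a w))"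
    by (simp add: algebra_simps)
  have 2: "(\<lambda>N. (\<Sum>j<N. cmod (\<integral>w. ((P (Phi v a (real j) w) + Q (Phi v a (real j) w)) - (P0 w + Q0 w)) * g w \<partial>haar)) / real N) \<longlonglongrightarrow> 0"
    (is "?L \<longlonglongrightarrow> 0") if g: "continuous_on UNIV g" for g
  proof -
    let ?x = "\<lambda>j. cmod (\<integral>w. (P (Phi v a (real j) w) - P0 w) * g w \<partial>haar)"
    let ?y = "\<lambda>j. cmod (\<integral>w. (Q (Phi v a (real j) w) - Q0 w) * g w \<partial>haar)"
    have "(\<lambda>N. (\<Sum>j<N. ?x j) / real N) \<longlonglongrightarrow> 0" "(\<lambda>N. (\<Sum>j<N. ?y j) / real N) \<longlonglongrightarrow> 0"
      by (rule splitsD(5)[OF assms(1) g] splitsD(5)[OF assms(2) g])+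
    from tendsto_add[OF this] have lim: "(\<lambda>N. (\<Sum>j<N. ?x j) / real N + (\<Sum>j<N. ?y j) / real N) \<longlonglongrightarrow> 0" by simp
    have le: "cmod (\<integral>w. ((P (Phi v a (real j) w) + Q (Phi v a (real j) w)) - (P0 w + Q0 w)) * g w \<partial>haar) \<le> ?x j + ?y j" for j
    proof -
      have "integrable haar (\<lambda>w. (P (Phi v a (real j) w) - P0 w) * g w)" "integrable haar (\<lambda>w. (Q (Phi v a (real j) w) - Q0 w) * g w)"
        by (intro haar_integrable continuous_on_mult continuous_on_diff continuous_on_Phi_w c g)+
      from Bochner_Integration.integral_add[OF this]
      have eq: "(\<integral>w. (P (Phi v a (real j) w) - P0 w) * g w + (Q (Phi v a (real j) w) - Q0 w) * g w \<partial>haar) =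
        (\<integral>w. (P (Phi v a (real j) w) - P0 w) * g w \<partial>haar) + (\<integral>w. (Q (Phi v a (real j) w) - Q0 w) * g w \<partial>haar)" .
      have "((P (Phi v a (real j) w) + Q (Phi v a (real j) w)) - (P0 w + Q0 w)) * g w =
        (P (Phi v a (real j) w) - P0 w) * g w + (Q (Phi v a (real j) w) - Q0 w) * g w" for w
        by (simp add: algebra_simps)
      then show ?thesis by (simp only: eq norm_triangle_ineq)
    qed
    show ?thesis
    proof (rule Lim_null_comparison[OF _ lim], rule always_eventually, rule allI)
      fix N
      have "(\<Sum>j<N. cmod (\<integral>w. ((P (Phi v a (real j) w) + Q (Phi v a (real j) w)) - (P0 w + Q0 w)) * g w \<partial>haar)) \<le> (\<Sum>j<N. ?x j + ?y j)"
        by (intro sum_mono le)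
      then have "?L N \<le> (\<Sum>j<N. ?x j + ?y j) / real N" by (intro divide_right_mono) auto
      moreover have "0 \<le> ?L N" by (intro divide_nonneg_nonneg sum_nonneg) auto
      ultimately show "norm (?L N) \<le> (\<Sum>j<N. ?x j) / real N + (\<Sum>j<N. ?y j) / real N"
        by (simp add: sum.distrib add_divide_distrib)
    qed
  qed
  show ?thesis unfolding splits_def
  proof (intro conjI allI impI)
    show "line_invariant (\<lambda>w. P0 w + Q0 w)" using inv by (simp add: line_invariant_def)
    show "\<exists>X. cob v X (\<lambda>w. ((P w + Q w) - (P0 w + Q0 w)) * of_real (phi a w))" using 1 by blast
    show "continuous_on UNIV (\<lambda>w. P w + Q w)" "continuous_on UNIV (\<lambda>w. P0 w + Q0 w)"
      by (intro continuous_on_add c)+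
  qed (rule 2)
qed

text \<open>A monomial with \<open>fst k = 0\<close> is constant on orbits and is its own invariant
  part; any other one has invariant part 0.\<close>

lemma trig_Er_splits: "Q \<in> trig Er \<Longrightarrow> \<exists>Q0. splits Q Q0"
proof (induction rule: trig.induct)
  case (trig_mono k c)
  have cont: "continuous_on UNIV (\<lambda>w. c * Er k w)"
    by (intro continuous_intros char_family.cont[OF char_family_Er trig_mono])
  show ?case
  proof (cases "fst k = 0")
    case True
    then have inv: "Er k (tshift (s *\<^sub>R v) w) = Er k w" for s w
      using Er_tshift[OF trig_mono] by simp
    then have "line_invariant (\<lambda>w. c * Er k w)" by (simp add: line_invariant_def)
    moreover have "Er k (Phi v a t w) = Er k w" for t w unfolding Phi_def by (rule inv)
    moreover have "\<exists>X. cob v X (\<lambda>w. 0)" using cob_0 by blast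
    ultimately have "splits (\<lambda>w. c * Er k w) (\<lambda>w. c * Er k w)"
      using cont unfolding splits_def by simp
    then show ?thesis by blast
  next
    case False
    have "splits (\<lambda>w. c * Er k w) (\<lambda>_. 0)"
      unfolding splits_def using cont cob_Er[OF trig_mono False, of c] average_Er[OF trig_mono False, of _ c]
      by (simp add: line_invariant_def)
    then show ?thesis by blast
  qed
next
  case (trig_add P Q)
  then show ?case using splits_add by blast
qed

lemma phi_orbit: "((\<lambda>s. phi a (tshift (s *\<^sub>R v) w)) has_integral htime v a (1 / lam) w) {0..1 / lam}"
proof -
  have "((\<lambda>s. phi a (tshift (s *\<^sub>R v) w)) has_integral htime v a (1 / lam) w - htime v a 0 w) {0..1 / lam}"
    using lam htime_has_derivative[of v a w]
    by (intro fundamental_theorem_of_calculus)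
      (auto simp: has_real_derivative_iff_has_vector_derivative intro: has_vector_derivative_at_within)
  then show ?thesis by simp
qed

lemma orbit_mean_0:
  assumes "cob v X (\<lambda>w. Y w * of_real (phi a w))"
  shows "((\<lambda>s. Y (tshift (s *\<^sub>R v) w) * of_real (phi a (tshift (s *\<^sub>R v) w))) has_integral 0) {0..1 / lam}"
  using cob_integral[OF assms, of "1 / lam" w] lam closed_orbit[of w] by simp

text \<open>On a closed orbit both \<open>F\<close> and \<open>Q - Q0\<close> have weighted mean 0,
  being coboundaries after multiplication by \<open>phi\<close>. Hence the constant
  \<open>Q0\<close> equals the weighted mean of \<open>Q - F\<close> there.\<close>

lemma invariant_part_small:
  assumes F: "cob v X (\<lambda>w. F w * of_real (phi a w))" and Q: "splits Q Q0"
    and close: "\<And>w. cmod (F w - Q w) \<le> e"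
  shows "cmod (Q0 w) \<le> e"
proof -
  define P where "P = htime v a (1 / lam) w"
  have P: "P > 0"
  proof -
    have "(1 / lam - 0) / 2 \<le> htime v a (1 / lam) w - htime v a 0 w" by (rule htime_mono) (use lam in simp)
    moreover have "0 < (1 / lam - 0) / 2" using lam by simp
    ultimately show ?thesis unfolding P_def htime_0 by linarith
  qed
  let ?T = "\<lambda>s. tshift (s *\<^sub>R v) w"
  have Q0: "Q0 (?T s) = Q0 w" for s using splitsD(3)[OF Q] unfolding line_invariant_def by (elim allE)
  obtain Y where "cob v Y (\<lambda>w. (Q w - Q0 w) * of_real (phi a w))" using splitsD(4)[OF Q] ..
  from has_integral_diff[OF orbit_mean_0[OF F] orbit_mean_0[OF this]]
  have 1: "((\<lambda>s. F (?T s) * of_real (phi a (?T s)) - (Q (?T s) - Q0 (?T s)) * of_real (phi a (?T s))) has_integral 0) {0..1 / lam}"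
    by simp
  have ph: "((\<lambda>s. phi a (?T s)) has_integral P) {0..1 / lam}" unfolding P_def by (rule phi_orbit)
  have "((\<lambda>s. Q0 w * of_real (phi a (?T s))) has_integral Q0 w * of_real P) {0..1 / lam}"
    by (intro has_integral_mult_right has_integral_of_real ph)
  from has_integral_diff[OF 1 this]
  have 2: "((\<lambda>s. (F (?T s) - Q (?T s)) * of_real (phi a (?T s))) has_integral - (Q0 w * of_real P)) {0..1 / lam}"
    by (simp add: Q0 algebra_simps)
  have 3: "((\<lambda>s. e * phi a (?T s)) has_integral e * P) {0..1 / lam}"
    by (intro has_integral_mult_right ph)
  have "norm (integral {0..1 / lam} (\<lambda>s. (F (?T s) - Q (?T s)) * of_real (phi a (?T s)))) \<le>
      integral {0..1 / lam} (\<lambda>s. e * phi a (?T s))"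
  proof (rule integral_norm_bound_integral)
    show "norm ((F (?T s) - Q (?T s)) * of_real (phi a (?T s))) \<le> e * phi a (?T s)" for s
      unfolding norm_mult norm_of_real using mult_right_mono[OF close[of "?T s"], of "phi a (?T s)"] by simp
  qed (use 2 3 in \<open>auto simp: integrable_on_def\<close>)
  then have "cmod (Q0 w) * P \<le> e * P"
    unfolding integral_unique[OF 2] integral_unique[OF 3] using P by (simp add: norm_mult)
  then show ?thesis using P by simp
qed

text \<open>\<open>F\<close> is approximated by some \<open>Q\<close> in the span of
  \<open>Er\<close>. Since \<open>F\<close> has no invariant part, that of \<open>Q\<close> is
  small, and the rest of \<open>Q\<close> decorrelates.\<close>

lemma average_coboundary:
  assumes F: "continuous_on UNIV F" "cob v X (\<lambda>w. F w * of_real (phi a w))" and g: "continuous_on UNIV g"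
  shows "(\<lambda>N. (\<Sum>j<N. cmod (\<integral>w. F (Phi v a (real j) w) * g w \<partial>haar)) / real N) \<longlonglongrightarrow> 0"
proof (rule LIMSEQ_I)
  fix e :: real assume e: "e > 0"
  obtain B where B: "B > 0" "\<And>w. cmod (g w) \<le> B" using torus_bounded[OF g] by metis
  \<comment> \<open>Two errors of size \<open>d\<close>, from \<open>F - Q\<close> and from
    \<open>Q0\<close>, each multiplied by the bound \<open>B\<close> of \<open>g\<close>, add up to
    \<open>e / 2\<close>.\<close>
  define d where "d = e / (4 * B)"
  have d: "d > 0" using e B by (simp add: d_def)
  obtain Q where Q: "Q \<in> trig Er" "\<forall>w. cmod (F w - Q w) < d"
    using char_family.trig_dense[OF char_family_Er F(1) d] by blast
  obtain Q0 where Q0: "splits Q Q0" using trig_Er_splits[OF Q(1)] by blast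
  have close: "cmod (F w - Q w) \<le> d" for w using spec[OF Q(2), of w] by simp
  have small: "cmod (Q0 w) \<le> d" for w by (rule invariant_part_small[OF F(2) Q0 close])
  have c: "continuous_on UNIV Q" "continuous_on UNIV Q0" by (rule splitsD[OF Q0])+
  let ?y = "\<lambda>j. cmod (\<integral>w. (Q (Phi v a (real j) w) - Q0 w) * g w \<partial>haar)"
  have le: "cmod (\<integral>w. F (Phi v a (real j) w) * g w \<partial>haar) \<le> e / 2 + ?y j" for j
  proof -
    have i1: "integrable haar (\<lambda>w. (F (Phi v a (real j) w) - Q (Phi v a (real j) w) + Q0 w) * g w)"
      and i2: "integrable haar (\<lambda>w. (Q (Phi v a (real j) w) - Q0 w) * g w)"
      by (intro haar_integrable continuous_on_mult continuous_on_diff continuous_on_add continuous_on_Phi_w c g F(1))+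
    have split: "F (Phi v a (real j) w) * g w = (F (Phi v a (real j) w) - Q (Phi v a (real j) w) + Q0 w) * g w
        + (Q (Phi v a (real j) w) - Q0 w) * g w" for w
      by (simp add: algebra_simps)
    have eq: "(\<integral>w. F (Phi v a (real j) w) * g w \<partial>haar) = (\<integral>w. (F (Phi v a (real j) w) - Q (Phi v a (real j) w) + Q0 w) * g w \<partial>haar)
        + (\<integral>w. (Q (Phi v a (real j) w) - Q0 w) * g w \<partial>haar)"
      by (subst split) (rule Bochner_Integration.integral_add[OF i1 i2])
    have "cmod (\<integral>w. (F (Phi v a (real j) w) - Q (Phi v a (real j) w) + Q0 w) * g w \<partial>haar) \<le> (d + d) * B"
    proof (rule norm_integral_le[OF prob_space_haar i1])
      fix w
      have "cmod (F (Phi v a (real j) w) - Q (Phi v a (real j) w) + Q0 w) \<le> d + d"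
        by (intro norm_triangle_le add_mono close small)
      then show "cmod ((F (Phi v a (real j) w) - Q (Phi v a (real j) w) + Q0 w) * g w) \<le> (d + d) * B"
        unfolding norm_mult using B(2)[of w] d by (intro mult_mono) auto
    qed
    also have "(d + d) * B = e / 2" using B by (simp add: d_def field_simps)
    finally show ?thesis unfolding eq
      using norm_triangle_ineq[of "\<integral>w. (F (Phi v a (real j) w) - Q (Phi v a (real j) w) + Q0 w) * g w \<partial>haar" "\<integral>w. (Q (Phi v a (real j) w) - Q0 w) * g w \<partial>haar"]
      by linarith
  qed
  have "(\<lambda>N. (\<Sum>j<N. ?y j) / real N) \<longlonglongrightarrow> 0" by (rule splitsD(5)[OF Q0 g])
  from LIMSEQ_D[OF this, of "e / 2"] e obtain N0 where N0: "\<forall>N\<ge>N0. norm ((\<Sum>j<N. ?y j) / real N - 0) < e / 2" by auto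
  have "norm ((\<Sum>j<N. cmod (\<integral>w. F (Phi v a (real j) w) * g w \<partial>haar)) / real N - 0) < e" if "N \<ge> N0" for N
  proof (cases "N = 0")
    case False
    have "(\<Sum>j<N. cmod (\<integral>w. F (Phi v a (real j) w) * g w \<partial>haar)) \<le> (\<Sum>j<N. e / 2 + ?y j)" by (intro sum_mono le)
    then have "(\<Sum>j<N. cmod (\<integral>w. F (Phi v a (real j) w) * g w \<partial>haar)) / real N \<le> (\<Sum>j<N. e / 2 + ?y j) / real N"
      by (intro divide_right_mono) auto
    also have "\<dots> = e / 2 + (\<Sum>j<N. ?y j) / real N" using False by (simp add: sum.distrib add_divide_distrib)
    also have "\<dots> < e"
    proof -
      have "norm ((\<Sum>j<N. ?y j) / real N - 0) < e / 2" using N0 that by blast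
      then show ?thesis unfolding diff_zero real_norm_def by linarith
    qed
    finally show ?thesis by (simp add: sum_nonneg)
  qed (use e in simp)
  then show "\<exists>N0. \<forall>N\<ge>N0. norm ((\<Sum>j<N. cmod (\<integral>w. F (Phi v a (real j) w) * g w \<partial>haar)) / real N - 0) < e" by blast
qed

text \<open>Along a line \<open>psi\<close> grows like \<open>htime - s * rho\<close> with constant
  \<open>rho\<close>. The lemma trades the constant 1 for \<open>phi / rho\<close>, which is the
  form needed to centre a character on each orbit.\<close>

lemma cob_psi: "cob v (\<lambda>w. of_real (psi v a n w / rho w)) (\<lambda>w. of_real (phi a w / rho w) - 1)"
  unfolding cob_def
proof (intro conjI allI)
  show "continuous_on UNIV (\<lambda>w. complex_of_real (psi v a n w / rho w))"
    by (intro continuous_intros continuous_on_psi) simp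
  fix w
  have "((\<lambda>u. htime v a u w) has_real_derivative phi a w) (at 0)"
    using htime_has_derivative[of v a w 0] by simp
  then have "((\<lambda>u. (psi v a n w + htime v a u w - u * rho w) / rho w) has_real_derivative (phi a w - rho w) / rho w) (at 0)"
    by (auto intro!: derivative_eq_intros)
  then have "((\<lambda>u. complex_of_real ((psi v a n w + htime v a u w - u * rho w) / rho w)) has_vector_derivative
      complex_of_real ((phi a w - rho w) / rho w)) (at 0)"
    by (intro has_vector_derivative_of_real) (simp add: has_real_derivative_iff_has_vector_derivative)
  then show "((\<lambda>u. complex_of_real (psi v a n (tshift (u *\<^sub>R v) w) / rho (tshift (u *\<^sub>R v) w))) has_vector_derivative
      of_real (phi a w / rho w) - 1) (at 0)"
    by (simp add: rho_tshift htime_eq diff_divide_distrib)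
qed

text \<open>Expanding \<open>phi\<close> produces the frequencies \<open>k\<close>,
  \<open>k \<plusminus> kap l\<close> and \<open>k \<plusminus> kap i\<close>. The last two are
  nonresonant together with \<open>k\<close> because \<open>kap i\<close> is orthogonal to
  \<open>v\<close>.\<close>

lemma quasi_cob_tchi_phi:
  assumes k: "k \<in> lat" "k \<bullet> v \<noteq> 0"
    and nr: "\<forall>l<n. (k + kap l = 0 \<or> (k + kap l) \<bullet> v \<noteq> 0) \<and> (k - kap l = 0 \<or> (k - kap l) \<bullet> v \<noteq> 0)"
  shows "quasi_cob v (\<lambda>w. tchi k w * of_real (phi a w))"
proof -
  have "quasi_cob v (\<lambda>w. tchi k w + (\<Sum>l<n. of_real (cf a l) * (tchi k w * complex_of_real (Re (tchi (kap l) w)))) +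
      of_real (cf a i) * (tchi k w * complex_of_real (Re (tchi (kap i) w))))"
  proof (intro quasi_cob_add quasi_cob_sum)
    show "quasi_cob v (tchi k)" using k by (intro quasi_cob_tchi) auto
    show "quasi_cob v (\<lambda>w. of_real (cf a l) * (tchi k w * complex_of_real (Re (tchi (kap l) w))))" if "l \<in> {..<n}" for l
      using nr that by (intro quasi_cob_tchi_Re k kap_lat) auto
    show "quasi_cob v (\<lambda>w. of_real (cf a i) * (tchi k w * complex_of_real (Re (tchi (kap i) w))))"
      using k kap_v by (intro quasi_cob_tchi_Re k kap_lat) (auto simp: inner_add_left inner_diff_left)
  qed simp
  moreover have "tchi k w + (\<Sum>l<n. of_real (cf a l) * (tchi k w * complex_of_real (Re (tchi (kap l) w)))) +
      of_real (cf a i) * (tchi k w * complex_of_real (Re (tchi (kap i) w))) = tchi k w * of_real (phi a w)" for w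
    by (simp add: phi_eq distrib_left sum_distrib_left mult_ac)
  ultimately show ?thesis by simp
qed

lemma integral_mu_haar:
  fixes f :: "torus \<Rightarrow> complex"
  assumes "continuous_on UNIV f"
  shows "(\<integral>w. f w \<partial>mu a) = (\<integral>w. f w * of_real (phi a w) \<partial>haar)"
  by (subst integral_mu) (auto simp: scaleR_conv_of_real mult.commute intro: borel_measurable_continuous_onI assms)

text \<open>The integral of \<open>tchi k * phi\<close> over one turn is the same for all orbits,
  but their durations are proportional to \<open>rho\<close>. The time mean on an orbit is therefore
  the space mean divided by \<open>rho\<close>, and this is what must be subtracted.\<close>

lemma cob_tchi_centered:
  assumes k: "k \<in> lat" "k \<bullet> v \<noteq> 0"
    and nr: "\<forall>l<n. (k + kap l = 0 \<or> (k + kap l) \<bullet> v \<noteq> 0) \<and> (k - kap l = 0 \<or> (k - kap l) \<bullet> v \<noteq> 0)"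
  shows "\<exists>X. cob v X (\<lambda>w. (tchi k w - (\<integral>w. tchi k w \<partial>mu a) / of_real (rho w)) * of_real (phi a w))"
proof -
  define I where "I = (\<integral>w. tchi k w \<partial>mu a)"
  have cont: "continuous_on UNIV (\<lambda>w. tchi k w * complex_of_real (phi a w))"
    by (intro continuous_intros k)
  obtain X c where X: "cob v X (\<lambda>w. tchi k w * of_real (phi a w) - c)"
    using quasi_cob_tchi_phi[OF k nr] unfolding quasi_cob_def by blast
  have "(\<integral>w. tchi k w * of_real (phi a w) - c \<partial>haar) = 0"
    by (rule cob_haar[OF X]) (intro continuous_on_diff cont continuous_on_const)
  then have "c = I"
    using haar_integrable[OF cont] haar.prob_space integral_mu_haar[OF continuous_on_tchi[OF k(1)]]
    by (simp add: I_def)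
  then have "cob v (\<lambda>w. X w + (- I) * of_real (psi v a n w / rho w))
      (\<lambda>w. (tchi k w * of_real (phi a w) - I) + (- I) * (of_real (phi a w / rho w) - 1))"
    using X by (intro cob_add cob_scale cob_psi) simp
  moreover have "(tchi k w * of_real (phi a w) - I) + (- I) * (of_real (phi a w / rho w) - 1) =
      (tchi k w - I / of_real (rho w)) * of_real (phi a w)" for w
    by (simp add: algebra_simps)
  ultimately show ?thesis unfolding I_def[symmetric] by auto
qed

text \<open>Replacing the orbit means \<open>I k / rho\<close> by the space mean \<open>I k\<close>
  costs at most \<open>2 * \<bar>cf a i\<bar>\<close>, below \<open>e / 2\<close> by
  \<open>small\<close>. The other half of \<open>e\<close> is for the centred characters, whose
  correlations are small at some common integer time.\<close>

lemma mixing_time: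
  assumes K: "finite K" "K \<subseteq> lat" and e: "e > 0" and small: "4 * \<bar>cf a i\<bar> < e"
    and nr: "\<forall>k\<in>K - {0}. k \<bullet> v \<noteq> 0 \<and>
      (\<forall>l<n. (k + kap l = 0 \<or> (k + kap l) \<bullet> v \<noteq> 0) \<and> (k - kap l = 0 \<or> (k - kap l) \<bullet> v \<noteq> 0))"
  shows "\<exists>t::nat. \<forall>k\<in>K. \<forall>k'\<in>K.
    cmod ((\<integral>w. tchi k (Phi v a (real t) w) * tchi k' w \<partial>mu a) - (\<integral>w. tchi k w \<partial>mu a) * (\<integral>w. tchi k' w \<partial>mu a)) < e"
proof -
  interpret M: prob_space "mu a" by (rule prob_space_mu)
  define I where "I k = (\<integral>w. tchi k w \<partial>mu a)" for k
  define F where "F k w = tchi k w - I k / of_real (rho w)" for k w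
  have cF: "continuous_on UNIV (F k)" if "k \<in> lat" for k
    unfolding F_def using that by (intro continuous_intros) simp_all
  have I1: "cmod (I k) \<le> 1" if "k \<in> lat" for k
    unfolding I_def using that by (intro norm_integral_le[OF prob_space_mu] mu_integrable continuous_on_tchi) auto
  define x where "x = (\<lambda>(k, k') j. cmod (\<integral>w. F k (Phi v a (real j) w) * (tchi k' w * of_real (phi a w)) \<partial>haar))"
  \<comment> \<open>The frequency 0 is left out: there the nonresonance hypothesis says nothing, and
    the correlation identity is exact.\<close>
  have "\<exists>j. \<forall>kk\<in>(K - {0}) \<times> K. x kk j < e / 2"
  proof (rule average_small_ex)
    show "finite ((K - {0}) \<times> K)" using K by simp
    show "(\<lambda>N. (\<Sum>j<N. x kk j) / real N) \<longlonglongrightarrow> 0" if kkK: "kk \<in> (K - {0}) \<times> K" for kk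
    proof -
      obtain k k' where kk: "kk = (k, k')" "k \<in> K - {0}" "k' \<in> K" using kkK by (cases kk) auto
      then have k: "k \<in> lat" "k' \<in> lat" using K by auto
      obtain X where X: "cob v X (\<lambda>w. F k w * of_real (phi a w))"
        using cob_tchi_centered[OF k(1)] nr kk(2) unfolding F_def I_def by blast
      show ?thesis unfolding x_def kk(1) prod.case
        using k by (intro average_coboundary[OF cF X] continuous_intros)
    qed
    show "0 \<le> x kk j" for kk j by (simp add: x_def case_prod_unfold)
  qed (use e in simp)
  then obtain t where t: "\<forall>kk\<in>(K - {0}) \<times> K. x kk t < e / 2" by blast
  have "cmod ((\<integral>w. tchi k (Phi v a (real t) w) * tchi k' w \<partial>mu a) - I k * I k') < e" if k: "k \<in> K" "k' \<in> K" for k k'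
  proof (cases "k = 0")
    case True
    then show ?thesis using e M.prob_space by (simp add: I_def)
  next
    case False
    have kl: "k \<in> lat" "k' \<in> lat" using k K by auto
    have c1: "continuous_on UNIV (\<lambda>w. F k (Phi v a (real t) w) * tchi k' w)"
      by (intro continuous_on_mult continuous_on_Phi_w cF kl continuous_on_tchi)
    have c2: "continuous_on UNIV (\<lambda>w. complex_of_real (1 / rho w - 1) * tchi k' w)"
      by (intro continuous_intros kl) simp_all
    have c3: "continuous_on UNIV (tchi k')" by (rule continuous_on_tchi[OF kl(2)])
    have "tchi k (Phi v a (real t) w) * tchi k' w =
        F k (Phi v a (real t) w) * tchi k' w + (I k * (complex_of_real (1 / rho w - 1) * tchi k' w) + I k * tchi k' w)" for w
      by (simp add: F_def rho_Phi algebra_simps)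
    then have "(\<integral>w. tchi k (Phi v a (real t) w) * tchi k' w \<partial>mu a) =
        (\<integral>w. F k (Phi v a (real t) w) * tchi k' w \<partial>mu a) +
        (I k * (\<integral>w. complex_of_real (1 / rho w - 1) * tchi k' w \<partial>mu a) + I k * I k')"
      using mu_integrable[OF c1, of a] mu_integrable[OF c2, of a] mu_integrable[OF c3, of a] by (simp add: I_def)
    then have eq: "(\<integral>w. tchi k (Phi v a (real t) w) * tchi k' w \<partial>mu a) - I k * I k' =
        (\<integral>w. F k (Phi v a (real t) w) * tchi k' w \<partial>mu a) + I k * (\<integral>w. complex_of_real (1 / rho w - 1) * tchi k' w \<partial>mu a)"
      by simp
    have "cmod (\<integral>w. F k (Phi v a (real t) w) * tchi k' w \<partial>mu a) = x (k, k') t"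
      unfolding integral_mu_haar[OF c1] by (simp add: x_def mult.assoc)
    then have 1: "cmod (\<integral>w. F k (Phi v a (real t) w) * tchi k' w \<partial>mu a) < e / 2" using t k False by simp
    have "cmod (\<integral>w. complex_of_real (1 / rho w - 1) * tchi k' w \<partial>mu a) \<le> 2 * \<bar>cf a i\<bar>"
    proof (rule norm_integral_le[OF prob_space_mu mu_integrable[OF c2]])
      fix w
      have "1 / rho w - 1 = (1 - rho w) / rho w" by (simp add: field_simps)
      then have "\<bar>1 / rho w - 1\<bar> = \<bar>rho w - 1\<bar> / rho w" using rho_ge[of w] by (simp add: abs_minus_commute)
      also have "\<dots> \<le> \<bar>cf a i\<bar> / (1/2)" using abs_rho[of w] rho_ge[of w] by (intro frac_le) auto
      finally show "cmod (complex_of_real (1 / rho w - 1) * tchi k' w) \<le> 2 * \<bar>cf a i\<bar>"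
        by (simp only: norm_mult norm_of_real norm_tchi) simp
    qed
    then have "cmod (I k * (\<integral>w. complex_of_real (1 / rho w - 1) * tchi k' w \<partial>mu a)) \<le> 1 * (2 * \<bar>cf a i\<bar>)"
      unfolding norm_mult using I1[OF kl(1)] by (intro mult_mono) auto
    then show ?thesis unfolding eq
      using 1 small norm_triangle_ineq[of "\<integral>w. F k (Phi v a (real t) w) * tchi k' w \<partial>mu a"
          "I k * (\<integral>w. complex_of_real (1 / rho w - 1) * tchi k' w \<partial>mu a)"] by linarith
  qed
  then show ?thesis unfolding I_def by blast
qed

end

section \<open>Open dense sets of almost mixing parameters\<close>

text \<open>Directions with a negative coordinate are admitted only to make the set dense in the whole parameter space.\<close>

definition mixing_set :: "nat \<Rightarrow> ((real \<times> real) \<times> (nat \<Rightarrow> real)) set" where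
  "mixing_set j = {x. fst (fst x) < 0 \<or> snd (fst x) < 0 \<or>
     (\<exists>t::nat. \<forall>k\<in>lat_box j. \<forall>k'\<in>lat_box j.
       cmod ((\<integral>w. tchi k (Phi (fst x) (snd x) (real t) w) * tchi k' w \<partial>mu (snd x)) -
         (\<integral>w. tchi k w \<partial>mu (snd x)) * (\<integral>w. tchi k' w \<partial>mu (snd x))) < 1 / (real j + 1))}"

lemma open_mixing_set: "open (mixing_set j)"
proof -
  let ?D = "\<lambda>t k k' (x :: (real \<times> real) \<times> (nat \<Rightarrow> real)). cmod ((\<integral>w. tchi k (Phi (fst x) (snd x) (real t) w) * tchi k' w \<partial>mu (snd x)) -
         (\<integral>w. tchi k w \<partial>mu (snd x)) * (\<integral>w. tchi k' w \<partial>mu (snd x)))"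
  have "open {x. ?D t k k' x < 1 / (real j + 1)}" if "k \<in> lat_box j" "k' \<in> lat_box j" for t k k'
  proof (rule open_Collect_less)
    have k: "k \<in> lat" "k' \<in> lat" using that lat_box_subset by blast+
    have "continuous_on UNIV (\<lambda>x :: (real \<times> real) \<times> (nat \<Rightarrow> real). \<integral>w. tchi k (Phi (fst x) (snd x) (real t) w) * tchi k' w \<partial>mu (snd x))"
    proof (rule continuous_on_integral_mu)
      show "continuous_on UNIV (\<lambda>p :: ((real \<times> real) \<times> (nat \<Rightarrow> real)) \<times> torus.
          tchi k (Phi (fst (fst p)) (snd (fst p)) (real t) (snd p)) * tchi k' (snd p))"
        by (intro continuous_intros k)
    qed (simp add: norm_mult)
    moreover have "continuous_on UNIV (\<lambda>x :: (real \<times> real) \<times> (nat \<Rightarrow> real). \<integral>w. tchi l w \<partial>mu (snd x))" if "l \<in> lat" for l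
      by (rule continuous_on_integral_mu) (auto intro!: continuous_intros that)
    ultimately show "continuous_on UNIV (?D t k k')"
      using k by (intro continuous_on_norm continuous_on_diff continuous_on_mult)
  qed (rule continuous_on_const)
  then have "open (\<Union>t. \<Inter>k\<in>lat_box j. \<Inter>k'\<in>lat_box j. {x. ?D t k k' x < 1 / (real j + 1)})"
    by (intro open_UN open_INT finite_lat_box ballI)
  moreover have "open {x :: (real \<times> real) \<times> (nat \<Rightarrow> real). fst (fst x) < 0}" "open {x :: (real \<times> real) \<times> (nat \<Rightarrow> real). snd (fst x) < 0}"
    by (intro open_Collect_less continuous_intros)+
  ultimately have "open ({x. fst (fst x) < 0} \<union> {x. snd (fst x) < 0} \<union>
      (\<Union>t. \<Inter>k\<in>lat_box j. \<Inter>k'\<in>lat_box j. {x. ?D t k k' x < 1 / (real j + 1)}))"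
    by (intro open_Un)
  moreover have "mixing_set j = {x. fst (fst x) < 0} \<union> {x. snd (fst x) < 0} \<union>
      (\<Union>t. \<Inter>k\<in>lat_box j. \<Inter>k'\<in>lat_box j. {x. ?D t k k' x < 1 / (real j + 1)})"
    by (auto simp: mixing_set_def)
  ultimately show ?thesis by simp
qed

text \<open>The factor \<open>lam\<close> absorbs the common denominator and the gcd, leaving a
  coprime pair, from which Bezout later yields the section \<open>b\<close>.\<close>

lemma rational_direction_dense:
  assumes V: "open V" "v \<in> V" and pos: "fst v > 0" "snd v > 0"
  shows "\<exists>lam q p. lam > 0 \<and> q > 0 \<and> p > 0 \<and> coprime q p \<and> lam *\<^sub>R (real q, real p) \<in> V"
proof -
  obtain d where d: "d > 0" "\<And>u. dist u v < d \<Longrightarrow> u \<in> V" using V unfolding open_dist by blast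
  obtain r where r: "r \<in> \<rat>" "fst v < r" "r < fst v + d / 2"
    using Rats_dense_in_real[of "fst v" "fst v + d / 2"] d by auto
  obtain s where s: "s \<in> \<rat>" "snd v < s" "s < snd v + d / 2"
    using Rats_dense_in_real[of "snd v" "snd v + d / 2"] d by auto
  obtain m1 n1 :: nat where 1: "n1 \<noteq> 0" "r = real m1 / real n1"
    using Rats_abs_nat_div_natE[OF r(1)] r pos by (metis abs_of_pos order_less_trans)
  obtain m2 n2 :: nat where 2: "n2 \<noteq> 0" "s = real m2 / real n2"
    using Rats_abs_nat_div_natE[OF s(1)] s pos by (metis abs_of_pos order_less_trans)
  have "r > 0" "s > 0" using r s pos by linarith+
  then have "m1 \<noteq> 0" "m2 \<noteq> 0" using 1 2 by (auto intro: ccontr)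
  define x where "x = m1 * n2"
  define y where "y = m2 * n1"
  define g where "g = gcd x y"
  have xy: "x > 0" "y > 0" using 1 2 \<open>m1 \<noteq> 0\<close> \<open>m2 \<noteq> 0\<close> by (simp_all add: x_def y_def)
  then have g: "g > 0" by (simp add: g_def)
  have "g dvd x" "g dvd y" by (simp_all add: g_def)
  then obtain q p where qp: "x = g * q" "y = g * p" by (auto elim!: dvdE)
  have "gcd x y = g * gcd q p" by (simp only: qp gcd_mult_distrib_nat)
  then have "g * 1 = g * gcd q p" by (simp only: g_def[symmetric] mult_1_right)
  then have "1 = gcd q p" by (rule iffD1[OF nat_mult_eq_cancel1[OF g]])
  then have "coprime q p" by (simp only: coprime_iff_gcd_eq_1)
  moreover have "q > 0" "p > 0" using xy qp by auto
  moreover define lam where "lam = real g / (real n1 * real n2)"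
  moreover have "lam > 0" using g 1 2 by (simp add: lam_def)
  moreover have "lam *\<^sub>R (real q, real p) \<in> V"
  proof -
    have "real g * real q = real m1 * real n2" "real g * real p = real m2 * real n1"
      using qp by (simp_all add: x_def y_def flip: of_nat_mult)
    then have "lam *\<^sub>R (real q, real p) = (r, s)"
      using 1 2 by (simp add: lam_def field_simps)
    moreover have "dist (r, s) v \<le> dist r (fst v) + dist s (snd v)"
      using real_sqrt_sum_squares_triangle_ineq[of "dist r (fst v)" 0 0 "dist s (snd v)"]
      by (cases v) (simp add: dist_Pair_Pair)
    then have "dist (r, s) v < d" using r s d by (simp add: dist_real_def)
    ultimately show ?thesis using d(2) by simp
  qed
  ultimately show ?thesis by blast
qed

text \<open>The order of choices matters. Once \<open>n\<close> modes are fixed, only finitely many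
  frequencies must be nonresonant, so near a generic direction there is an open set
  \<open>V'\<close> of admissible ones. A rational direction in \<open>V'\<close> creates a
  resonance that involves none of the fixed modes, and its amplitude can then be chosen
  freely.\<close>

lemma dense_mixing_set:
  assumes U: "open U" "x \<in> U" shows "U \<inter> mixing_set j \<noteq> {}"
proof -
  obtain a n where an: "(fst x, a) \<in> U" "\<forall>i\<ge>n. a i = 0"
    using finitely_supported_in_open[of U "fst x" "snd x"] U by auto
  define V where "V = (\<lambda>v. (v, a)) -` U"
  have oV: "open V" unfolding V_def using U(1) by (intro open_vimage continuous_intros)
  have neV: "V \<noteq> {}" using an(1) by (auto simp: V_def)
  show ?thesis
  proof (cases "\<exists>v\<in>V. fst v < 0 \<or> snd v < 0")
    case True
    then obtain v where "v \<in> V" "fst v < 0 \<or> snd v < 0" by blast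
    then have "(v, a) \<in> U \<inter> mixing_set j" by (auto simp: V_def mixing_set_def)
    then show ?thesis by blast
  next
    case False
    obtain v where v: "v \<in> V" "prime_generic v" using prime_generic_dense[OF oV neV] by blast
    have "(1, 0) \<bullet> v \<noteq> 0" "(0, 1) \<bullet> v \<noteq> 0"
      by (rule prime_generic_nonresonant[OF v(2)]; simp add: lat_iff zero_prod_def)+
    then have "fst v > 0" "snd v > 0" using False v(1) by (auto simp: inner_prod_def not_less order_less_le)
    \<comment> \<open>All nonzero frequencies on which \<open>rational_flow\<close> and
      \<open>mixing_time\<close> impose nonresonance.\<close>
    define S where "S = (lat_box j \<union> kap ` {..<n} \<union> (\<lambda>(k, l). k + kap l) ` (lat_box j \<times> {..<n}) \<union>
      (\<lambda>(k, l). k - kap l) ` (lat_box j \<times> {..<n})) - {0}"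
    have finS: "finite S" unfolding S_def using finite_lat_box by auto
    have S: "S \<subseteq> lat - {0}"
    proof -
      have "k + kap l \<in> lat" "k - kap l \<in> lat" if "k \<in> lat_box j" for k l
        by (rule lat_add[OF subsetD[OF lat_box_subset that] kap_lat] lat_diff[OF subsetD[OF lat_box_subset that] kap_lat])+
      then show ?thesis unfolding S_def using lat_box_subset[of j] kap_lat by auto
    qed
    define V' where "V' = V \<inter> (\<Inter>m\<in>S. {v. m \<bullet> v \<noteq> 0})"
    have "open V'" unfolding V'_def
      by (intro open_Int oV open_INT finS ballI open_Collect_neq continuous_intros)
    moreover have "v \<in> V'" using v prime_generic_nonresonant[OF v(2)] S unfolding V'_def by blast
    ultimately obtain lam q p where lqp: "lam > 0" "q > 0" "p > 0" "coprime q p" "lam *\<^sub>R (real q, real p) \<in> V'"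
      using rational_direction_dense[of V' v] \<open>fst v > 0\<close> \<open>snd v > 0\<close> by blast
    define v' where "v' = lam *\<^sub>R (real q, real p)"
    have v': "v' \<in> V" "\<forall>m\<in>S. m \<bullet> v' \<noteq> 0" using lqp(5) by (auto simp: v'_def V'_def)
    obtain i where i: "kap i = (real p, - real q)" using kap_surj[of p q] lqp by auto
    have "kap i \<bullet> v' = 0" by (simp add: i v'_def)
    have kapS: "kap l \<in> S" if "l < n" for l using that kap_nonzero by (auto simp: S_def)
    \<comment> \<open>The modes below \<open>n\<close> lie in \<open>S\<close> and are nonresonant
      for \<open>v'\<close>, so the resonant index is new and \<open>a\<close> vanishes
      there.\<close>
    have in_: "n \<le> i"
    proof (rule ccontr)
      assume "\<not> n \<le> i"
      then have "kap i \<in> S" by (intro kapS) simp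
      with v'(2) \<open>kap i \<bullet> v' = 0\<close> show False by blast
    qed
    obtain b1 b2 :: int where "b1 * int q + b2 * int p = gcd (int q) (int p)" using bezout_int by blast
    then have "b1 * int q + b2 * int p = 1" using lqp(4) by (simp add: coprime_int_iff coprime_iff_gcd_eq_1[symmetric])
    then have "real_of_int (b1 * int q + b2 * int p) = 1" by simp
    then have b: "(real_of_int b1, real_of_int b2) \<in> lat" "(real_of_int b1, real_of_int b2) \<bullet> (real q, real p) = 1"
      by (simp_all add: lat_iff)
    define e where "e = 1 / (real j + 1)"
    have e: "e > 0" by (simp add: e_def)
    have "continuous_on UNIV (\<lambda>\<delta>. (v', a(i := \<delta>)))"
    proof (intro continuous_on_Pair continuous_on_const continuous_on_coordinatewise_then_product)
      show "continuous_on UNIV (\<lambda>\<delta>. (a(i := \<delta>)) l)" for l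
        by (cases "l = i") (auto intro: continuous_intros)
    qed
    then have "open ((\<lambda>\<delta>. (v', a(i := \<delta>))) -` U)" using U(1) by (simp add: open_vimage)
    moreover have "a(i := 0) = a" using an(2) in_ by auto
    then have "0 \<in> (\<lambda>\<delta>. (v', a(i := \<delta>))) -` U" using v'(1) by (simp add: V_def)
    ultimately obtain d where d: "d > 0" "\<And>\<delta>. dist \<delta> 0 < d \<Longrightarrow> (v', a(i := \<delta>)) \<in> U"
      unfolding open_dist by blast
    \<comment> \<open>Below \<open>d\<close> it stays inside \<open>U\<close>; at most 1 it makes
      the sine positive, so the mode is present; below \<open>e\<close>, together with the factor
      \<open>(1/2) ^ (i + 2) \<le> 1/4\<close>, it gives \<open>small\<close>.\<close>
    define \<delta> where "\<delta> = min (d / 2) (min 1 (e / 2))"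
    have \<delta>: "0 < \<delta>" "\<delta> < d" "\<delta> \<le> 1" "\<delta> < e" using d(1) e by (auto simp: \<delta>_def min_def)
    define a' where "a' = a(i := \<delta>)"
    have cf: "cf a' i = (1/2) ^ (i + 2) * sin \<delta>" by (simp add: cf_def a'_def)
    have sin: "0 < sin \<delta>" "sin \<delta> \<le> \<delta>"
      using \<delta> pi_gt3 by (auto intro: sin_gt_zero sin_x_le_x)
    have "(1/2 :: real) ^ (i + 2) \<le> (1/2) ^ 2" by (rule power_decreasing) auto
    then have "(1/2) ^ (i + 2) * sin \<delta> \<le> 1/4 * \<delta>"
      using sin by (intro mult_mono) (auto simp: power2_eq_square)
    then have small: "4 * \<bar>cf a' i\<bar> < e" using sin \<delta> by (simp add: cf abs_mult)
    interpret rational_flow lam q p "(real_of_int b1, real_of_int b2)" n i a' v'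
    proof
      show "\<forall>l\<ge>n. l \<noteq> i \<longrightarrow> a' l = 0" using an(2) by (simp add: a'_def)
      show "\<forall>l<n. kap l \<bullet> v' \<noteq> 0" using kapS v'(2) by blast
      show "cf a' i \<noteq> 0" using sin by (simp add: cf)
    qed (use lqp i in_ b v'_def in auto)
    have "\<forall>k\<in>lat_box j - {0}. k \<bullet> v' \<noteq> 0 \<and>
      (\<forall>l<n. (k + kap l = 0 \<or> (k + kap l) \<bullet> v' \<noteq> 0) \<and> (k - kap l = 0 \<or> (k - kap l) \<bullet> v' \<noteq> 0))"
    proof (intro ballI conjI allI impI)
      fix k assume k: "k \<in> lat_box j - {0}"
      then have "k \<in> S" by (simp add: S_def)
      then show "k \<bullet> v' \<noteq> 0" using v'(2) by blast
      fix l assume "l < n"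
      then have "k + kap l \<in> insert 0 S" "k - kap l \<in> insert 0 S"
        using k unfolding S_def by force+
      then show "k + kap l = 0 \<or> (k + kap l) \<bullet> v' \<noteq> 0" "k - kap l = 0 \<or> (k - kap l) \<bullet> v' \<noteq> 0"
        using v'(2) by blast+
    qed
    from mixing_time[OF finite_lat_box lat_box_subset e small this]
    have "(v', a') \<in> mixing_set j" by (auto simp: mixing_set_def e_def)
    moreover have "(v', a') \<in> U" using d(2)[of \<delta>] \<delta> by (simp add: a'_def)
    ultimately show ?thesis by blast
  qed
qed

section \<open>Mixing along a sequence of times\<close>

text \<open>Additivity is asked only for continuous functions, where integrability is known, while
  scaling holds for all functions because the Bochner integral commutes with it
  unconditionally.\<close>

definition bounded_functional :: "real \<Rightarrow> ((torus \<Rightarrow> complex) \<Rightarrow> complex) \<Rightarrow> bool" where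
  "bounded_functional B T \<longleftrightarrow>
     (\<forall>f g. continuous_on UNIV f \<longrightarrow> continuous_on UNIV g \<longrightarrow> T (\<lambda>w. f w + g w) = T f + T g) \<and>
     (\<forall>f c. T (\<lambda>w. c * f w) = c * T f) \<and>
     (\<forall>f C. continuous_on UNIV f \<longrightarrow> (\<forall>w. cmod (f w) \<le> C) \<longrightarrow> cmod (T f) \<le> B * C)"

lemma bounded_functionalD:
  assumes "bounded_functional B T"
  shows "continuous_on UNIV f \<Longrightarrow> continuous_on UNIV g \<Longrightarrow> T (\<lambda>w. f w + g w) = T f + T g"
    and "T (\<lambda>w. c * f w) = c * T f"
    and "continuous_on UNIV f \<Longrightarrow> (\<And>w. cmod (f w) \<le> C) \<Longrightarrow> cmod (T f) \<le> B * C"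
  using assms unfolding bounded_functional_def by simp_all

text \<open>Functionals with a common bound that converge on a set with dense span converge
  everywhere; the bound makes the approximation error uniform in \<open>j\<close>.\<close>

lemma (in char_family) functional_convergence:
  assumes T: "\<And>j::nat. bounded_functional B (T j)" and L: "bounded_functional B L" and B: "B > 0"
    and conv: "\<And>k. k \<in> lat \<Longrightarrow> (\<lambda>j. T j (E k)) \<longlonglongrightarrow> L (E k)"
    and f: "continuous_on UNIV f"
  shows "(\<lambda>j. T j f) \<longlonglongrightarrow> L f"
  using f
proof (induction rule: continuous_induct)
  case (mono k c)
  have "(\<lambda>j. c * T j (E k)) \<longlonglongrightarrow> c * L (E k)" by (intro tendsto_mult tendsto_const conv mono)
  then show ?case by (simp only: bounded_functionalD(2)[OF T] bounded_functionalD(2)[OF L])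
next
  case (add g h)
  have "(\<lambda>j. T j g + T j h) \<longlonglongrightarrow> L g + L h" by (intro tendsto_add add)
  then show ?case by (simp only: bounded_functionalD(1)[OF T add(1,2)] bounded_functionalD(1)[OF L add(1,2)])
next
  case (limit g)
  show ?case
  proof (rule LIMSEQ_I)
    fix e :: real assume e: "e > 0"
    define d where "d = e / (3 * B)"
    have d: "d > 0" using e B by (simp add: d_def)
    obtain h where h: "continuous_on UNIV h" "(\<lambda>j. T j h) \<longlonglongrightarrow> L h" "\<forall>w. cmod (g w - h w) < d"
      using limit(2)[OF d] by (elim exE conjE)
    define r where "r w = g w - h w" for w
    have r: "continuous_on UNIV r" unfolding r_def by (intro continuous_on_diff limit(1) h(1))
    have small: "cmod (r w) \<le> d" for w using spec[OF h(3), of w] by (simp add: r_def)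
    have g: "g = (\<lambda>w. h w + r w)" by (simp add: r_def)
    have Tg: "T j g = T j h + T j r" for j unfolding g by (rule bounded_functionalD(1)[OF T h(1) r])
    have Lg: "L g = L h + L r" unfolding g by (rule bounded_functionalD(1)[OF L h(1) r])
    have Bd: "B * d = e / 3" using B by (simp add: d_def)
    from LIMSEQ_D[OF h(2), of "e / 3"] e obtain N where N: "\<forall>j\<ge>N. norm (T j h - L h) < e / 3" by auto
    have "norm (T j g - L g) < e" if "j \<ge> N" for j
    proof -
      have "T j g - L g = (T j h - L h) + (T j r - L r)" unfolding Tg Lg by simp
      moreover have "norm (T j h - L h) < e / 3" using N that by blast
      moreover have "norm (T j r) \<le> e / 3" "norm (L r) \<le> e / 3"
        using bounded_functionalD(3)[OF T r small, of j] bounded_functionalD(3)[OF L r small] by (simp_all add: Bd)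
      ultimately show ?thesis
        using norm_triangle_ineq[of "T j h - L h" "T j r - L r"] norm_triangle_ineq4[of "T j r" "L r"] by simp
    qed
    then show "\<exists>N. \<forall>j\<ge>N. norm (T j g - L g) < e" by blast
  qed
qed

lemma bounded_functional_correlation:
  assumes q: "continuous_on UNIV q" and B: "\<And>w. cmod (q w) \<le> B"
  shows "bounded_functional B (\<lambda>h. \<integral>w. h (Phi v a t w) * q w \<partial>mu a)"
  unfolding bounded_functional_def
proof (intro conjI allI impI)
  fix f g :: "torus \<Rightarrow> complex" and c :: complex and C :: real
  have i: "continuous_on UNIV (\<lambda>w. h (Phi v a t w) * q w)" if "continuous_on UNIV h" for h
    by (intro continuous_on_mult continuous_on_Phi_w that q)
  show "(\<integral>w. c * f (Phi v a t w) * q w \<partial>mu a) = c * (\<integral>w. f (Phi v a t w) * q w \<partial>mu a)"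
    by (simp add: mult.assoc)
  assume f: "continuous_on UNIV f"
  show "cmod (\<integral>w. f (Phi v a t w) * q w \<partial>mu a) \<le> B * C" if C: "\<forall>w. cmod (f w) \<le> C"
  proof (rule norm_integral_le[OF prob_space_mu mu_integrable[OF i[OF f]]])
    fix w
    have "0 \<le> C" using order_trans[OF norm_ge_zero spec[OF C, of w]] .
    then have "cmod (f (Phi v a t w)) * cmod (q w) \<le> C * B"
      by (intro mult_mono spec[OF C] B norm_ge_zero)
    then show "cmod (f (Phi v a t w) * q w) \<le> B * C" by (simp add: norm_mult mult.commute)
  qed
  assume g: "continuous_on UNIV g"
  show "(\<integral>w. (f (Phi v a t w) + g (Phi v a t w)) * q w \<partial>mu a) =
      (\<integral>w. f (Phi v a t w) * q w \<partial>mu a) + (\<integral>w. g (Phi v a t w) * q w \<partial>mu a)"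
    unfolding distrib_right by (rule Bochner_Integration.integral_add[OF mu_integrable[OF i[OF f]] mu_integrable[OF i[OF g]]])
qed

text \<open>At time 0 a correlation with the constant \<open>c\<close> is the integral times
  \<open>c\<close>, so the bound for correlations applies.\<close>

lemma bounded_functional_integral:
  assumes c: "cmod c \<le> B" shows "bounded_functional B (\<lambda>h. (\<integral>w. h w \<partial>mu a) * c)"
proof -
  have "(\<integral>w. h (Phi 0 a 0 w) * c \<partial>mu a) = (\<integral>w. h w \<partial>mu a) * c" for h :: "torus \<Rightarrow> complex" by simp
  then show ?thesis
    using bounded_functional_correlation[OF continuous_on_const[of UNIV c] c, where v = 0 and a = a and t = 0] by simp
qed

lemma mixing_continuous:
  assumes chars: "\<And>k k'. k \<in> lat \<Longrightarrow> k' \<in> lat \<Longrightarrow>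
      (\<lambda>j. \<integral>w. tchi k (Phi v a (\<tau> j) w) * tchi k' w \<partial>mu a) \<longlonglongrightarrow> (\<integral>w. tchi k w \<partial>mu a) * (\<integral>w. tchi k' w \<partial>mu a)"
    and f: "continuous_on UNIV f" and g: "continuous_on UNIV g"
  shows "(\<lambda>j. \<integral>w. f (Phi v a (\<tau> j) w) * g w \<partial>mu a) \<longlonglongrightarrow> (\<integral>w. f w \<partial>mu a) * (\<integral>w. g w \<partial>mu a :: complex)"
proof -
  have 1: "(\<lambda>j. \<integral>w. f (Phi v a (\<tau> j) w) * tchi k' w \<partial>mu a) \<longlonglongrightarrow> (\<integral>w. f w \<partial>mu a) * (\<integral>w. tchi k' w \<partial>mu a)"
    if k': "k' \<in> lat" for k'
  proof -
    note c = continuous_on_tchi[OF k']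
    have b: "cmod (tchi k' w) \<le> 1" for w by simp
    have b': "cmod (\<integral>w. tchi k' w \<partial>mu a) \<le> 1" by (rule norm_integral_le[OF prob_space_mu mu_integrable[OF c] b])
    show ?thesis
      by (rule tchi.functional_convergence[OF bounded_functional_correlation[OF c b] bounded_functional_integral[OF b'] zero_less_one chars[OF _ k'] f])
  qed
  obtain B where B: "B > 0" "\<And>w. cmod (f w) \<le> B" using torus_bounded[OF f] by metis
  have b: "cmod (f (Phi v a (\<tau> j) w)) \<le> B" for j w by (rule B(2))
  have b': "cmod (\<integral>w. f w \<partial>mu a) \<le> B" by (rule norm_integral_le[OF prob_space_mu mu_integrable[OF f] B(2)])
  \<comment> \<open>The second pass varies \<open>g\<close> with \<open>f\<close> fixed. Writing
    \<open>h\<close> as \<open>h \<circ> Phi 0 a 0\<close> and swapping the factors brings it into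
    the form of \<open>bounded_functional_correlation\<close>.\<close>
  have 2: "(\<lambda>j. \<integral>w. h (Phi 0 a 0 w) * f (Phi v a (\<tau> j) w) \<partial>mu a) = (\<lambda>j. \<integral>w. f (Phi v a (\<tau> j) w) * h w \<partial>mu a)"
    for h :: "torus \<Rightarrow> complex" by (simp add: mult.commute)
  have "(\<lambda>j. \<integral>w. g (Phi 0 a 0 w) * f (Phi v a (\<tau> j) w) \<partial>mu a) \<longlonglongrightarrow> (\<integral>w. g w \<partial>mu a) * (\<integral>w. f w \<partial>mu a)"
  proof (rule tchi.functional_convergence[OF bounded_functional_correlation[OF continuous_on_Phi_w[OF f] b] bounded_functional_integral[OF b'] B(1) _ g])
    show "(\<lambda>j. \<integral>w. tchi k (Phi 0 a 0 w) * f (Phi v a (\<tau> j) w) \<partial>mu a) \<longlonglongrightarrow> (\<integral>w. tchi k w \<partial>mu a) * (\<integral>w. f w \<partial>mu a)"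
      if "k \<in> lat" for k
      unfolding 2 using 1[OF that] by (simp only: mult.commute[of "\<integral>w. f w \<partial>mu a"])
  qed
  then show ?thesis unfolding 2 by (simp only: mult.commute[of "\<integral>w. g w \<partial>mu a"])
qed

text \<open>One pair \<open>f\<close>, \<open>g\<close> works for all times, since invariance turns
  the error of \<open>f \<circ> Phi t\<close> into that of \<open>f\<close>. This uniformity gives
  both continuity in \<open>t\<close> and the limit along \<open>\<tau>\<close> for Borel
  sets.\<close>

lemma approx_correlation:
  assumes A: "A \<in> sets borel" "B \<in> sets borel" and e: "e > 0"
  shows "\<exists>f g :: torus \<Rightarrow> real. continuous_on UNIV f \<and> continuous_on UNIV g \<and>
    (\<forall>t. \<bar>measure (mu a) (Phi v a t -` A \<inter> B) - (\<integral>w. f (Phi v a t w) * g w \<partial>mu a)\<bar> \<le> 2 * e) \<and>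
    \<bar>measure (mu a) A * measure (mu a) B - (\<integral>w. f w \<partial>mu a) * (\<integral>w. g w \<partial>mu a)\<bar> \<le> 2 * e"
proof -
  interpret M: prob_space "mu a" by (rule prob_space_mu)
  note [measurable] = A
  obtain f where f: "continuous_on UNIV f" "\<forall>w. 0 \<le> f w \<and> f w \<le> 1" "(\<integral>w. \<bar>indicator A w - f w :: real\<bar> \<partial>mu a) < e"
    using L1_approx[OF M.finite_measure_axioms sets_mu A(1) e] by blast
  obtain g where g: "continuous_on UNIV g" "\<forall>w. 0 \<le> g w \<and> g w \<le> 1" "(\<integral>w. \<bar>indicator B w - g w :: real\<bar> \<partial>mu a) < e"
    using L1_approx[OF M.finite_measure_axioms sets_mu A(2) e] by blast
  have [measurable]: "f \<in> borel_measurable borel" "g \<in> borel_measurable borel"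
    by (rule borel_measurable_continuous_onI[OF f(1)] borel_measurable_continuous_onI[OF g(1)])+
  have f01: "0 \<le> f w" "f w \<le> 1" and g01: "0 \<le> g w" "g w \<le> 1" for w using f(2) g(2) by blast+
  have ii: "integrable (mu a) h" if "h \<in> borel_measurable borel" "\<And>w. \<bar>h w\<bar> \<le> 1" for h :: "torus \<Rightarrow> real"
    by (rule M.integrable_const_bound[of _ 1]) (use that in auto)
  have df: "\<bar>indicator A w - f w\<bar> \<le> 1" and dg: "\<bar>indicator B w - g w\<bar> \<le> 1" for w
    using f01[of w] g01[of w] by (auto simp: indicator_def)
  have "\<bar>measure (mu a) (Phi v a t -` A \<inter> B) - (\<integral>w. f (Phi v a t w) * g w \<partial>mu a)\<bar> \<le> 2 * e" for t
  proof -
    have S [measurable]: "Phi v a t -` A \<in> sets borel" using measurable_sets[OF Phi_measurable A(1)] by simp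
    have eq: "indicator (Phi v a t -` A \<inter> B) w = (indicator A (Phi v a t w) * indicator B w :: real)" for w
      by (simp add: indicator_def)
    have fg: "\<bar>f (Phi v a t w) * g w\<bar> \<le> 1" for w
      using f01 g01 by (simp add: abs_mult mult_le_one)
    have "measure (mu a) (Phi v a t -` A \<inter> B) = (\<integral>w. indicator (Phi v a t -` A \<inter> B) w \<partial>mu a)" by simp
    then have "measure (mu a) (Phi v a t -` A \<inter> B) - (\<integral>w. f (Phi v a t w) * g w \<partial>mu a) =
        (\<integral>w. indicator A (Phi v a t w) * indicator B w - f (Phi v a t w) * g w \<partial>mu a)"
      unfolding eq by (subst Bochner_Integration.integral_diff) (auto intro!: ii fg simp: indicator_def)
    also have "\<bar>\<dots>\<bar> \<le> (\<integral>w. \<bar>indicator A (Phi v a t w) - f (Phi v a t w)\<bar> + \<bar>indicator B w - g w\<bar> \<partial>mu a)"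
    proof (rule order_trans[OF integral_abs_bound], rule integral_mono)
      fix w
      have split: "indicator A (Phi v a t w) * indicator B w - f (Phi v a t w) * g w =
          (indicator A (Phi v a t w) - f (Phi v a t w)) * indicator B w + f (Phi v a t w) * (indicator B w - g w)"
        by (simp add: algebra_simps)
      have "\<bar>(indicator A (Phi v a t w) - f (Phi v a t w)) * indicator B w\<bar> \<le> \<bar>indicator A (Phi v a t w) - f (Phi v a t w)\<bar> * 1"
        unfolding abs_mult by (intro mult_left_mono) (auto simp: indicator_def)
      moreover have "\<bar>f (Phi v a t w) * (indicator B w - g w)\<bar> \<le> 1 * \<bar>indicator B w - g w\<bar>"
        unfolding abs_mult using f01 by (intro mult_right_mono) auto
      ultimately show "\<bar>indicator A (Phi v a t w) * indicator B w - f (Phi v a t w) * g w\<bar> \<le>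
          \<bar>indicator A (Phi v a t w) - f (Phi v a t w)\<bar> + \<bar>indicator B w - g w\<bar>"
        unfolding split by (intro order_trans[OF abs_triangle_ineq] add_mono) simp_all
    next
      have "integrable (mu a) (\<lambda>w. indicator A (Phi v a t w) * indicator B w :: real)" by (intro ii) (auto simp: indicator_def)
      then show "integrable (mu a) (\<lambda>w. \<bar>indicator A (Phi v a t w) * indicator B w - f (Phi v a t w) * g w\<bar>)"
        by (intro integrable_abs Bochner_Integration.integrable_diff ii[OF _ fg]) auto
      show "integrable (mu a) (\<lambda>w. \<bar>indicator A (Phi v a t w) - f (Phi v a t w)\<bar> + \<bar>indicator B w - g w\<bar>)"
        using df dg by (intro Bochner_Integration.integrable_add ii) auto
    qed
    also have "\<dots> = (\<integral>w. \<bar>indicator A (Phi v a t w) - f (Phi v a t w)\<bar> \<partial>mu a) + (\<integral>w. \<bar>indicator B w - g w\<bar> \<partial>mu a)"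
      using df dg by (intro Bochner_Integration.integral_add ii) auto
    also have "(\<integral>w. \<bar>indicator A (Phi v a t w) - f (Phi v a t w)\<bar> \<partial>mu a) = (\<integral>w. \<bar>indicator A w - f w\<bar> \<partial>distr (mu a) (mu a) (Phi v a t))"
      by (subst integral_distr) auto
    also have "distr (mu a) (mu a) (Phi v a t) = mu a" using invariant_prob_mu[of v a] by (simp add: invariant_prob_def)
    finally show ?thesis using f(3) g(3) by linarith
  qed
  moreover have "\<bar>measure (mu a) A * measure (mu a) B - (\<integral>w. f w \<partial>mu a) * (\<integral>w. g w \<partial>mu a)\<bar> \<le> 2 * e"
  proof -
    have d: "\<bar>measure (mu a) C - (\<integral>w. h w \<partial>mu a)\<bar> \<le> e"
      if [measurable]: "C \<in> sets borel" "h \<in> borel_measurable borel" and h: "\<And>w. 0 \<le> h w" "\<And>w. h w \<le> 1"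
        and l: "(\<integral>w. \<bar>indicator C w - h w :: real\<bar> \<partial>mu a) < e" for C h
    proof -
      have "measure (mu a) C - (\<integral>w. h w \<partial>mu a) = (\<integral>w. indicator C w - h w \<partial>mu a)"
        using h by (subst Bochner_Integration.integral_diff) (auto intro!: ii simp: indicator_def)
      moreover have "\<bar>\<integral>w. indicator C w - h w \<partial>mu a\<bar> \<le> (\<integral>w. \<bar>indicator C w - h w\<bar> \<partial>mu a)"
        by (rule integral_abs_bound)
      ultimately show ?thesis using l by linarith
    qed
    have dA: "\<bar>measure (mu a) A - (\<integral>w. f w \<partial>mu a)\<bar> \<le> e" and dB: "\<bar>measure (mu a) B - (\<integral>w. g w \<partial>mu a)\<bar> \<le> e"
      using f01 g01 f(3) g(3) by (intro d; simp)+
    have If: "\<bar>\<integral>w. f w \<partial>mu a\<bar> \<le> 1"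
      using norm_integral_le[OF prob_space_mu mu_integrable[OF f(1)], of 1 a] f01 by simp
    have split: "measure (mu a) A * measure (mu a) B - (\<integral>w. f w \<partial>mu a) * (\<integral>w. g w \<partial>mu a) =
      (measure (mu a) A - (\<integral>w. f w \<partial>mu a)) * measure (mu a) B + (\<integral>w. f w \<partial>mu a) * (measure (mu a) B - (\<integral>w. g w \<partial>mu a))"
      by (simp add: algebra_simps)
    have "\<bar>(measure (mu a) A - (\<integral>w. f w \<partial>mu a)) * measure (mu a) B\<bar> \<le> e * 1"
      unfolding abs_mult using dA e by (intro mult_mono) auto
    moreover have "\<bar>(\<integral>w. f w \<partial>mu a) * (measure (mu a) B - (\<integral>w. g w \<partial>mu a))\<bar> \<le> 1 * e"
      unfolding abs_mult using dB If e by (intro mult_mono) auto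
    ultimately have "\<bar>measure (mu a) A * measure (mu a) B - (\<integral>w. f w \<partial>mu a) * (\<integral>w. g w \<partial>mu a)\<bar> \<le> e * 1 + 1 * e"
      unfolding split by (intro order_trans[OF abs_triangle_ineq] add_mono)
    then show ?thesis by simp
  qed
  ultimately show ?thesis using f(1) g(1) by blast
qed

lemma continuous_correlation:
  fixes f g :: "torus \<Rightarrow> real"
  assumes f: "continuous_on UNIV f" and g: "continuous_on UNIV g"
  shows "continuous_on UNIV (\<lambda>t. \<integral>w. f (Phi v a t w) * g w \<partial>mu a)"
proof -
  obtain F where F: "F > 0" "\<And>w. norm (f w) \<le> F" using torus_bounded[OF f] by metis
  obtain G where G: "G > 0" "\<And>w. norm (g w) \<le> G" using torus_bounded[OF g] by metis
  have 1: "continuous_on UNIV (\<lambda>p. f (Phi v a (fst p) (snd p)))"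
    by (rule continuous_on_compose2[OF f]) (auto intro!: continuous_intros)
  have 2: "continuous_on UNIV (\<lambda>p :: real \<times> torus. g (snd p))"
    by (rule continuous_on_compose2[OF g]) (auto intro!: continuous_intros)
  have "continuous_on UNIV (\<lambda>t. \<integral>w. complex_of_real (phi a w * (f (Phi v a t w) * g w)) \<partial>haar)"
  proof (rule continuous_on_integral_haar[where B = "3/2 * (F * G)"])
    show "continuous_on UNIV (\<lambda>p. complex_of_real (phi a (snd p) * (f (Phi v a (fst p) (snd p)) * g (snd p))))"
      by (intro continuous_on_of_real continuous_on_mult 1 2 continuous_on_phi continuous_intros)
    show "cmod (complex_of_real (phi a w * (f (Phi v a t w) * g w))) \<le> 3/2 * (F * G)" for t w
      unfolding norm_of_real abs_mult using phi_bounds[of a w] F G by (intro mult_mono) (auto simp: abs_mult)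
  qed
  from continuous_on_Re[OF this]
  have "continuous_on UNIV (\<lambda>t. \<integral>w. phi a w * (f (Phi v a t w) * g w) \<partial>haar)"
    unfolding integral_complex_of_real Re_complex_of_real .
  moreover have "(\<integral>w. f (Phi v a t w) * g w \<partial>mu a) = (\<integral>w. phi a w * (f (Phi v a t w) * g w) \<partial>haar)" for t
    by (subst integral_mu) (auto intro!: borel_measurable_continuous_onI continuous_on_mult continuous_on_Phi_w f g)
  ultimately show ?thesis by simp
qed

lemma weakly_mixing_Phi:
  assumes chars: "\<And>k k'. k \<in> lat \<Longrightarrow> k' \<in> lat \<Longrightarrow>
      (\<lambda>j. \<integral>w. tchi k (Phi v a (\<tau> j) w) * tchi k' w \<partial>mu a) \<longlonglongrightarrow> (\<integral>w. tchi k w \<partial>mu a) * (\<integral>w. tchi k' w \<partial>mu a)"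
  shows "weakly_mixing (Phi v a) (mu a)"
proof (rule weakly_mixing_of_sequence[where \<tau> = \<tau>])
  show "invariant_prob (Phi v a) (mu a)" by (rule invariant_prob_mu)
  show "Phi v a (s + t) z = Phi v a s (Phi v a t z)" for s t z by (rule Phi_add)
  fix A B assume "A \<in> sets (mu a)" "B \<in> sets (mu a)"
  then have A: "A \<in> sets borel" "B \<in> sets borel" by simp_all
  define Q where "Q n f g \<longleftrightarrow> continuous_on UNIV f \<and> continuous_on UNIV g \<and>
    (\<forall>t. \<bar>measure (mu a) (Phi v a t -` A \<inter> B) - (\<integral>w. f (Phi v a t w) * g w \<partial>mu a)\<bar> \<le> 2 * (1 / real (Suc n))) \<and>
    \<bar>measure (mu a) A * measure (mu a) B - (\<integral>w. f w \<partial>mu a) * (\<integral>w. g w \<partial>mu a)\<bar> \<le> 2 * (1 / real (Suc n))"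
    for n :: nat and f g :: "torus \<Rightarrow> real"
  have "\<exists>f g. Q n f g" for n
    unfolding Q_def by (rule approx_correlation[OF A]) simp
  then obtain f g where Q: "\<And>n. Q n (f n) (g n)" by metis
  have fg1: "continuous_on UNIV (f n)" for n using Q[of n] unfolding Q_def by (elim conjE)
  have fg2: "continuous_on UNIV (g n)" for n using Q[of n] unfolding Q_def by (elim conjE)
  have fg3: "\<bar>measure (mu a) (Phi v a t -` A \<inter> B) - (\<integral>w. f n (Phi v a t w) * g n w \<partial>mu a)\<bar> \<le> 2 * (1 / real (Suc n))" for n t
    using Q[of n] unfolding Q_def by (elim conjE) (erule spec)
  have fg4: "\<bar>measure (mu a) A * measure (mu a) B - (\<integral>w. f n w \<partial>mu a) * (\<integral>w. g n w \<partial>mu a)\<bar> \<le> 2 * (1 / real (Suc n))" for n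
    using Q[of n] unfolding Q_def by (elim conjE)
  show "continuous_on UNIV (\<lambda>t. measure (mu a) (Phi v a t -` A \<inter> B))"
  proof (rule uniform_limit_theorem)
    show "\<forall>\<^sub>F n in sequentially. continuous_on UNIV (\<lambda>t. \<integral>w. f n (Phi v a t w) * g n w \<partial>mu a)"
      by (intro always_eventually allI continuous_correlation fg1 fg2)
    show "uniform_limit UNIV (\<lambda>n t. \<integral>w. f n (Phi v a t w) * g n w \<partial>mu a) (\<lambda>t. measure (mu a) (Phi v a t -` A \<inter> B)) sequentially"
    proof (rule uniform_limitI)
      fix e :: real assume "e > 0"
      have "(\<lambda>n. 2 * (1 / real (Suc n))) \<longlonglongrightarrow> 2 * 0" by (intro tendsto_intros LIMSEQ_Suc[OF lim_1_over_n])
      then have "\<forall>\<^sub>F n in sequentially. 2 * (1 / real (Suc n)) < e" using \<open>e > 0\<close> by (intro order_tendstoD(2)) auto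
      then show "\<forall>\<^sub>F n in sequentially. \<forall>t\<in>UNIV. dist (\<integral>w. f n (Phi v a t w) * g n w \<partial>mu a) (measure (mu a) (Phi v a t -` A \<inter> B)) < e"
      proof (eventually_elim, intro ballI)
        fix n t assume "2 * (1 / real (Suc n)) < e"
        then show "dist (\<integral>w. f n (Phi v a t w) * g n w \<partial>mu a) (measure (mu a) (Phi v a t -` A \<inter> B)) < e"
          using fg3[where t = t and n = n] by (simp only: dist_real_def abs_minus_commute)
      qed
    qed
  qed simp
  show "(\<lambda>j. measure (mu a) (Phi v a (\<tau> j) -` A \<inter> B)) \<longlonglongrightarrow> measure (mu a) A * measure (mu a) B"
  proof (rule LIMSEQ_I)
    fix e :: real assume e: "e > 0"
    have "(\<lambda>n. 2 * (1 / real (Suc n))) \<longlonglongrightarrow> 2 * 0" by (intro tendsto_intros LIMSEQ_Suc[OF lim_1_over_n])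
    then have "\<forall>\<^sub>F n in sequentially. 2 * (1 / real (Suc n)) < e / 3" using e by (intro order_tendstoD(2)) auto
    from eventually_sequentially_ex[OF this] obtain n where n: "2 * (1 / real (Suc n)) < e / 3" by blast
    have "(\<lambda>j. \<integral>w. complex_of_real (f n (Phi v a (\<tau> j) w)) * complex_of_real (g n w) \<partial>mu a) \<longlonglongrightarrow>
        (\<integral>w. complex_of_real (f n w) \<partial>mu a) * (\<integral>w. complex_of_real (g n w) \<partial>mu a)"
      by (intro mixing_continuous[OF chars] continuous_on_of_real fg1 fg2)
    from tendsto_Re[OF this]
    have "(\<lambda>j. \<integral>w. f n (Phi v a (\<tau> j) w) * g n w \<partial>mu a) \<longlonglongrightarrow> (\<integral>w. f n w \<partial>mu a) * (\<integral>w. g n w \<partial>mu a)"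
      by (simp flip: of_real_mult)
    from LIMSEQ_D[OF this, of "e / 3"] e obtain N where
      N: "\<forall>j\<ge>N. norm ((\<integral>w. f n (Phi v a (\<tau> j) w) * g n w \<partial>mu a) - (\<integral>w. f n w \<partial>mu a) * (\<integral>w. g n w \<partial>mu a)) < e / 3" by auto
    have "norm (measure (mu a) (Phi v a (\<tau> j) -` A \<inter> B) - measure (mu a) A * measure (mu a) B) < e" if "j \<ge> N" for j
    proof -
      have "\<bar>(\<integral>w. f n (Phi v a (\<tau> j) w) * g n w \<partial>mu a) - (\<integral>w. f n w \<partial>mu a) * (\<integral>w. g n w \<partial>mu a)\<bar> < e / 3"
        using N that by simp
      then show ?thesis using fg3[where t = "\<tau> j" and n = n] fg4[of n] n unfolding real_norm_def by linarith
    qed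
    then show "\<exists>N. \<forall>j\<ge>N. norm (measure (mu a) (Phi v a (\<tau> j) -` A \<inter> B) - measure (mu a) A * measure (mu a) B) < e" by blast
  qed
qed

section \<open>Unique ergodicity and the generic parameter\<close>

text \<open>For an invariant \<open>M\<close> the prime average of \<open>F\<close> has the same
  \<open>M\<close>-integral as \<open>F\<close>, while it is uniformly close to the constant
  \<open>\<integral>w. F w \<partial>mu a\<close>.\<close>

lemma unique_invariant_prob_Phi:
  assumes N: "\<And>j. j \<le> N j" and eq: "\<And>f. continuous_on UNIV f \<Longrightarrow> equidist N v a f"
  shows "unique_invariant_prob (Phi v a) (mu a)"
  unfolding unique_invariant_prob_def
proof (intro conjI allI impI)
  show "invariant_prob (Phi v a) (mu a)" by (rule invariant_prob_mu)
  fix M assume M: "invariant_prob (Phi v a) M"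
  then have P: "prob_space M" and sM: "sets M = sets borel" and
    inv: "\<And>t. Phi v a t \<in> measurable M M" "\<And>t. distr M M (Phi v a t) = M"
    by (auto simp: invariant_prob_def)
  interpret M: prob_space M by (rule P)
  show "M = mu a"
  proof (rule measure_eqI_continuous)
    show "finite_measure M" by (rule M.finite_measure_axioms)
    show "finite_measure (mu a)" by (rule prob_space.finite_measure[OF prob_space_mu])
    fix f :: "torus \<Rightarrow> real" assume f: "continuous_on UNIV f"
    define F where "F w = complex_of_real (f w)" for w
    have F: "continuous_on UNIV F" unfolding F_def by (intro continuous_on_of_real f)
    note Mi = continuous_integrable[OF _ M.finite_measure_axioms sM]
    have FM: "(\<integral>w. F (Phi v a t w) \<partial>M) = (\<integral>w. F w \<partial>M)" for t
      using integral_distr[OF inv(1)[of t], of F] borel_measurable_integrable[OF Mi[OF F]] by (simp add: inv(2))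
    have "cmod ((\<integral>w. F w \<partial>M) - (\<integral>w. F w \<partial>mu a)) \<le> e" if e: "e > 0" for e
    proof -
      have "\<forall>\<^sub>F l in sequentially. \<forall>w. cmod (prime_avg (N l) (\<lambda>p. F (Phi v a (real p) w)) - (\<integral>w. F w \<partial>mu a)) < e"
        using eq[OF F] e unfolding equidist_def by blast
      then have "\<forall>\<^sub>F l in sequentially. 3 \<le> l \<and> (\<forall>w. cmod (prime_avg (N l) (\<lambda>p. F (Phi v a (real p) w)) - (\<integral>w. F w \<partial>mu a)) < e)"
        by (intro eventually_conj eventually_ge_at_top)
      from eventually_sequentially_ex[OF this] obtain l where l: "3 \<le> l"
        "\<forall>w. cmod (prime_avg (N l) (\<lambda>p. F (Phi v a (real p) w)) - (\<integral>w. F w \<partial>mu a)) < e" by blast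
      \<comment> \<open>This is why \<open>3 \<le> l\<close> was demanded: the average must run over
        at least one prime.\<close>
      have "2 \<in> {p :: nat. prime p \<and> p < N l}" using l(1) N[of l] by simp
      then have pos: "prime_count (N l) > 0"
        unfolding prime_count_def using finite_primes_below card_gt_0_iff by blast
      have c: "continuous_on UNIV (\<lambda>w. prime_avg (N l) (\<lambda>p. F (Phi v a (real p) w)))"
        unfolding prime_avg_def divide_inverse by (intro continuous_on_mult continuous_on_sum continuous_on_const continuous_on_Phi_w F)
      have "(\<integral>w. prime_avg (N l) (\<lambda>p. F (Phi v a (real p) w)) \<partial>M) = prime_avg (N l) (\<lambda>p. \<integral>w. F w \<partial>M)"
        unfolding prime_avg_def using Mi[OF continuous_on_Phi_w[OF F]] by (simp add: FM)
      then have "(\<integral>w. F w \<partial>M) - (\<integral>w. F w \<partial>mu a) = (\<integral>w. prime_avg (N l) (\<lambda>p. F (Phi v a (real p) w)) - (\<integral>w. F w \<partial>mu a) \<partial>M)"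
        using Mi[OF c] M.prob_space by (simp add: prime_avg_const[OF pos])
      also have "cmod \<dots> \<le> e"
        using spec[OF l(2)] by (intro norm_integral_le[OF P] Mi continuous_on_diff c continuous_on_const less_imp_le)
      finally show ?thesis .
    qed
    then have "cmod ((\<integral>w. F w \<partial>M) - (\<integral>w. F w \<partial>mu a)) \<le> 0" by (rule field_le_epsilon[of _ 0, simplified])
    then show "integral\<^sup>L M f = integral\<^sup>L (mu a) f" by (simp add: F_def)
  qed (simp_all add: sM)
qed

lemma prime_sequence:
  assumes "\<And>j. (v, a) \<in> prime_set j"
  shows "\<exists>N. strict_mono N \<and> (\<forall>f. continuous_on UNIV f \<longrightarrow> equidist N v a f)"
proof -
  define good where "good j N \<longleftrightarrow> j \<le> N \<and> (\<forall>k\<in>lat_box j. \<forall>w.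
     cmod (prime_avg N (\<lambda>p. tchi k (Phi v a (real p) w)) - (\<integral>w. tchi k w \<partial>mu a)) < 1 / (real j + 1))" for j N
  have "\<exists>N. good j N" for j using assms[of j] by (auto simp: prime_set_def good_def)
  then obtain P where P: "\<And>j. good j (P j)" by metis
  \<comment> \<open>The cutoffs given by the open sets need not increase. As
    \<open>P j \<ge> j\<close>, evaluating \<open>P\<close> beyond the previous value forces strict
    growth, and \<open>good\<close> for a large index implies it for smaller ones.\<close>
  define N where "N = rec_nat (P 0) (\<lambda>_ m. P (Suc m))"
  have N_Suc: "N (Suc k) = P (Suc (N k))" for k by (simp add: N_def)
  have mono: "strict_mono N"
    unfolding strict_mono_Suc_iff N_Suc using P[of "Suc _"] by (auto simp: good_def Suc_le_eq)
  have box: "lat_box i \<subseteq> lat_box j" if "i \<le> j" for i j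
    unfolding lat_box_def using that by (intro image_mono Sigma_mono) auto
  have good_mono: "good i m" if "good j m" "i \<le> j" for i j m
    unfolding good_def
  proof (intro conjI ballI allI)
    show "i \<le> m" using that by (simp add: good_def)
    fix k w assume "k \<in> lat_box i"
    then have "cmod (prime_avg m (\<lambda>p. tchi k (Phi v a (real p) w)) - (\<integral>w. tchi k w \<partial>mu a)) < 1 / (real j + 1)"
      using that box[OF that(2)] unfolding good_def by blast
    also have "\<dots> \<le> 1 / (real i + 1)" using that(2) by (simp add: frac_le)
    finally show "cmod (prime_avg m (\<lambda>p. tchi k (Phi v a (real p) w)) - (\<integral>w. tchi k w \<partial>mu a)) < 1 / (real i + 1)" .
  qed
  have good_N: "good k (N k)" for k
  proof (cases k)
    case 0
    then show ?thesis using P[of 0] by (simp add: N_def)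
  next
    case (Suc k')
    then show ?thesis
      using good_mono[OF P[of "Suc (N k')"], of k] strict_mono_imp_increasing[OF mono, of k'] by (simp add: N_Suc)
  qed
  have "equidist N v a (tchi k)" if k: "k \<in> lat" for k
    unfolding equidist_def
  proof (intro allI impI)
    fix e :: real assume e: "e > 0"
    obtain j0 where j0: "\<forall>j\<ge>j0. k \<in> lat_box j" using lat_box_exhaust[OF k] by blast
    have "(\<lambda>j. 1 / real (Suc j)) \<longlonglongrightarrow> 0" by (rule LIMSEQ_Suc[OF lim_1_over_n])
    then have "\<forall>\<^sub>F j in sequentially. 1 / real (Suc j) < e" using e by (rule order_tendstoD(2))
    then show "\<forall>\<^sub>F j in sequentially. \<forall>w. cmod (prime_avg (N j) (\<lambda>p. tchi k (Phi v a (real p) w)) - (\<integral>w. tchi k w \<partial>mu a)) < e"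
      using eventually_ge_at_top[of j0]
    proof (eventually_elim, intro allI)
      fix j w assume j: "1 / real (Suc j) < e" "j0 \<le> j"
      then have "k \<in> lat_box j" using j0 by blast
      then have "cmod (prime_avg (N j) (\<lambda>p. tchi k (Phi v a (real p) w)) - (\<integral>w. tchi k w \<partial>mu a)) < 1 / (real j + 1)"
        using good_N[of j] unfolding good_def by blast
      then show "cmod (prime_avg (N j) (\<lambda>p. tchi k (Phi v a (real p) w)) - (\<integral>w. tchi k w \<partial>mu a)) < e"
        using j(1) by (simp add: add.commute)
    qed
  qed
  then show ?thesis using mono tchi.equidist_all by blast
qed

lemma mixing_sequence:
  assumes "\<And>j. (v, a) \<in> mixing_set j" and pos: "fst v > 0" "snd v > 0"
  shows "weakly_mixing (Phi v a) (mu a)"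
proof -
  have "\<exists>t::nat. \<forall>k\<in>lat_box j. \<forall>k'\<in>lat_box j.
      cmod ((\<integral>w. tchi k (Phi v a (real t) w) * tchi k' w \<partial>mu a) -
         (\<integral>w. tchi k w \<partial>mu a) * (\<integral>w. tchi k' w \<partial>mu a)) < 1 / (real j + 1)" for j
    using assms(1)[of j] pos by (auto simp: mixing_set_def)
  then obtain t :: "nat \<Rightarrow> nat" where t: "\<forall>j. \<forall>k\<in>lat_box j. \<forall>k'\<in>lat_box j.
      cmod ((\<integral>w. tchi k (Phi v a (real (t j)) w) * tchi k' w \<partial>mu a) -
         (\<integral>w. tchi k w \<partial>mu a) * (\<integral>w. tchi k' w \<partial>mu a)) < 1 / (real j + 1)" by metis
  show ?thesis
  proof (rule weakly_mixing_Phi[where \<tau> = "\<lambda>j. real (t j)"])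
    fix k k' assume k: "k \<in> lat" "k' \<in> lat"
    let ?D = "\<lambda>j. (\<integral>w. tchi k (Phi v a (real (t j)) w) * tchi k' w \<partial>mu a) - (\<integral>w. tchi k w \<partial>mu a) * (\<integral>w. tchi k' w \<partial>mu a)"
    obtain j0 j1 where j0: "\<forall>j\<ge>j0. k \<in> lat_box j" "\<forall>j\<ge>j1. k' \<in> lat_box j"
      using lat_box_exhaust[OF k(1)] lat_box_exhaust[OF k(2)] by blast
    have lim: "(\<lambda>j. 1 / real (Suc j)) \<longlonglongrightarrow> 0" by (rule LIMSEQ_Suc[OF lim_1_over_n])
    have "?D \<longlonglongrightarrow> 0"
    proof (rule Lim_null_comparison[OF _ lim])
      show "\<forall>\<^sub>F j in sequentially. norm (?D j) \<le> 1 / real (Suc j)"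
        using eventually_ge_at_top[of "max j0 j1"]
      proof eventually_elim
        case (elim j)
        then have "k \<in> lat_box j" "k' \<in> lat_box j" using j0 by auto
        then have "norm (?D j) < 1 / (real j + 1)" using t by blast
        then show ?case by (simp add: add.commute)
      qed
    qed
    then show "(\<lambda>j. \<integral>w. tchi k (Phi v a (real (t j)) w) * tchi k' w \<partial>mu a) \<longlonglongrightarrow> (\<integral>w. tchi k w \<partial>mu a) * (\<integral>w. tchi k' w \<partial>mu a)"
      by (simp only: LIM_zero_iff)
  qed
qed

text \<open>Each slope to be avoided contributes one more open dense set. The dense intersection is
  then met with the open positive quadrant, where the trivial alternatives in
  \<open>mixing_set\<close> cannot occur.\<close>

lemma generic_point:
  assumes "countable S"
  shows "\<exists>v a. fst v > 0 \<and> snd v > 0 \<and> (\<forall>j. (v, a) \<in> prime_set j \<and> (v, a) \<in> mixing_set j) \<and> (\<forall>\<alpha>\<in>S. snd v \<noteq> \<alpha> * fst v)"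
proof -
  define G where "G \<alpha> = {x :: (real \<times> real) \<times> (nat \<Rightarrow> real). snd (fst x) \<noteq> \<alpha> * fst (fst x)}" for \<alpha>
  define \<G> where "\<G> = range prime_set \<union> range mixing_set \<union> G ` S"
  have G_open: "open (G \<alpha>)" for \<alpha>
    unfolding G_def by (intro open_Collect_neq continuous_intros)
  have G_dense: "U \<inter> G \<alpha> \<noteq> {}" if U: "open U" "x \<in> U" for U x \<alpha>
  proof -
    let ?f = "\<lambda>d. ((fst (fst x), snd (fst x) + d), snd x)"
    have "open (?f -` U)" using U(1) by (intro open_vimage continuous_intros)
    moreover have "0 \<in> ?f -` U" using U(2) by simp
    ultimately obtain d where d: "d > 0" "\<And>e. dist e 0 < d \<Longrightarrow> ?f e \<in> U" unfolding open_dist by blast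
    have "?f 0 \<in> U" using U(2) by simp
    moreover have "?f (d / 2) \<in> U" using d(1) by (intro d(2)) simp
    moreover have "?f 0 \<in> G \<alpha> \<or> ?f (d / 2) \<in> G \<alpha>" using d(1) by (auto simp: G_def)
    ultimately show ?thesis by blast
  qed
  have "euclidean closure_of \<Inter>\<G> = topspace (euclidean :: ((real \<times> real) \<times> (nat \<Rightarrow> real)) topology)"
  proof (rule Baire_category)
    show "completely_metrizable_space (euclidean :: ((real \<times> real) \<times> (nat \<Rightarrow> real)) topology) \<or>
        locally_compact_space (euclidean :: ((real \<times> real) \<times> (nat \<Rightarrow> real)) topology) \<and> regular_space (euclidean :: ((real \<times> real) \<times> (nat \<Rightarrow> real)) topology)"
      using completely_metrizable_space_euclidean by blast
    show "countable \<G>" unfolding \<G>_def using assms by auto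
    fix T assume "T \<in> \<G>"
    then consider j where "T = prime_set j" | j where "T = mixing_set j" | \<alpha> where "T = G \<alpha>"
      unfolding \<G>_def by (elim UnE imageE) simp_all
    then have T: "open T \<and> (\<forall>U x. open U \<longrightarrow> x \<in> U \<longrightarrow> U \<inter> T \<noteq> {})"
    proof cases
      case 1 then show ?thesis using open_prime_set[of j] dense_prime_set[of _ _ j] by simp
    next
      case 2 then show ?thesis using open_mixing_set[of j] dense_mixing_set[of _ _ j] by simp
    next
      case 3 then show ?thesis using G_open[of \<alpha>] G_dense[of _ _ \<alpha>] by simp
    qed
    have "x \<in> closure T" for x
    proof (rule ccontr)
      assume "x \<notin> closure T"
      then have "- closure T \<inter> T \<noteq> {}" using T by (metis ComplI open_Compl closed_closure)
      then show False using closure_subset[of T] by blast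
    qed
    then have "closure T = UNIV" by (intro UNIV_eq_I[symmetric])
    then show "openin euclidean T \<and> euclidean closure_of T = topspace euclidean" using T by simp
  qed
  then have "closure (\<Inter>\<G>) = UNIV" by simp
  moreover define W where "W = {x :: (real \<times> real) \<times> (nat \<Rightarrow> real). fst (fst x) > 0} \<inter> {x. snd (fst x) > 0}"
  moreover have "open W" unfolding W_def by (intro open_Int open_Collect_less continuous_intros)
  moreover have "((1, 1), \<lambda>_. 0) \<in> W" by (simp add: W_def)
  ultimately have "W \<inter> \<Inter>\<G> \<noteq> {}" by (metis open_Int_closure_eq_empty Int_UNIV_right empty_iff)
  then obtain x where x: "x \<in> W" "x \<in> \<Inter>\<G>" by blast
  obtain v a where va: "x = (v, a)" by (cases x)
  have "(v, a) \<in> prime_set j" "(v, a) \<in> mixing_set j" for j using x(2) unfolding \<G>_def va by blast+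
  moreover have "snd v \<noteq> \<alpha> * fst v" if "\<alpha> \<in> S" for \<alpha>
  proof -
    have "(v, a) \<in> G \<alpha>" using x(2) that unfolding \<G>_def va by blast
    then show ?thesis by (simp add: G_def)
  qed
  moreover have "fst v > 0" "snd v > 0" using x(1) by (simp_all add: W_def va)
  ultimately show ?thesis by blast
qed

theorem theorem1:
  "uncountable {\<alpha> :: real. \<alpha> \<notin> \<rat> \<and>
     (\<exists>(r :: torus \<Rightarrow> real) (\<Phi> :: real \<Rightarrow> torus \<Rightarrow> torus) (\<mu> :: torus measure).
        smooth_on_torus r \<and> (\<forall>z. r z > 0) \<and>
        reparametrized_flow \<alpha> r \<Phi> \<and>
        unique_invariant_prob \<Phi> \<mu> \<and>
        weakly_mixing \<Phi> \<mu> \<and>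
        (\<exists>N :: nat \<Rightarrow> real. strict_mono N \<and> filterlim N at_top sequentially \<and>
           (\<forall>x :: torus. \<forall>g :: torus \<Rightarrow> complex. continuous_on UNIV g \<longrightarrow>
              (\<lambda>k. (\<Sum>p | prime p \<and> real p < N k. g (\<Phi> (real p) x))
                     / of_nat (card {p :: nat. prime p \<and> real p < N k}))
              \<longlonglongrightarrow> (\<integral>z. g z \<partial>\<mu>))))}"
  (is "uncountable ?S")
proof
  assume "countable ?S"
  \<comment> \<open>Putting the rationals among the forbidden slopes yields irrationality and the
    contradiction from the same generic point.\<close>
  then have "countable (?S \<union> \<rat>)" using countable_rat by (rule countable_Un)
  from generic_point[OF this] obtain v a where pos: "fst v > 0" "snd v > 0"
    and pm: "\<forall>j. (v, a) \<in> prime_set j \<and> (v, a) \<in> mixing_set j" and out: "\<forall>\<alpha>\<in>?S \<union> \<rat>. snd v \<noteq> \<alpha> * fst v"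
    by blast
  define \<alpha> where "\<alpha> = snd v / fst v"
  have "snd v = \<alpha> * fst v" using pos by (simp add: \<alpha>_def)
  then have \<alpha>: "\<alpha> \<notin> ?S" "\<alpha> \<notin> \<rat>" using out by blast+
  from pm prime_sequence[of v a] obtain N where N: "strict_mono N" "\<forall>f. continuous_on UNIV f \<longrightarrow> equidist N v a f"
    by blast
  have "smooth_on_torus (\<lambda>w. fst v / phi a w)" by (rule smooth_speed)
  moreover have "\<forall>z. fst v / phi a z > 0" using pos by simp
  moreover have "reparametrized_flow \<alpha> (\<lambda>w. fst v / phi a w) (Phi v a)"
    unfolding \<alpha>_def using pos by (intro reparametrized_flow_Phi) simp
  moreover have "unique_invariant_prob (Phi v a) (mu a)"
    using N by (intro unique_invariant_prob_Phi[of N]) (auto intro: strict_mono_imp_increasing)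
  moreover have "weakly_mixing (Phi v a) (mu a)" using pm pos by (intro mixing_sequence) auto
  moreover have "\<exists>N :: nat \<Rightarrow> real. strict_mono N \<and> filterlim N at_top sequentially \<and>
           (\<forall>x :: torus. \<forall>g :: torus \<Rightarrow> complex. continuous_on UNIV g \<longrightarrow>
              (\<lambda>k. (\<Sum>p | prime p \<and> real p < N k. g (Phi v a (real p) x))
                     / of_nat (card {p :: nat. prime p \<and> real p < N k}))
              \<longlonglongrightarrow> (\<integral>z. g z \<partial>mu a))"
  proof (intro exI[of _ "\<lambda>k. real (N k)"] conjI allI impI)
    show "strict_mono (\<lambda>k. real (N k))" using N(1) by (simp add: strict_mono_def)
    show "filterlim (\<lambda>k. real (N k)) at_top sequentially"
      by (rule filterlim_compose[OF filterlim_real_sequentially filterlim_subseq[OF N(1)]])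
    fix x and g :: "torus \<Rightarrow> complex" assume g: "continuous_on UNIV g"
    have "(\<lambda>k. prime_avg (N k) (\<lambda>p. g (Phi v a (real p) x))) \<longlonglongrightarrow> (\<integral>z. g z \<partial>mu a)"
    proof (rule tendstoI)
      fix e :: real assume "e > 0"
      then have "\<forall>\<^sub>F l in sequentially. \<forall>w. cmod (prime_avg (N l) (\<lambda>p. g (Phi v a (real p) w)) - (\<integral>w. g w \<partial>mu a)) < e"
        using N(2) g unfolding equidist_def by blast
      then show "\<forall>\<^sub>F k in sequentially. dist (prime_avg (N k) (\<lambda>p. g (Phi v a (real p) x))) (\<integral>z. g z \<partial>mu a) < e"
        by eventually_elim (metis dist_norm)
    qed
    then show "(\<lambda>k. (\<Sum>p | prime p \<and> real p < real (N k). g (Phi v a (real p) x))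
                     / of_nat (card {p :: nat. prime p \<and> real p < real (N k)})) \<longlonglongrightarrow> (\<integral>z. g z \<partial>mu a)"
      by (simp add: prime_avg_def prime_count_def)
  qed
  ultimately have "\<alpha> \<in> ?S" using \<alpha>(2) by blast
  with \<alpha>(1) show False ..
qed

end
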